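(* Let $T[1..n]$ be any text over an integer alphabet $\Sigma$ and let $\preceq_+\in\{\le_{\mathrm{lex}},\le_{\mathrm{pos}}\}$. Given a self-index version of the CDAWG of $T$ (without access to $T$), the quasi-irreducible $\mathrm{GLPF}_{\preceq_+}$ array of $T$, i.e. the set $\widetilde{\mathrm{GLPF}}=\{(\mathrm{pos}(S),\mathrm{GLPF}_{\preceq_+}[\mathrm{pos}(S)]) : S\in CS_+\}$ of at most $e$ pairs, can be constructed in $O(e)$ worst-case time using $O(e)$ words of space.
   Context: Let $\Sigma$ be an integer alphabet with total order $\le_\Sigma$ and $T=T[1..n]\in\Sigma^n$ a text whose last symbol $T[n]=\$$ occurs nowhere else and is smaller than every other symbol. For $p\in[n]$, $T_p=T[p..n]$; $\mathrm{Suf}(T)=\{T_1,\dots,T_n\}$; for a suffix $S$, $\mathrm{pos}(S)=n+1-|S|$. $\le_{\mathrm{lex}}$ is the lexicographic order; the text order is $X\le_{\mathrm{pos}}Y$ iff $|X|\ge|Y|$; $<$ denotes strict versions. $lcp(X,Y)$ is the length of the longest common prefix. The generalized longest previous factor array under $\preceq_+$ is $\mathrm{GLPF}_{\preceq_+}[p]=\max(\{lcp(T_p,T_q): q\in[n],\ T_q \prec_+ T_p\}\cup\{0\})$ for $p\in[n]$, where $\prec_+$ is the strict version of $\preceq_+$. The CDAWG $G$ of $T$ is the edge-labeled DAG obtained from the suffix tree of $T$ by merging isomorphic subtrees; it has a root and a sink, each edge $f=(v,X,w)$ goes from $v$ to $w$ with nonempty label $X$, outgoing edges of a node have distinct first symbols,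 and spelling root-to-sink paths is a bijection onto $\mathrm{Suf}(T)$. Its size $e$ is its number of edges plus its number of suffix links. For a node $v$, $N_-(v)$ and $N_+(v)$ are its incoming and outgoing edges, $U_-(v)$ is the set of strings spelled by root-to-$v$ paths and $U_+(v)$ the set of strings spelled by $v$-to-sink paths. The self-index version of the CDAWG is an $O(e)$-word representation of $G$ from which edge labels can be recovered without accessing $T$. Let $\preceq_-=\le_{\mathrm{pos}}$. For $\delta\in\{-,+\}$, $\mathrm{repr}_\delta(v)=\min_{\preceq_\delta}U_\delta(v)$ (strings are identified with the unique path spelling them). An edge of $N_-(v)$ is $(-)$-primary if it is the last edge of the path spelling $\mathrm{repr}_-(v)$; an edge of $N_+(v)$ is $(+)$-primary if it is the first edge of the path spelling $\mathrm{repr}_+(v)$. $EP_\delta$ is the set of $\delta$-primary edges and $ES_\delta=E\setminus EP_\delta$. A suffix $S$ with root-to-sink path $(f_1,\dots,f_\ell)$ is $(+)$-trivial if all its edges lie in $EP_+$ (exactly one such suffix exists). $S$ has a $(+)$-canonical factoring at index $k\in[\ell]$ if $f_1,\dots,f_{k-1}\in EP_-$, $f_k\in ES_+$ and $f_{k+1},\dots,f_\ell\in EP_+$. $S$ is $(+)$-canonical if it is $(+)$-trivial or has a $(+)$-canonical factoring; $CS_+$ is the set of $(+)$-canonical suffixes (these are defined with respect to $\preceq_+$). *)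

theory Defs
  imports Main "HOL-Library.Sublist"
begin

section \<open>Texts, suffixes, orders and the GLPF array\<close>

text \<open>Symbols are natural numbers in their usual order. Lists are indexed from 0, text positions
  from 1.\<close>

definition terminated_text :: "nat list \<Rightarrow> bool" where
  "terminated_text T \<longleftrightarrow> T \<noteq> [] \<and> (\<forall>x\<in>set (butlast T). last T < x)"

definition suffix_at :: "nat list \<Rightarrow> nat \<Rightarrow> nat list" where
  "suffix_at T p = drop (p - 1) T"

definition Suf :: "nat list \<Rightarrow> nat list set" where
  "Suf T = suffix_at T ` {1..length T}"

definition pos :: "nat list \<Rightarrow> nat list \<Rightarrow> nat" where
  "pos T S = length T + 1 - length S"

definition le_lex :: "nat list \<Rightarrow> nat list \<Rightarrow> bool" where
  "le_lex = ord_class.lexordp_eq"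

definition le_pos :: "nat list \<Rightarrow> nat list \<Rightarrow> bool" where
  "le_pos X Y \<longleftrightarrow> length X \<ge> length Y"

definition strict :: "('b \<Rightarrow> 'b \<Rightarrow> bool) \<Rightarrow> 'b \<Rightarrow> 'b \<Rightarrow> bool" where
  "strict le x y \<longleftrightarrow> le x y \<and> \<not> le y x"

definition lcp :: "nat list \<Rightarrow> nat list \<Rightarrow> nat" where
  "lcp X Y = length (longest_common_prefix X Y)"

definition GLPF :: "(nat list \<Rightarrow> nat list \<Rightarrow> bool) \<Rightarrow> nat list \<Rightarrow> nat \<Rightarrow> nat" where
  "GLPF le T p =
     Max ({lcp (suffix_at T p) (suffix_at T q) | q.
             q \<in> {1..length T} \<and> strict le (suffix_at T q) (suffix_at T p)} \<union> {0})"

section \<open>Edge-labelled graphs\<close>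

type_synonym 'v edge = "'v \<times> nat list \<times> 'v"

definition src :: "'v edge \<Rightarrow> 'v" where "src f = fst f"
definition lab :: "'v edge \<Rightarrow> nat list" where "lab f = fst (snd f)"
definition tgt :: "'v edge \<Rightarrow> 'v" where "tgt f = snd (snd f)"

fun path :: "'v edge set \<Rightarrow> 'v \<Rightarrow> 'v edge list \<Rightarrow> 'v \<Rightarrow> bool" where
  "path E v [] w \<longleftrightarrow> v = w"
| "path E v (f # fs) w \<longleftrightarrow> f \<in> E \<and> src f = v \<and> path E (tgt f) fs w"

definition spell :: "'v edge list \<Rightarrow> nat list" where
  "spell fs = concat (map lab fs)"

section \<open>The suffix tree\<close>

text \<open>A vertex of the suffix tree is identified with the string spelled from the root to it. The
  root is a vertex even if it is not branching, which happens for texts of length 1.\<close>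

definition st_nodes :: "nat list \<Rightarrow> nat list set" where
  "st_nodes T = {[]} \<union> Suf T \<union>
     {U. \<exists>a b. a \<noteq> b \<and> sublist (U @ [a]) T \<and> sublist (U @ [b]) T}"

definition st_edges :: "nat list \<Rightarrow> nat list edge set" where
  "st_edges T = {(U, X, W). U \<in> st_nodes T \<and> W \<in> st_nodes T \<and> X \<noteq> [] \<and> W = U @ X \<and>
     (\<forall>Y. strict_prefix Y X \<and> Y \<noteq> [] \<longrightarrow> U @ Y \<notin> st_nodes T)}"

definition st_subtree :: "nat list \<Rightarrow> nat list \<Rightarrow> nat list set" where
  "st_subtree T U = {W. (U, W) \<in> {(A, B). \<exists>X. (A, X, B) \<in> st_edges T}\<^sup>*}"

definition st_iso :: "nat list \<Rightarrow> nat list \<Rightarrow> nat list \<Rightarrow> bool" where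
  "st_iso T U V \<longleftrightarrow> (\<exists>\<phi>. bij_betw \<phi> (st_subtree T U) (st_subtree T V) \<and> \<phi> U = V \<and>
     (\<forall>A\<in>st_subtree T U. \<forall>B\<in>st_subtree T U. \<forall>X.
        (A, X, B) \<in> st_edges T \<longleftrightarrow> (\<phi> A, X, \<phi> B) \<in> st_edges T))"

section \<open>The CDAWG\<close>

definition cls :: "nat list \<Rightarrow> nat list \<Rightarrow> nat list set" where
  "cls T U = {V \<in> st_nodes T. st_iso T U V}"

definition nodes :: "nat list \<Rightarrow> nat list set set" where
  "nodes T = cls T ` st_nodes T"

definition edges :: "nat list \<Rightarrow> nat list set edge set" where
  "edges T = {(cls T U, X, cls T W) | U X W. (U, X, W) \<in> st_edges T}"

definition root :: "nat list \<Rightarrow> nat list set" where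
  "root T = cls T []"

text \<open>All leaves of the suffix tree are merged into a single vertex.\<close>

definition sink :: "nat list \<Rightarrow> nat list set" where
  "sink T = cls T T"

text \<open>The suffix link of a suffix tree vertex \<open>a U\<close> leads to \<open>U\<close>. Merging turns the links inside a
  class into self-loops, which are dropped; exactly one link leaves each class other than the
  root.\<close>

definition suffix_links :: "nat list \<Rightarrow> (nat list set \<times> nat list set) set" where
  "suffix_links T = {(cls T U, cls T (tl U)) | U.
     U \<in> st_nodes T \<and> U \<noteq> [] \<and> cls T U \<noteq> cls T (tl U)}"

definition cdawg_size :: "nat list \<Rightarrow> nat" where
  "cdawg_size T = card (edges T) + card (suffix_links T)"

definition U_minus :: "nat list \<Rightarrow> nat list set \<Rightarrow> nat list set" where
  "U_minus T v = {spell fs | fs. path (edges T) (root T) fs v}"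

definition U_plus :: "nat list \<Rightarrow> nat list set \<Rightarrow> nat list set" where
  "U_plus T v = {spell fs | fs. path (edges T) v fs (sink T)}"

definition min_wrt :: "('b \<Rightarrow> 'b \<Rightarrow> bool) \<Rightarrow> 'b set \<Rightarrow> 'b" where
  "min_wrt le A = (THE m. m \<in> A \<and> (\<forall>x\<in>A. le m x))"

definition repr_minus :: "nat list \<Rightarrow> nat list set \<Rightarrow> nat list" where
  "repr_minus T v = min_wrt le_pos (U_minus T v)"

definition repr_plus ::
  "(nat list \<Rightarrow> nat list \<Rightarrow> bool) \<Rightarrow> nat list \<Rightarrow> nat list set \<Rightarrow> nat list" where
  "repr_plus le T v = min_wrt le (U_plus T v)"

definition EP_minus :: "nat list \<Rightarrow> nat list set edge set" where
  "EP_minus T = {last fs | fs v.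
     path (edges T) (root T) fs v \<and> fs \<noteq> [] \<and> spell fs = repr_minus T v}"

definition EP_plus ::
  "(nat list \<Rightarrow> nat list \<Rightarrow> bool) \<Rightarrow> nat list \<Rightarrow> nat list set edge set" where
  "EP_plus le T = {hd fs | fs v.
     path (edges T) v fs (sink T) \<and> fs \<noteq> [] \<and> spell fs = repr_plus le T v}"

definition ES_plus ::
  "(nat list \<Rightarrow> nat list \<Rightarrow> bool) \<Rightarrow> nat list \<Rightarrow> nat list set edge set" where
  "ES_plus le T = edges T - EP_plus le T"

definition trivial_path ::
  "(nat list \<Rightarrow> nat list \<Rightarrow> bool) \<Rightarrow> nat list \<Rightarrow> nat list set edge list \<Rightarrow> bool" where
  "trivial_path le T fs \<longleftrightarrow> set fs \<subseteq> EP_plus le T"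

definition canonical_factoring_at ::
  "(nat list \<Rightarrow> nat list \<Rightarrow> bool) \<Rightarrow> nat list \<Rightarrow> nat list set edge list \<Rightarrow> nat \<Rightarrow> bool" where
  "canonical_factoring_at le T fs k \<longleftrightarrow> k \<in> {1..length fs} \<and>
     set (take (k - 1) fs) \<subseteq> EP_minus T \<and>
     fs ! (k - 1) \<in> ES_plus le T \<and>
     set (drop k fs) \<subseteq> EP_plus le T"

definition CS_plus :: "(nat list \<Rightarrow> nat list \<Rightarrow> bool) \<Rightarrow> nat list \<Rightarrow> nat list set" where
  "CS_plus le T = {S \<in> Suf T. \<exists>fs. path (edges T) (root T) fs (sink T) \<and> spell fs = S \<and>
     (trivial_path le T fs \<or> (\<exists>k. canonical_factoring_at le T fs k))}"

definition quasi_irreducible_GLPF ::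
  "(nat list \<Rightarrow> nat list \<Rightarrow> bool) \<Rightarrow> nat list \<Rightarrow> (nat \<times> nat) set" where
  "quasi_irreducible_GLPF le T = {(pos T S, GLPF le T (pos T S)) | S. S \<in> CS_plus le T}"

section \<open>Self-index version of the CDAWG\<close>

text \<open>The representation is a sequence \<open>I\<close> of machine words. It starts with the header
    \<^item> \<open>I ! 0\<close>: the number of words of the representation,
    \<^item> \<open>I ! 1\<close>, \<open>I ! 2\<close>: the numbers of vertices and of edges,
    \<^item> \<open>I ! 3\<close>, \<open>I ! 4\<close>: the numbers of the root and of the sink,
    \<^item> \<open>I ! 5\<close>: the length of the text,
    \<^item> \<open>I ! 6\<close>, \<open>I ! 7\<close>: the addresses of the vertex table and of the edge table.

  The entry of a vertex consists of the number of its first outgoing edge, its out-degree and the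
  target of its suffix link (arbitrary for the root). The entry of an edge consists of the first
  symbol of its label, the length of its label, and its target. Vertices may be numbered in any order
  (\<open>\<nu>\<close>), and so may edges (\<open>\<eta>\<close>), except that those leaving the same vertex are consecutive. All
  other words of \<open>I\<close> are unconstrained, so that any additional data may be present. The labels
  themselves are not stored; \<open>self_index_determines_labels\<close> below shows that \<open>I\<close> determines them,
  and the text.\<close>

definition self_index_via ::
  "nat list \<Rightarrow> nat list \<Rightarrow> (nat \<Rightarrow> nat list set) \<Rightarrow> (nat \<Rightarrow> nat list set edge) \<Rightarrow> bool" where
  "self_index_via T I \<nu> \<eta> \<longleftrightarrow>
     length I \<ge> 8 \<and> I ! 0 = length I \<and>
     (let nv = I ! 1; ne = I ! 2; nt = I ! 6; et = I ! 7 in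
        bij_betw \<nu> {..<nv} (nodes T) \<and>
        bij_betw \<eta> {..<ne} (edges T) \<and>
        I ! 3 < nv \<and> \<nu> (I ! 3) = root T \<and>
        I ! 4 < nv \<and> \<nu> (I ! 4) = sink T \<and>
        I ! 5 = length T \<and>
        nt + 3 * nv \<le> length I \<and>
        et + 3 * ne \<le> length I \<and>
        (\<forall>v<nv.
           {i. i < ne \<and> src (\<eta> i) = \<nu> v} = {I ! (nt + 3 * v) ..< I ! (nt + 3 * v) + I ! (nt + 3 * v + 1)} \<and>
           (\<nu> v \<noteq> root T \<longrightarrow>
              I ! (nt + 3 * v + 2) < nv \<and> (\<nu> v, \<nu> (I ! (nt + 3 * v + 2))) \<in> suffix_links T)) \<and>
        (\<forall>i<ne.
           I ! (et + 3 * i) = hd (lab (\<eta> i)) \<and>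
           I ! (et + 3 * i + 1) = length (lab (\<eta> i)) \<and>
           I ! (et + 3 * i + 2) < nv \<and> \<nu> (I ! (et + 3 * i + 2)) = tgt (\<eta> i)))"

definition self_index :: "nat list \<Rightarrow> nat list \<Rightarrow> bool" where
  "self_index T I \<longleftrightarrow> (\<exists>\<nu> \<eta>. self_index_via T I \<nu> \<eta>)"

lemma st_iso_refl: "st_iso T U U"
  unfolding st_iso_def by (intro exI[of _ id]) auto

lemma st_iso_sym: assumes "st_iso T U V" shows "st_iso T V U"
proof -
  let ?S = "st_subtree T"
  obtain f where bij: "bij_betw f (?S U) (?S V)" and fU: "f U = V"
    and e: "\<forall>A\<in>?S U. \<forall>B\<in>?S U. \<forall>X. (A, X, B) \<in> st_edges T \<longleftrightarrow> (f A, X, f B) \<in> st_edges T"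
    using assms unfolding st_iso_def by blast
  let ?g = "inv_into (?S U) f"
  have U: "U \<in> ?S U" by (simp add: st_subtree_def)
  have g: "bij_betw ?g (?S V) (?S U)" using bij by (rule bij_betw_inv_into)
  have gV: "?g V = U" using bij_betw_inv_into_left[OF bij U] fU by simp
  have "(A, X, B) \<in> st_edges T \<longleftrightarrow> (?g A, X, ?g B) \<in> st_edges T" if "A \<in> ?S V" "B \<in> ?S V" for A B X
    using e[rule_format, of "?g A" "?g B" X] that bij_betw_apply[OF g] bij_betw_inv_into_right[OF bij] by simp
  then show ?thesis using g gV unfolding st_iso_def by blast
qed

lemma st_iso_trans: assumes "st_iso T U V" "st_iso T V W" shows "st_iso T U W"
proof -
  let ?S = "st_subtree T"
  obtain f where f: "bij_betw f (?S U) (?S V)" "f U = V"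
    and fe: "\<forall>A\<in>?S U. \<forall>B\<in>?S U. \<forall>X. (A, X, B) \<in> st_edges T \<longleftrightarrow> (f A, X, f B) \<in> st_edges T"
    using assms(1) unfolding st_iso_def by blast
  obtain g where g: "bij_betw g (?S V) (?S W)" "g V = W"
    and ge: "\<forall>A\<in>?S V. \<forall>B\<in>?S V. \<forall>X. (A, X, B) \<in> st_edges T \<longleftrightarrow> (g A, X, g B) \<in> st_edges T"
    using assms(2) unfolding st_iso_def by blast
  have "bij_betw (g \<circ> f) (?S U) (?S W)" using f g by (blast intro: bij_betw_trans)
  moreover have "(g \<circ> f) U = W" using f g by simp
  moreover have "\<forall>A\<in>?S U. \<forall>B\<in>?S U. \<forall>X.
      (A, X, B) \<in> st_edges T \<longleftrightarrow> ((g \<circ> f) A, X, (g \<circ> f) B) \<in> st_edges T"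
  proof (intro ballI allI)
    fix A B X assume "A \<in> ?S U" "B \<in> ?S U"
    then show "(A, X, B) \<in> st_edges T \<longleftrightarrow> ((g \<circ> f) A, X, (g \<circ> f) B) \<in> st_edges T"
      using fe[rule_format, of A B X] ge[rule_format, of "f A" "f B" X] bij_betw_apply[OF f(1)] by simp
  qed
  ultimately show ?thesis unfolding st_iso_def by blast
qed

lemma cls_eq_iff: assumes "U \<in> st_nodes T" "V \<in> st_nodes T"
  shows "cls T U = cls T V \<longleftrightarrow> st_iso T U V"
  using assms unfolding cls_def by (auto intro: st_iso_refl st_iso_sym st_iso_trans)

lemma st_edges_D: assumes "(U, X, W) \<in> st_edges T"
  shows "U \<in> st_nodes T" "W \<in> st_nodes T" "X \<noteq> []" "W = U @ X"
  using assms by (auto simp: st_edges_def)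

lemma st_iso_edge:
  assumes "st_iso T U V" "(U, X, W) \<in> st_edges T"
  shows "(V, X, V @ X) \<in> st_edges T" "st_iso T W (V @ X)"
proof -
  let ?S = "st_subtree T" and ?R = "{(A, B). \<exists>X. (A, X, B) \<in> st_edges T}"
  obtain f where bij: "bij_betw f (?S U) (?S V)" and fU: "f U = V"
    and e: "\<And>A B X. A \<in> ?S U \<Longrightarrow> B \<in> ?S U \<Longrightarrow> (A, X, B) \<in> st_edges T \<longleftrightarrow> (f A, X, f B) \<in> st_edges T"
    using assms unfolding st_iso_def by blast
  have U: "U \<in> ?S U" by (simp add: st_subtree_def)
  have W: "W \<in> ?S U" using assms(2) by (auto simp: st_subtree_def)
  have 1: "(V, X, f W) \<in> st_edges T" using e[OF U W] assms(2) fU by simp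
  then have fW: "f W = V @ X" by (rule st_edges_D)
  show "(V, X, V @ X) \<in> st_edges T" using 1 fW by simp
  have sub: "?S W \<subseteq> ?S U" using W by (auto simp: st_subtree_def)
  have fwd: "f B \<in> ?S (f W)" if "B \<in> ?S W" for B
  proof -
    have "(W, B) \<in> ?R\<^sup>*" using that by (simp add: st_subtree_def)
    then show ?thesis
    proof (induction)
      case base show ?case by (simp add: st_subtree_def)
    next
      case (step A B)
      obtain Y where Y: "(A, Y, B) \<in> st_edges T" using step by blast
      have A: "A \<in> ?S U" using step(1) sub by (auto simp: st_subtree_def)
      have "(W, B) \<in> ?R\<^sup>*" using step(1,2) by (rule rtrancl_into_rtrancl)
      then have B: "B \<in> ?S U" using sub by (auto simp: st_subtree_def)
      have "(f A, f B) \<in> ?R" using e[OF A B] Y by blast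
      then show ?case using step.IH by (auto simp: st_subtree_def intro: rtrancl_into_rtrancl)
    qed
  qed
  have bwd: "\<exists>A\<in>?S W. f A = B" if "B \<in> ?S (f W)" for B
  proof -
    have "(f W, B) \<in> ?R\<^sup>*" using that by (simp add: st_subtree_def)
    then show ?thesis
    proof (induction)
      case base show ?case by (auto simp: st_subtree_def)
    next
      case (step B C)
      obtain A where A: "A \<in> ?S W" "f A = B" using step by blast
      then have "B \<in> ?S V" using sub bij by (metis bij_betw_apply subsetD)
      then have "C \<in> ?S V" using step(2) by (auto simp: st_subtree_def intro: rtrancl_into_rtrancl)
      then obtain D where D: "D \<in> ?S U" "f D = C" using bij by (metis bij_betw_imp_surj_on imageE)
      obtain Y where "(f A, Y, f D) \<in> st_edges T" using step(2) A D by blast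
      then have "(A, Y, D) \<in> st_edges T" using e A D sub by blast
      then have "D \<in> ?S W" using A(1) by (auto simp: st_subtree_def intro: rtrancl_into_rtrancl)
      then show ?case using D by blast
    qed
  qed
  have "bij_betw f (?S W) (?S (f W))"
    using fwd bwd bij sub unfolding bij_betw_def by (auto intro: inj_on_subset)
  moreover have "\<forall>A\<in>?S W. \<forall>B\<in>?S W. \<forall>X. (A, X, B) \<in> st_edges T \<longleftrightarrow> (f A, X, f B) \<in> st_edges T"
    using e sub by blast
  ultimately show "st_iso T W (V @ X)" unfolding st_iso_def fW[symmetric] by blast
qed

lemma Suf_suffix: "S \<in> Suf T \<longleftrightarrow> S \<noteq> [] \<and> suffix S T"
proof
  assume "S \<in> Suf T"
  then show "S \<noteq> [] \<and> suffix S T" by (auto simp: Suf_def suffix_at_def suffix_drop)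
next
  assume a: "S \<noteq> [] \<and> suffix S T"
  then obtain R where R: "T = R @ S" by (auto simp: suffix_def)
  have "S = suffix_at T (length R + 1)" using R by (simp add: suffix_at_def)
  moreover have "length R + 1 \<in> {1..length T}" using R a by (cases S) auto
  ultimately show "S \<in> Suf T" unfolding Suf_def by blast
qed

lemma st_node_ext: assumes "U \<in> st_nodes T" "T \<noteq> []" shows "\<exists>S\<in>Suf T. prefix U S"
proof -
  consider "U = []" | "suffix U T" | a where "sublist (U @ [a]) T"
    using assms(1) by (auto simp: st_nodes_def Suf_suffix)
  then have "sublist U T"
  proof cases
    case 3
    then show ?thesis by (metis append.assoc sublist_def)
  qed (auto simp: suffix_imp_sublist)
  then obtain ps ss where T: "T = ps @ U @ ss" by (auto simp: sublist_def)
  show ?thesis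
  proof (cases "U = []")
    case True
    then show ?thesis using assms by (intro bexI[of _ T]) (auto simp: Suf_suffix)
  next
    case False
    then show ?thesis using T by (intro bexI[of _ "U @ ss"]) (auto simp: Suf_suffix suffix_def)
  qed
qed

lemma Suf_leaf: assumes "terminated_text T" "S \<in> Suf T" shows "(S, X, W) \<notin> st_edges T"
proof
  assume a: "(S, X, W) \<in> st_edges T"
  have S: "S \<noteq> []" "suffix S T" using assms(2) by (auto simp: Suf_suffix)
  have W: "W = S @ X" "X \<noteq> []" "W \<in> st_nodes T" using st_edges_D[OF a] by auto
  have T: "T \<noteq> []" using assms by (simp add: terminated_text_def)
  obtain Q where "Q \<in> Suf T" "prefix W Q" using st_node_ext[OF W(3) T] by blast
  then obtain ps ss where "T = ps @ S @ (X @ ss)" using W(1) by (auto simp: Suf_suffix suffix_def prefix_def)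
  then have "set S \<subseteq> set (butlast T)" using W(2) by (auto simp: butlast_append)
  moreover have "last T \<in> set S" using S by (auto simp: suffix_def)
  ultimately show False using assms(1) by (auto simp: terminated_text_def)
qed

lemma path_append: "path E v (fs @ gs) w \<longleftrightarrow> (\<exists>u. path E v fs u \<and> path E u gs w)"
  by (induction fs arbitrary: v) auto

lemma spell_simps [simp]: "spell [] = []" "spell (f # fs) = lab f @ spell fs"
    "spell (fs @ gs) = spell fs @ spell gs"
  by (auto simp: spell_def)

lemma cdawg_path_exists:
  assumes "U \<in> st_nodes T" "U @ Y \<in> st_nodes T"
  shows "\<exists>fs. path (edges T) (cls T U) fs (cls T (U @ Y)) \<and> spell fs = Y"
  using assms
proof (induction "length Y" arbitrary: U Y rule: less_induct)
  case less
  show ?case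
  proof (cases "Y = []")
    case True
    then show ?thesis by (intro exI[of _ "[]"]) auto
  next
    case False
    let ?P = "\<lambda>k. 0 < k \<and> k \<le> length Y \<and> U @ take k Y \<in> st_nodes T"
    define k where "k = (LEAST k. ?P k)"
    have "?P (length Y)" using False less.prems by simp
    then have k: "?P k" unfolding k_def by (rule LeastI)
    have min: "\<not> ?P j" if "j < k" for j using that unfolding k_def by (rule not_less_Least)
    have e: "(U, take k Y, U @ take k Y) \<in> st_edges T"
    proof -
      have "U @ Z \<notin> st_nodes T" if Z: "strict_prefix Z (take k Y)" "Z \<noteq> []" for Z
      proof -
        have "length Z < k" using prefix_length_less[OF Z(1)] k by simp
        moreover have "Z = take (length Z) Y"
          using Z(1) by (metis append_eq_conv_conj prefix_def prefix_order.less_imp_le take_is_prefix prefix_order.trans)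
        ultimately show ?thesis using min[of "length Z"] k Z(2) by auto
      qed
      then show ?thesis using k less.prems False by (auto simp: st_edges_def)
    qed
    then have c: "(cls T U, take k Y, cls T (U @ take k Y)) \<in> edges T" unfolding edges_def by blast
    have "\<exists>fs. path (edges T) (cls T (U @ take k Y)) fs (cls T ((U @ take k Y) @ drop k Y)) \<and> spell fs = drop k Y"
      using k less.prems by (intro less.hyps) auto
    then obtain fs where "path (edges T) (cls T (U @ take k Y)) fs (cls T (U @ Y))" "spell fs = drop k Y"
      by auto
    then show ?thesis using c
      by (intro exI[of _ "(cls T U, take k Y, cls T (U @ take k Y)) # fs"]) (auto simp: src_def tgt_def lab_def)
  qed
qed

lemma cdawg_path_spell:
  assumes "path (edges T) (cls T U) fs w" "U \<in> st_nodes T"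
  shows "U @ spell fs \<in> st_nodes T \<and> w = cls T (U @ spell fs)"
  using assms
proof (induction fs arbitrary: U)
  case Nil then show ?case by simp
next
  case (Cons f fs)
  then obtain A X B where f: "f = (cls T A, X, cls T B)" and e: "(A, X, B) \<in> st_edges T"
    by (auto simp: edges_def)
  have "cls T A = cls T U" using Cons.prems f by (simp add: src_def)
  then have i: "st_iso T A U" using cls_eq_iff st_edges_D[OF e] Cons.prems(2) by blast
  have 1: "(U, X, U @ X) \<in> st_edges T" and 2: "st_iso T B (U @ X)" using st_iso_edge[OF i e] by auto
  have UX: "U @ X \<in> st_nodes T" using st_edges_D[OF 1] by simp
  have "cls T B = cls T (U @ X)" using 2 cls_eq_iff st_edges_D[OF e] UX by blast
  then have "path (edges T) (cls T (U @ X)) fs w" using Cons.prems f by (simp add: tgt_def)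
  from Cons.IH[OF this UX] show ?case using f by (simp add: lab_def)
qed

lemma Nil_st_node: "[] \<in> st_nodes T" by (simp add: st_nodes_def)
lemma Suf_st_node: "S \<in> Suf T \<Longrightarrow> S \<in> st_nodes T" by (simp add: st_nodes_def)

lemma cls_Suf: assumes "terminated_text T" "S \<in> Suf T" shows "cls T S = sink T"
proof -
  have T: "T \<in> Suf T" using assms(1) by (simp add: Suf_suffix terminated_text_def)
  have leaf: "st_subtree T R = {R}" if "R \<in> Suf T" for R
    using Suf_leaf[OF assms(1) that] by (auto simp: st_subtree_def elim: converse_rtranclE)
  have "st_iso T S T" unfolding st_iso_def leaf[OF assms(2)] leaf[OF T]
    using Suf_leaf[OF assms(1)] assms(2) T by (intro exI[of _ "\<lambda>_. T"]) (auto simp: bij_betw_def)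
  then show ?thesis unfolding sink_def using cls_eq_iff Suf_st_node assms(2) T by blast
qed

lemma st_node_sink: assumes "terminated_text T" "U \<in> st_nodes T" "cls T U = sink T"
  shows "U \<in> Suf T"
proof (rule ccontr)
  assume n: "U \<notin> Suf T"
  have T0: "T \<noteq> []" using assms(1) by (simp add: terminated_text_def)
  have T: "T \<in> Suf T" using T0 by (simp add: Suf_suffix)
  obtain S where S: "S \<in> Suf T" "prefix U S" using st_node_ext[OF assms(2) T0] by blast
  then obtain Y where Y: "S = U @ Y" by (auto simp: prefix_def)
  then have Y0: "Y \<noteq> []" using n S(1) by auto
  obtain fs where fs: "path (edges T) (cls T U) fs (cls T S)" "spell fs = Y"
    using cdawg_path_exists[OF assms(2)] S Y Suf_st_node by blast
  then obtain f gs where "fs = f # gs" using Y0 by (cases fs) auto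
  then obtain A X B where e: "(A, X, B) \<in> st_edges T" "cls T A = cls T U"
    using fs by (auto simp: edges_def src_def)
  then have "st_iso T A T" using assms(3) cls_eq_iff st_edges_D Suf_st_node[OF T] unfolding sink_def by metis
  then show False using st_iso_edge(1)[OF _ e(1)] Suf_leaf[OF assms(1) T] by blast
qed

lemma root_sink_path_Suf:
  assumes "terminated_text T" "path (edges T) (root T) fs (sink T)" shows "spell fs \<in> Suf T"
proof -
  have "spell fs \<in> st_nodes T \<and> sink T = cls T (spell fs)"
    using cdawg_path_spell[OF assms(2)[unfolded root_def] Nil_st_node] unfolding append_Nil .
  then show ?thesis using st_node_sink[OF assms(1)] by metis
qed

lemma Suf_root_sink_path:
  assumes "terminated_text T" "S \<in> Suf T"
  shows "\<exists>fs. path (edges T) (root T) fs (sink T) \<and> spell fs = S"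
  using cdawg_path_exists[OF Nil_st_node, of S T, unfolded append_Nil, OF Suf_st_node[OF assms(2)]]
  unfolding cls_Suf[OF assms] root_def .

lemma edge_on_path:
  assumes "terminated_text T" "f \<in> edges T"
  shows "\<exists>fs gs. path (edges T) (root T) (fs @ f # gs) (sink T)"
proof -
  obtain A X B where f: "f = (cls T A, X, cls T B)" and e: "(A, X, B) \<in> st_edges T"
    using assms(2) by (auto simp: edges_def)
  have T0: "T \<noteq> []" using assms(1) by (simp add: terminated_text_def)
  note n = st_edges_D[OF e]
  obtain fs where fs: "path (edges T) (root T) fs (cls T A)"
    using cdawg_path_exists[OF Nil_st_node, of A T] n(1) unfolding root_def by auto
  obtain S where S: "S \<in> Suf T" "prefix B S" using st_node_ext[OF n(2) T0] by blast
  then obtain Y where Y: "S = B @ Y" by (auto simp: prefix_def)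
  have "B @ Y \<in> st_nodes T" using Suf_st_node[OF S(1)] Y by simp
  then obtain gs where "path (edges T) (cls T B) gs (cls T (B @ Y))"
    using cdawg_path_exists[OF n(2)] by blast
  then have gs: "path (edges T) (cls T B) gs (sink T)" using cls_Suf[OF assms(1) S(1)] Y by simp
  have "src f = cls T A" "tgt f = cls T B" by (simp_all add: f src_def tgt_def)
  then have "path (edges T) (cls T A) (f # gs) (sink T)" using assms(2) gs by simp
  then show ?thesis using fs path_append[of "edges T" "root T" fs "f # gs" "sink T"] by blast
qed

lemma self_index_viaD:
  assumes "self_index_via T I \<nu> \<eta>"
  shows "inj_on \<nu> {..<I ! 1}" "\<eta> ` {..<I ! 2} = edges T"
    "root T = \<nu> (I ! 3)" "sink T = \<nu> (I ! 4)" "I ! 3 < I ! 1" "I ! 4 < I ! 1" "I ! 5 = length T"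
    "v < I ! 1 \<Longrightarrow> {i. i < I ! 2 \<and> src (\<eta> i) = \<nu> v} =
       {I ! (I ! 6 + 3 * v) ..< I ! (I ! 6 + 3 * v) + I ! (I ! 6 + 3 * v + 1)}"
    "i < I ! 2 \<Longrightarrow> I ! (I ! 7 + 3 * i) = hd (lab (\<eta> i))"
    "i < I ! 2 \<Longrightarrow> I ! (I ! 7 + 3 * i + 1) = length (lab (\<eta> i))"
    "i < I ! 2 \<Longrightarrow> I ! (I ! 7 + 3 * i + 2) < I ! 1"
    "i < I ! 2 \<Longrightarrow> \<nu> (I ! (I ! 7 + 3 * i + 2)) = tgt (\<eta> i)"
  using assms unfolding self_index_via_def Let_def bij_betw_def by blast+

lemma self_index_transfer_path:
  assumes s: "self_index_via T I \<nu> \<eta>" and s': "self_index_via T' I \<nu>' \<eta>'"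
    and "path (edges T) (\<nu> v) (map \<eta> is) (\<nu> w)" "v < I ! 1" "w < I ! 1" "\<forall>i\<in>set is. i < I ! 2"
  shows "path (edges T') (\<nu>' v) (map \<eta>' is) (\<nu>' w)"
  using assms(3-)
proof (induction "is" arbitrary: v)
  case Nil
  have "inj_on \<nu> {..<I ! 1}" using self_index_viaD(1)[OF s] .
  then show ?case using Nil by (auto dest: inj_onD)
next
  case (Cons i js)
  let ?r = "\<lambda>v. {I ! (I ! 6 + 3 * v) ..< I ! (I ! 6 + 3 * v) + I ! (I ! 6 + 3 * v + 1)}"
  have i: "i < I ! 2" using Cons.prems by simp
  have t: "I ! (I ! 7 + 3 * i + 2) < I ! 1" "\<nu> (I ! (I ! 7 + 3 * i + 2)) = tgt (\<eta> i)"
    using self_index_viaD(11,12)[OF s i] .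
  have t': "\<nu>' (I ! (I ! 7 + 3 * i + 2)) = tgt (\<eta>' i)"
    using self_index_viaD(12)[OF s' i] .
  have "{i. i < I ! 2 \<and> src (\<eta> i) = \<nu> v} = ?r v"
    using self_index_viaD(8)[OF s Cons.prems(2)] .
  then have "i \<in> ?r v" using i Cons.prems by auto
  moreover have "{i. i < I ! 2 \<and> src (\<eta>' i) = \<nu>' v} = ?r v"
    using self_index_viaD(8)[OF s' Cons.prems(2)] .
  ultimately have sr: "src (\<eta>' i) = \<nu>' v" by blast
  have "\<eta>' i \<in> edges T'" using self_index_viaD(2)[OF s'] i by blast
  moreover have "path (edges T') (tgt (\<eta>' i)) (map \<eta>' js) (\<nu>' w)"
    using Cons.IH[of "I ! (I ! 7 + 3 * i + 2)"] Cons.prems t t' by auto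
  ultimately show ?case using sr by simp
qed

lemma self_index_lab:
  assumes "self_index_via T I \<nu> \<eta>" "i < I ! 2"
  shows "length (lab (\<eta> i)) = I ! (I ! 7 + 3 * i + 1)" "hd (lab (\<eta> i)) = I ! (I ! 7 + 3 * i)"
    "\<eta> i \<in> edges T" "lab (\<eta> i) \<noteq> []"
proof -
  show "length (lab (\<eta> i)) = I ! (I ! 7 + 3 * i + 1)" "hd (lab (\<eta> i)) = I ! (I ! 7 + 3 * i)"
    and "\<eta> i \<in> edges T" using self_index_viaD(2,9,10)[OF assms(1)] assms(2) by (metis, metis, blast)
  then show "lab (\<eta> i) \<noteq> []" by (auto simp: edges_def lab_def dest: st_edges_D)
qed

lemma self_index_root_sink:
  assumes "self_index_via T I \<nu> \<eta>"
  shows "root T = \<nu> (I ! 3)" "sink T = \<nu> (I ! 4)" "I ! 3 < I ! 1" "I ! 4 < I ! 1" "I ! 5 = length T"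
  using self_index_viaD(3-7)[OF assms] .

lemma self_index_transfer_spell:
  assumes "self_index_via T I \<nu> \<eta>" and "self_index_via T' I \<nu>' \<eta>'" and "\<forall>i\<in>set is. i < I ! 2"
  shows "length (spell (map \<eta> is)) = length (spell (map \<eta>' is))"
  using assms(3) by (induction "is") (auto simp: self_index_lab[OF assms(1)] self_index_lab[OF assms(2)])

lemma path_edges: "path E v fs w \<Longrightarrow> set fs \<subseteq> E"
  by (induction fs arbitrary: v) auto

lemma path_as_indices:
  assumes s: "self_index_via T I \<nu> \<eta>" and "path (edges T) v fs w"
  shows "\<exists>is. fs = map \<eta> is \<and> (\<forall>i\<in>set is. i < I ! 2)"
proof -
  have "\<eta> ` {..<I ! 2} = edges T" using self_index_viaD(2)[OF s] .
  then have "set fs \<subseteq> \<eta> ` {..<I ! 2}" using path_edges[OF assms(2)] by simp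
  then show ?thesis
  proof (induction fs)
    case (Cons f fs)
    then obtain i js where "f = \<eta> i" "i < I ! 2" "fs = map \<eta> js" "\<forall>i\<in>set js. i < I ! 2" by auto
    then show ?case by (intro exI[of _ "i # js"]) auto
  qed auto
qed

lemma Suf_by_length: assumes "S \<in> Suf T" shows "S = drop (length T - length S) T"
  using assms by (auto simp: Suf_suffix suffix_def)

theorem self_index_determines_labels:
  assumes T: "terminated_text T" and T': "terminated_text T'"
    and s: "self_index_via T I \<nu> \<eta>" and s': "self_index_via T' I \<nu>' \<eta>'"
  shows "T = T'" and "i < I ! 2 \<Longrightarrow> lab (\<eta> i) = lab (\<eta>' i)"
proof -
  note rs = self_index_root_sink[OF s] and rs' = self_index_root_sink[OF s']
  have len: "length T = length T'" using rs rs' by simp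
  have transfer: "path (edges T') (root T') (map \<eta>' js) (sink T')"
    if "path (edges T) (root T) (map \<eta> js) (sink T)" "\<forall>i\<in>set js. i < I ! 2" for js
    using self_index_transfer_path[OF s s', of "I ! 3" js "I ! 4"] that rs rs' by simp
  show TT: "T = T'"
  proof (rule nth_equalityI[OF len])
    fix p assume p: "p < length T"
    have "drop p T \<in> Suf T" using p by (auto simp: Suf_suffix suffix_drop)
    then obtain fs where fs: "path (edges T) (root T) fs (sink T)" "spell fs = drop p T"
      using Suf_root_sink_path[OF T] by blast
    then obtain js where js: "fs = map \<eta> js" "\<forall>i\<in>set js. i < I ! 2" using path_as_indices[OF s] by blast
    have "spell (map \<eta>' js) \<in> Suf T'" using root_sink_path_Suf[OF T'] transfer fs js by blast
    then have "spell (map \<eta>' js) = drop (length T' - length (spell (map \<eta>' js))) T'"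
      by (rule Suf_by_length)
    moreover have "length T' - length (spell (map \<eta>' js)) = p"
      using self_index_transfer_spell[OF s s' js(2)] fs js len p by simp
    ultimately have sp: "spell (map \<eta>' js) = drop p T'" by simp
    obtain j ks where j: "js = j # ks" using fs js p by (cases js) auto
    then have "j < I ! 2" using js by simp
    then have h: "hd (lab (\<eta> j)) = hd (lab (\<eta>' j))" "lab (\<eta> j) \<noteq> []" "lab (\<eta>' j) \<noteq> []"
      using self_index_lab[OF s] self_index_lab[OF s'] by simp_all
    have "drop p T = lab (\<eta> j) @ spell (map \<eta> ks)" "drop p T' = lab (\<eta>' j) @ spell (map \<eta>' ks)"
      using fs(2) sp js(1) j by simp_all
    then have "hd (drop p T) = hd (drop p T')" using h by simp
    then show "T ! p = T' ! p" using p len by (simp add: hd_drop_conv_nth)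
  qed
  show "lab (\<eta> i) = lab (\<eta>' i)" if i: "i < I ! 2"
  proof -
    obtain fs gs where p: "path (edges T) (root T) (fs @ \<eta> i # gs) (sink T)"
      using edge_on_path[OF T self_index_lab(3)[OF s i]] by blast
    then obtain js ks where js: "fs = map \<eta> js" "\<forall>i\<in>set js. i < I ! 2"
      and ks: "gs = map \<eta> ks" "\<forall>i\<in>set ks. i < I ! 2"
      using path_as_indices[OF s] unfolding path_append path.simps by metis
    let ?js = "js @ i # ks"
    have in_range: "\<forall>i\<in>set ?js. i < I ! 2" using js ks i by auto
    have p1: "path (edges T) (root T) (map \<eta> ?js) (sink T)" using p js ks by simp
    have "spell (map \<eta> ?js) = drop (length T - length (spell (map \<eta> ?js))) T"
      using root_sink_path_Suf[OF T p1] by (rule Suf_by_length)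
    moreover have "spell (map \<eta>' ?js) = drop (length T' - length (spell (map \<eta>' ?js))) T'"
      using root_sink_path_Suf[OF T' transfer[OF p1 in_range]] by (rule Suf_by_length)
    ultimately have "spell (map \<eta> ?js) = spell (map \<eta>' ?js)"
      using self_index_transfer_spell[OF s s' in_range] TT by metis
    moreover have "length (spell (map \<eta> js)) = length (spell (map \<eta>' js))"
      using self_index_transfer_spell[OF s s' js(2)] .
    ultimately show ?thesis using self_index_lab(1)[OF s i] self_index_lab(1)[OF s' i] by simp
  qed
qed

section \<open>The word RAM\<close>

datatype instr =
    Const nat nat          (* r := k *)
  | Move nat nat           (* r := r1 *)
  | Add nat nat nat        (* r := r1 + r2 *)
  | Sub nat nat nat        (* r := max 0 (r1 - r2) *)
  | Load nat nat           (* r := memory[r1] *)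
  | Store nat nat          (* memory[r] := r1 *)
  | Jump nat               (* goto l *)
  | JumpLess nat nat nat   (* if r1 < r2 then goto l *)

record state =
  pc :: nat
  reg :: "nat \<Rightarrow> nat"
  mem :: "nat \<Rightarrow> nat"

text \<open>The machine has \<open>m\<close> memory words of \<open>w\<close> bits each, and \<open>w\<close>-bit registers. An access outside
  the memory and an overflow are faults (\<open>None\<close>).\<close>

definition set_reg :: "nat \<Rightarrow> nat \<Rightarrow> nat \<Rightarrow> state \<Rightarrow> state option" where
  "set_reg w r x s =
     (if x < 2 ^ w then Some (s\<lparr>pc := pc s + 1, reg := (reg s)(r := x)\<rparr>) else None)"

fun exec :: "nat \<Rightarrow> nat \<Rightarrow> instr \<Rightarrow> state \<Rightarrow> state option" where
  "exec m w (Const r k) s = set_reg w r k s"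
| "exec m w (Move r r1) s = set_reg w r (reg s r1) s"
| "exec m w (Add r r1 r2) s = set_reg w r (reg s r1 + reg s r2) s"
| "exec m w (Sub r r1 r2) s = set_reg w r (reg s r1 - reg s r2) s"
| "exec m w (Load r r1) s = (if reg s r1 < m then set_reg w r (mem s (reg s r1)) s else None)"
| "exec m w (Store r r1) s =
     (if reg s r < m then Some (s\<lparr>pc := pc s + 1, mem := (mem s)(reg s r := reg s r1)\<rparr>) else None)"
| "exec m w (Jump l) s = Some (s\<lparr>pc := l\<rparr>)"
| "exec m w (JumpLess r1 r2 l) s = Some (s\<lparr>pc := (if reg s r1 < reg s r2 then l else pc s + 1)\<rparr>)"

definition step :: "instr list \<Rightarrow> nat \<Rightarrow> nat \<Rightarrow> state \<Rightarrow> state option" where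
  "step P m w s = (if pc s < length P then exec m w (P ! pc s) s else None)"

fun steps :: "instr list \<Rightarrow> nat \<Rightarrow> nat \<Rightarrow> nat \<Rightarrow> state \<Rightarrow> state option" where
  "steps P m w 0 s = Some s"
| "steps P m w (Suc t) s = Option.bind (step P m w s) (steps P m w t)"

definition initial :: "nat list \<Rightarrow> state" where
  "initial I = \<lparr>pc = 0, reg = (\<lambda>_. 0), mem = (\<lambda>a. if a < length I then I ! a else 0)\<rparr>"

text \<open>The output is an array of pairs whose address and length are left in the registers 0 and 1.\<close>

definition output_pairs :: "state \<Rightarrow> (nat \<times> nat) list" where
  "output_pairs s =
     map (\<lambda>i. (mem s (reg s 0 + 2 * i), mem s (reg s 0 + 2 * i + 1))) [0..<reg s 1]"

text \<open>A program halts by moving the program counter just behind its last instruction.\<close>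

definition constructs ::
  "instr list \<Rightarrow> nat list \<Rightarrow> (nat \<times> nat) set \<Rightarrow> nat \<Rightarrow> nat \<Rightarrow> nat \<Rightarrow> bool" where
  "constructs P I A t m w \<longleftrightarrow> length I \<le> m \<and>
     (\<exists>t'\<le>t. \<exists>s. steps P m w t' (initial I) = Some s \<and> pc s = length P \<and>
        reg s 0 + 2 * reg s 1 \<le> m \<and> distinct (output_pairs s) \<and> set (output_pairs s) = A)"

end

theory Submission
  imports Defs
begin

text \<open>Write \<open>L\<^sub>-(v)\<close> and \<open>L\<^sub>+(v)\<close> for the lengths of the two representatives of a vertex \<open>v\<close>. Apart
  from the trivial one, the canonical suffixes correspond to the edges \<open>f = (v, X, w)\<close> that are not
  primary: the suffix of \<open>f\<close> is the concatenation of \<open>repr_minus v\<close>, \<open>X\<close> and \<open>repr_plus w\<close>. Its GLPF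
  value is \<open>L\<^sub>-(v)\<close>: following \<open>repr_plus v\<close> instead of \<open>f\<close> from \<open>v\<close> on gives a smaller suffix, while
  any suffix that shares the edge \<open>f\<close> is at least as large, because both orders are invariant under
  prepending a common prefix. The trivial suffix is the minimum and has the value 0.

  So it suffices to compute \<open>L\<^sub>-\<close>, \<open>L\<^sub>+\<close> and the primary edges. A topological sort yields \<open>L\<^sub>-\<close>, the
  length of a longest path from the root, and going through the vertices in reverse order yields
  \<open>L\<^sub>+\<close> and the primary edge, which has the smallest first symbol for the lexicographic order and
  maximises \<open>|X| + L\<^sub>+(w)\<close> for the text order.\<close>

section \<open>Canonical suffixes and their GLPF values\<close>

text \<open>Vertices are classes of isomorphic subtrees, so the arguments about strings rest on one
  exchange property: any string into \<open>v\<close> followed by any string from \<open>v\<close>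
  to the sink is a suffix (\<open>U_minus_plus\<close>). Together with the fact that edges leaving a
  vertex differ in their first symbols, it reduces both orders to numbers: lengths, first symbols,
  and one key per edge whose minimum marks the primary edge. The algorithm is therefore verified
  over numbers alone, in the locales \<open>dag\<close>, \<open>indexed_dag\<close> and
  \<open>keyed_dag\<close>, where no suffix occurs any more; the CDAWG is plugged in only at the
  end. On the machine side, running time, overflow and memory bounds have to be established along
  with correctness. Hence \<open>wp\<close> carries a count of executed instructions and demands
  that every value put into a register fit into a word. All bounds refer to the length
  \<open>N\<close> of the index, which is at least three times the number of vertices and at least
  three times the number of edges. Linear time comes from an amortisation: each vertex is visited
  once, and the out-degrees sum to the number of edges.\<close>

lemma min_wrt:
  assumes "finite A" "A \<noteq> {}"
    and total: "\<And>x y. x \<in> A \<Longrightarrow> y \<in> A \<Longrightarrow> le x y \<or> le y x"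
    and trans: "\<And>x y z. le x y \<Longrightarrow> le y z \<Longrightarrow> le x z"
    and antisym: "\<And>x y. x \<in> A \<Longrightarrow> y \<in> A \<Longrightarrow> le x y \<Longrightarrow> le y x \<Longrightarrow> x = y"
  shows "min_wrt le A \<in> A" "\<And>x. x \<in> A \<Longrightarrow> le (min_wrt le A) x"
proof -
  have "\<exists>m\<in>A. \<forall>x\<in>A. le m x" using assms(1,2) total
  proof (induction A rule: finite_ne_induct)
    case (insert a B)
    then obtain m where m: "m \<in> B" "\<forall>x\<in>B. le m x" by auto
    show ?case
    proof (cases "le a m")
      case True
      then have "\<forall>x\<in>B. le a x" using m trans by blast
      then show ?thesis using insert.prems[of a a] by blast
    next
      case False
      then show ?thesis using insert.prems[of a m] m by blast
    qed
  qed auto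
  then obtain m where m: "m \<in> A" "\<forall>x\<in>A. le m x" by blast
  \<comment> \<open>Uniqueness is what the definite description needs. Antisymmetry is assumed on
    \<open>A\<close> only, because \<open>le_pos\<close> cannot tell apart lists of equal
    length.\<close>
  then have "min_wrt le A = m" unfolding min_wrt_def using antisym by blast
  then show "min_wrt le A \<in> A" "\<And>x. x \<in> A \<Longrightarrow> le (min_wrt le A) x" using m by auto
qed

section \<open>Finiteness and determinism of the CDAWG\<close>

lemma finite_Suf: "finite (Suf T)"
  by (simp add: Suf_def)

lemma finite_st_nodes: "finite (st_nodes T)"
proof -
  \<comment> \<open>A branching vertex \<open>U\<close> is the \<open>butlast\<close> of a factor
    \<open>U @ [a]\<close> of \<open>T\<close>, and \<open>T\<close> has finitely many
    factors.\<close>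
  have "st_nodes T \<subseteq> insert [] (Suf T) \<union> butlast ` set (sublists T)"
    unfolding st_nodes_def set_sublists_eq by (force simp: image_iff)
  then show ?thesis by (rule finite_subset) (simp add: finite_Suf)
qed

lemma finite_edges: "finite (edges T)"
proof -
  have "st_edges T \<subseteq> (\<lambda>(U, W). (U, drop (length U) W, W)) ` (st_nodes T \<times> st_nodes T)"
    by (force simp: st_edges_def image_iff)
  then have "finite (st_edges T)" by (rule finite_subset) (simp add: finite_st_nodes)
  moreover have "edges T = (\<lambda>(U, X, W). (cls T U, X, cls T W)) ` st_edges T"
    by (force simp: edges_def)
  ultimately show ?thesis by simp
qed

lemma mem_cls: assumes "V \<in> cls T U" "U \<in> st_nodes T" shows "V \<in> st_nodes T" "cls T V = cls T U"
proof -
  show V: "V \<in> st_nodes T" using assms by (simp add: cls_def)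
  show "cls T V = cls T U" using assms cls_eq_iff[OF V assms(2)] by (auto simp: cls_def intro: st_iso_sym)
qed

text \<open>A path from the root spells a suffix tree vertex and ends in the class of that vertex;
  conversely, each member of a class is spelled by some path to it. So a CDAWG vertex, being a set
  of strings, is its own left language.\<close>

lemma U_minus_cls: assumes "U \<in> st_nodes T" shows "U_minus T (cls T U) = cls T U"
proof (intro set_eqI iffI)
  fix V assume "V \<in> U_minus T (cls T U)"
  then obtain fs where fs: "path (edges T) (cls T []) fs (cls T U)" "V = spell fs"
    by (auto simp: U_minus_def root_def)
  then have "V \<in> st_nodes T" "cls T U = cls T V" using cdawg_path_spell[OF fs(1) Nil_st_node] by auto
  then show "V \<in> cls T U" using cls_eq_iff[OF assms] by (auto simp: cls_def)
next
  fix V assume "V \<in> cls T U"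
  from mem_cls[OF this assms] show "V \<in> U_minus T (cls T U)"
    using cdawg_path_exists[OF Nil_st_node, of V T] by (auto simp: U_minus_def root_def)
qed

lemma edge_src: assumes "f \<in> edges T" obtains U where "U \<in> st_nodes T" "src f = cls T U"
  using assms st_edges_D(1) by (force simp: edges_def src_def)

text \<open>Isomorphic subtrees have the same outgoing labels, so a CDAWG edge can be lifted to any
  chosen representative \<open>U\<close> of its source, not only to the one it was obtained
  from.\<close>

lemma edge_at:
  assumes "f \<in> edges T" "U \<in> st_nodes T" "src f = cls T U"
  shows "(U, lab f, U @ lab f) \<in> st_edges T" "tgt f = cls T (U @ lab f)"
    "U @ lab f \<in> st_nodes T" "lab f \<noteq> []"
proof -
  obtain A X B where f: "f = (cls T A, X, cls T B)" and e: "(A, X, B) \<in> st_edges T"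
    using assms(1) by (auto simp: edges_def)
  note n = st_edges_D[OF e]
  have i: "st_iso T A U" using assms cls_eq_iff[OF n(1)] by (simp add: f src_def)
  show e': "(U, lab f, U @ lab f) \<in> st_edges T" using st_iso_edge(1)[OF i e] by (simp add: f lab_def)
  show "U @ lab f \<in> st_nodes T" "lab f \<noteq> []" using st_edges_D[OF e'] by auto
  then show "tgt f = cls T (U @ lab f)"
    using st_iso_edge(2)[OF i e] cls_eq_iff[OF n(2)] by (simp add: f lab_def tgt_def)
qed

text \<open>Two different labels with the same first symbol are either comparable as prefixes or
  branch after a nonempty common prefix. In both cases a vertex would lie strictly inside one of the
  edges.\<close>

lemma st_edges_hd_inj:
  assumes "T \<noteq> []" "(U, X, V) \<in> st_edges T" "(U, Y, W) \<in> st_edges T" "hd X = hd Y"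
  shows "X = Y"
proof -
  let ?Z = "longest_common_prefix X Y"
  note x = st_edges_D[OF assms(2)] and y = st_edges_D[OF assms(3)]
  have min: "U @ A \<notin> st_nodes T" if "A \<noteq> []" "strict_prefix A X \<or> strict_prefix A Y" for A
    using assms(2,3) that by (auto simp: st_edges_def)
  have Z0: "?Z \<noteq> []" using x(3) y(3) assms(4) by (cases X; cases Y) auto
  obtain A B where A: "X = ?Z @ A" and B: "Y = ?Z @ B"
    by (metis longest_common_prefix_prefix1 longest_common_prefix_prefix2 prefixE)
  have sub: "sublist V T" if V: "V \<in> st_nodes T" for V
  proof -
    obtain S where "S \<in> Suf T" "prefix V S" using st_node_ext[OF V assms(1)] by blast
    then show ?thesis by (auto simp: Suf_suffix suffix_def prefix_def sublist_def)
  qed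
  show ?thesis
  proof (cases "A = [] \<or> B = []")
    case True
    show ?thesis
    proof (rule ccontr)
      assume "X \<noteq> Y"
      then have "strict_prefix X Y \<or> strict_prefix Y X" using True A B
        by (metis append_Nil2 prefixI strict_prefix_def)
      then show False using min[of X] min[of Y] x y by auto
    qed
  next
    case False
    then obtain a A' b B' where ab: "A = a # A'" "B = b # B'" by (auto simp: neq_Nil_conv)
    have "a \<noteq> b"
    proof
      assume "a = b"
      then have "prefix (?Z @ [a]) X" "prefix (?Z @ [a]) Y" using A B ab by (metis append.assoc append_Cons append_Nil prefixI)+
      then have "prefix (?Z @ [a]) ?Z" by (rule longest_common_prefix_max_prefix)
      then show False using prefix_length_le by fastforce
    qed
    have "sublist (U @ ?Z @ [c]) T" if "prefix (U @ ?Z @ [c]) V" "V \<in> st_nodes T" for c V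
      using sub[OF that(2)] that(1) by (metis prefix_imp_sublist sublist_order.order_trans)
    moreover have "prefix (U @ ?Z @ [a]) V" "prefix (U @ ?Z @ [b]) W"
      using x(4) y(4) A B ab by (metis append.assoc append_Cons append_Nil prefixI)+
    ultimately have "sublist (U @ ?Z @ [a]) T" "sublist (U @ ?Z @ [b]) T" using x(2) y(2) by auto
    then have "U @ ?Z \<in> st_nodes T" using \<open>a \<noteq> b\<close> by (auto simp: st_nodes_def)
    moreover have "strict_prefix ?Z X" using A ab by (metis False append_self_conv prefixI strict_prefix_def)
    ultimately show ?thesis using min Z0 by blast
  qed
qed

text \<open>Both edges are lifted to the same representative of their common source, which leaves
  the corresponding fact about the suffix tree.\<close>

lemma edge_determ:
  assumes "T \<noteq> []" "f \<in> edges T" "g \<in> edges T" "src f = src g" "hd (lab f) = hd (lab g)"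
  shows "f = g"
proof -
  obtain U where U: "U \<in> st_nodes T" "src f = cls T U" using edge_src[OF assms(2)] by blast
  note f = edge_at[OF assms(2) U] and g = edge_at[OF assms(3) U(1)]
  have "lab f = lab g" using st_edges_hd_inj[OF assms(1) f(1) g(1)] U assms by simp
  moreover have "tgt f = tgt g" using f(2) g(2) U assms(4) calculation by simp
  ultimately show ?thesis using assms(4) by (simp add: src_def lab_def tgt_def prod_eq_iff)
qed

lemma edge_lab_nonempty: "f \<in> edges T \<Longrightarrow> lab f \<noteq> []"
  using edge_src edge_at(4) by metis

text \<open>As labels are nonempty, the first symbol of the remaining string selects the next
  edge.\<close>

lemma path_determ:
  assumes "T \<noteq> []" "path (edges T) v fs w" "path (edges T) v gs w'" "spell fs = spell gs"
  shows "fs = gs"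
  using assms(2-)
proof (induction fs arbitrary: v gs)
  case Nil
  then show ?case by (cases gs) (auto simp: edge_lab_nonempty)
next
  case (Cons f fs)
  show ?case
  proof (cases gs)
    case Nil
    then show ?thesis using Cons.prems by (auto simp: edge_lab_nonempty)
  next
    case g: (Cons g hs)
    have fg: "f \<in> edges T" "g \<in> edges T" "src f = src g" using Cons.prems g by auto
    have "hd (lab f) = hd (lab g)"
      using Cons.prems(3) g fg by (metis edge_lab_nonempty hd_append2 spell_simps(2))
    then have "f = g" using edge_determ[OF assms(1) fg] by blast
    then show ?thesis using Cons g by auto
  qed
qed

lemma U_minus_edge:
  assumes "f \<in> edges T" "P \<in> U_minus T (src f)" shows "P @ lab f \<in> U_minus T (tgt f)"
proof -
  obtain fs where fs: "path (edges T) (root T) fs (src f)" "P = spell fs"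
    using assms by (auto simp: U_minus_def)
  then have "path (edges T) (root T) (fs @ [f]) (tgt f)" using assms(1) by (auto simp: path_append)
  moreover have "P @ lab f = spell (fs @ [f])" using fs by simp
  ultimately show ?thesis unfolding U_minus_def by blast
qed

lemma U_plus_edge:
  assumes "f \<in> edges T" "Y \<in> U_plus T (tgt f)" shows "lab f @ Y \<in> U_plus T (src f)"
proof -
  obtain fs where "path (edges T) (tgt f) fs (sink T)" "Y = spell fs"
    using assms by (auto simp: U_plus_def)
  then have "path (edges T) (src f) (f # fs) (sink T) \<and> lab f @ Y = spell (f # fs)"
    using assms(1) by simp
  then show ?thesis unfolding U_plus_def by blast
qed

lemma cls_in_nodes: "U \<in> st_nodes T \<Longrightarrow> cls T U \<in> nodes T"
  by (simp add: nodes_def)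

lemma edge_nodes: assumes "f \<in> edges T" shows "src f \<in> nodes T" "tgt f \<in> nodes T"
  using edge_src[OF assms] edge_at(2,3)[OF assms] cls_in_nodes by metis+

lemma root_in_nodes: "root T \<in> nodes T"
  by (simp add: root_def cls_in_nodes Nil_st_node)

text \<open>Applied with the primary edges as \<open>A\<close>: the distinguished edge of a
  canonical factoring is recovered from the path alone, as its last edge outside
  \<open>A\<close>.\<close>

lemma last_outside_unique:
  assumes "fs @ f # gs = fs' @ f' # gs'" "f \<notin> A" "f' \<notin> A" "set gs \<subseteq> A" "set gs' \<subseteq> A"
  shows "f = f'"
proof -
  have "last (filter (\<lambda>x. x \<notin> A) (hs @ h # ks)) = h" if "h \<notin> A" "set ks \<subseteq> A" for hs h ks
  proof -
    have "filter (\<lambda>x. x \<notin> A) ks = []" using that(2) by (auto simp: filter_empty_conv)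
    then show ?thesis using that(1) by simp
  qed
  then show ?thesis using assms by metis
qed

lemma suffix_at_pos: assumes "S \<in> Suf T" shows "suffix_at T (pos T S) = S" "pos T S \<in> {1..length T}"
proof -
  have l: "length S \<le> length T" "S \<noteq> []" using assms by (auto simp: Suf_suffix dest: suffix_length_le)
  then show "suffix_at T (pos T S) = S"
    using Suf_by_length[OF assms] by (simp add: suffix_at_def pos_def)
  show "pos T S \<in> {1..length T}" using l by (cases S) (auto simp: pos_def)
qed

lemma inj_pos: "inj_on (pos T) (Suf T)"
  by (metis inj_onI suffix_at_pos(1))

lemma lcp_append: "lcp (A @ X) (A @ Y) = length A + lcp X Y"
  by (induction A) (auto simp: lcp_def)

lemma lcp_hd_neq: "X \<noteq> [] \<Longrightarrow> Y \<noteq> [] \<Longrightarrow> hd X \<noteq> hd Y \<Longrightarrow> lcp X Y = 0"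
  by (cases X; cases Y) (auto simp: lcp_def)

section \<open>Strings into and out of a vertex, and their representatives\<close>

locale cdawg =
  fixes T :: "nat list"
  assumes terminated: "terminated_text T"
begin

lemma T_nonempty: "T \<noteq> []" using terminated by (simp add: terminated_text_def)

lemma T_Suf: "T \<in> Suf T" using T_nonempty by (simp add: Suf_suffix)

lemma sink_in_nodes: "sink T \<in> nodes T"
  by (simp add: sink_def cls_in_nodes Suf_st_node T_Suf)

lemma U_plus_cls:
  assumes "U \<in> st_nodes T" shows "U_plus T (cls T U) = {Y. U @ Y \<in> Suf T}"
proof (intro set_eqI iffI)
  fix Y assume "Y \<in> U_plus T (cls T U)"
  then obtain fs where fs: "path (edges T) (cls T U) fs (sink T)" "Y = spell fs" by (auto simp: U_plus_def)
  then show "Y \<in> {Y. U @ Y \<in> Suf T}" using cdawg_path_spell[OF fs(1) assms] st_node_sink[OF terminated] by auto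
next
  fix Y assume "Y \<in> {Y. U @ Y \<in> Suf T}"
  then have Y: "U @ Y \<in> Suf T" by simp
  show "Y \<in> U_plus T (cls T U)"
    using cdawg_path_exists[OF assms Suf_st_node[OF Y]] cls_Suf[OF terminated Y] by (auto simp: U_plus_def)
qed

lemma nodeE: assumes "v \<in> nodes T"
  obtains U where "U \<in> st_nodes T" "v = cls T U" "U_minus T v = cls T U"
    "U_plus T v = {Y. U @ Y \<in> Suf T}" "U \<in> U_minus T v"
proof -
  obtain U where U: "U \<in> st_nodes T" "v = cls T U" using assms by (auto simp: nodes_def)
  moreover have "U \<in> cls T U" using U by (simp add: cls_def st_iso_refl)
  ultimately show thesis using that[of U] U_minus_cls U_plus_cls by simp
qed

text \<open>The exchange property: the continuations to a suffix depend on the class only, not on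
  the string that leads to it. It allows either half of a suffix to be replaced by a
  representative.\<close>

lemma U_minus_plus:
  assumes "v \<in> nodes T" "P \<in> U_minus T v" shows "Y \<in> U_plus T v \<longleftrightarrow> P @ Y \<in> Suf T"
proof -
  obtain U where U: "U \<in> st_nodes T" "v = cls T U" "U_minus T v = cls T U" using nodeE[OF assms(1)] by metis
  have "P \<in> st_nodes T" "v = cls T P" using mem_cls[of P T U] U assms by auto
  then show ?thesis using U_plus_cls by simp
qed

lemma U_plus_nonempty: assumes "v \<in> nodes T" shows "U_plus T v \<noteq> {}"
proof -
  obtain U where U: "U \<in> st_nodes T" "U_plus T v = {Y. U @ Y \<in> Suf T}" using nodeE[OF assms] by metis
  obtain S where "S \<in> Suf T" "prefix U S" using st_node_ext[OF U(1) T_nonempty] by blast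
  then show ?thesis using U by (auto simp: prefix_def)
qed

lemma U_minus_nonempty: "v \<in> nodes T \<Longrightarrow> U_minus T v \<noteq> {}"
  by (metis nodeE empty_iff)

lemma U_plus_suffix: assumes "v \<in> nodes T" "Y \<in> U_plus T v" shows "suffix Y T"
proof -
  obtain P where "P \<in> U_minus T v" using U_minus_nonempty[OF assms(1)] by blast
  then have "P @ Y \<in> Suf T" using U_minus_plus[OF assms(1)] assms(2) by blast
  then show ?thesis by (auto simp: Suf_suffix suffix_def)
qed

lemma finite_U_plus: assumes "v \<in> nodes T" shows "finite (U_plus T v)"
proof -
  have "U_plus T v \<subseteq> set (suffixes T)" using U_plus_suffix[OF assms] by auto
  then show ?thesis by (rule finite_subset) simp
qed

lemma finite_U_minus: assumes "v \<in> nodes T" shows "finite (U_minus T v)"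
proof -
  obtain U where "U_minus T v = cls T U" using nodeE[OF assms] by metis
  moreover have "cls T U \<subseteq> st_nodes T" by (auto simp: cls_def)
  ultimately show ?thesis using finite_subset finite_st_nodes by metis
qed

text \<open>With a common continuation \<open>Y\<close> both strings become suffixes of
  \<open>T\<close> of the same length, hence equal. This makes \<open>le_pos\<close> antisymmetric
  on a left language, so that \<open>repr_minus\<close> is well defined.\<close>

lemma U_minus_length_inj:
  assumes "v \<in> nodes T" "P \<in> U_minus T v" "Q \<in> U_minus T v" "length P = length Q"
  shows "P = Q"
proof -
  obtain Y where "Y \<in> U_plus T v" using U_plus_nonempty[OF assms(1)] by blast
  then have "P @ Y \<in> Suf T" "Q @ Y \<in> Suf T" using U_minus_plus[OF assms(1)] assms by auto
  from this[THEN Suf_by_length] show ?thesis using assms(4) by (metis append_same_eq length_append)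
qed

lemma repr_minus_longest:
  assumes "v \<in> nodes T"
  shows "repr_minus T v \<in> U_minus T v" "P \<in> U_minus T v \<Longrightarrow> length P \<le> length (repr_minus T v)"
proof -
  note m = min_wrt[OF finite_U_minus[OF assms] U_minus_nonempty[OF assms], of le_pos]
  have a: "\<And>x y. x \<in> U_minus T v \<Longrightarrow> y \<in> U_minus T v \<Longrightarrow> le_pos x y \<Longrightarrow> le_pos y x \<Longrightarrow> x = y"
    using U_minus_length_inj[OF assms] by (auto simp: le_pos_def)
  show "repr_minus T v \<in> U_minus T v" unfolding repr_minus_def
    by (rule m) (use a in \<open>auto simp: le_pos_def\<close>)
  show "length P \<le> length (repr_minus T v)" if "P \<in> U_minus T v"
  proof -
    have "le_pos (repr_minus T v) P" unfolding repr_minus_def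
      by (rule m(2)) (use a that in \<open>auto simp: le_pos_def\<close>)
    then show ?thesis by (simp add: le_pos_def)
  qed
qed

lemma repr_minus_eqI:
  assumes "v \<in> nodes T" "P \<in> U_minus T v" "\<And>Q. Q \<in> U_minus T v \<Longrightarrow> length Q \<le> length P"
  shows "repr_minus T v = P"
  by (meson assms U_minus_length_inj repr_minus_longest le_antisym)

text \<open>The whole text is a continuation from the root, and nothing nonempty can precede it in a
  suffix.\<close>

lemma U_minus_root: "U_minus T (root T) = {[]}"
proof -
  have "P = []" if P: "P \<in> U_minus T (root T)" for P
  proof -
    have "T \<in> U_plus T (root T)" unfolding root_def using U_plus_cls[OF Nil_st_node] T_Suf by simp
    then have "P @ T \<in> Suf T" using U_minus_plus[OF root_in_nodes P] by simp
    then show ?thesis by (auto simp: Suf_suffix dest: suffix_length_le)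
  qed
  then show ?thesis using U_minus_nonempty[OF root_in_nodes] by auto
qed

lemma repr_minus_root: "repr_minus T (root T) = []"
  using repr_minus_longest(1)[OF root_in_nodes] U_minus_root by simp

lemma tgt_not_root: assumes "f \<in> edges T" shows "tgt f \<noteq> root T"
proof
  assume "tgt f = root T"
  moreover obtain P where "P \<in> U_minus T (src f)" using U_minus_nonempty[OF edge_nodes(1)[OF assms]] by blast
  ultimately have "P @ lab f \<in> U_minus T (root T)" using U_minus_edge[OF assms] by metis
  then show False using edge_lab_nonempty[OF assms] by (simp add: U_minus_root)
qed

lemma U_plus_sink: "U_plus T (sink T) = {[]}"
proof -
  have "Y = []" if "Y \<in> U_plus T (sink T)" for Y
  proof -
    have "T @ Y \<in> Suf T" using that U_plus_cls[OF Suf_st_node[OF T_Suf]] by (simp add: sink_def)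
    then show ?thesis by (auto simp: Suf_suffix dest: suffix_length_le)
  qed
  then show ?thesis using U_plus_nonempty[OF sink_in_nodes] by auto
qed

lemma src_not_sink: assumes "f \<in> edges T" shows "src f \<noteq> sink T"
proof
  assume s: "src f = sink T"
  obtain Y where "Y \<in> U_plus T (tgt f)" using U_plus_nonempty[OF edge_nodes(2)[OF assms]] by blast
  then have "lab f @ Y \<in> U_plus T (sink T)" using U_plus_edge[OF assms] s by simp
  then show False using U_plus_sink edge_lab_nonempty[OF assms] by simp
qed

lemma root_not_sink: "root T \<noteq> sink T"
  using U_plus_sink U_plus_cls[OF Nil_st_node] T_Suf T_nonempty by (auto simp: root_def)

text \<open>The witness is the last edge of the path spelling \<open>repr_minus T v\<close>. Only
  lengths occur, so the recursion can be evaluated from the index without reconstructing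
  labels.\<close>

lemma repr_minus_recursion:
  assumes "v \<in> nodes T" "v \<noteq> root T"
  shows "\<exists>f\<in>edges T. tgt f = v \<and> length (repr_minus T v) = length (repr_minus T (src f)) + length (lab f)"
proof -
  obtain fs where fs: "path (edges T) (root T) fs v" "spell fs = repr_minus T v"
    using repr_minus_longest(1)[OF assms(1)] by (auto simp: U_minus_def)
  have "fs \<noteq> []" using fs(1) assms(2) by auto
  then obtain gs f where gs: "fs = gs @ [f]" using rev_exhaust by blast
  then have p: "path (edges T) (root T) gs (src f)" and f: "f \<in> edges T" "tgt f = v"
    using fs by (auto simp: path_append)
  have "spell gs \<in> U_minus T (src f)" using p by (auto simp: U_minus_def)
  then have 1: "length (spell gs) \<le> length (repr_minus T (src f))"
    using repr_minus_longest(2)[OF edge_nodes(1)[OF f(1)]] by blast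
  have "repr_minus T (src f) @ lab f \<in> U_minus T v"
    using U_minus_edge[OF f(1) repr_minus_longest(1)[OF edge_nodes(1)[OF f(1)]]] f by simp
  then have "length (repr_minus T (src f) @ lab f) \<le> length (repr_minus T v)"
    using repr_minus_longest(2)[OF assms(1)] by blast
  moreover have "length (repr_minus T v) = length (spell gs) + length (lab f)"
    using arg_cong[OF fs(2), of length] gs by simp
  ultimately show ?thesis using f 1 by (intro bexI[of _ f]) auto
qed

lemma repr_minus_edge:
  assumes "f \<in> edges T"
  shows "length (repr_minus T (src f)) + length (lab f) \<le> length (repr_minus T (tgt f))"
  using repr_minus_longest(2)[OF edge_nodes(2)[OF assms]]
    U_minus_edge[OF assms repr_minus_longest(1)[OF edge_nodes(1)[OF assms]]] by fastforce

lemma spell_butlast_repr_minus: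
  assumes "path (edges T) (root T) (fs @ [f]) v" "spell (fs @ [f]) = repr_minus T v"
  shows "spell fs = repr_minus T (src f)"
proof -
  have f: "f \<in> edges T" "tgt f = v" "path (edges T) (root T) fs (src f)"
    using assms by (auto simp: path_append)
  note n = edge_nodes[OF f(1)]
  have "length Q \<le> length (spell fs)" if "Q \<in> U_minus T (src f)" for Q
    using repr_minus_longest(2)[OF n(2) U_minus_edge[OF f(1) that]] f(2) assms(2)
    by (metis add_le_cancel_right length_append spell_simps append_Nil2)
  moreover have "spell fs \<in> U_minus T (src f)" using f(3) by (auto simp: U_minus_def)
  ultimately show ?thesis using repr_minus_eqI[OF n(1)] by simp
qed

text \<open>Being primary is defined edge by edge, each time through some witness path. As removing
  the last edge from a longest string leaves a longest one, these local witnesses fit together along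
  a path.\<close>

lemma EP_minus_path:
  assumes "path (edges T) (root T) fs v"
  shows "set fs \<subseteq> EP_minus T \<longleftrightarrow> spell fs = repr_minus T v"
  using assms
proof (induction fs arbitrary: v rule: rev_induct)
  case Nil
  then show ?case using repr_minus_root by auto
next
  case (snoc f fs)
  have f: "f \<in> edges T" "tgt f = v" "path (edges T) (root T) fs (src f)"
    using snoc.prems by (auto simp: path_append)
  note n = edge_nodes[OF f(1)]
  show ?case
  proof
    assume a: "set (fs @ [f]) \<subseteq> EP_minus T"
    then have fs: "spell fs = repr_minus T (src f)" using snoc.IH[OF f(3)] by simp
    \<comment> \<open>The witness \<open>gs\<close> need not be given as \<open>fs @ [f]\<close>;
      the two spell the same string because the part of \<open>gs\<close> before \<open>f\<close>
      also spells \<open>repr_minus T (src f)\<close>.\<close>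
    obtain gs u where g: "path (edges T) (root T) gs u" "gs \<noteq> []" "spell gs = repr_minus T u" "f = last gs"
      using a by (auto simp: EP_minus_def)
    then obtain hs where h: "gs = hs @ [f]" by (metis append_butlast_last_id)
    have "spell hs = repr_minus T (src f)" using spell_butlast_repr_minus[of hs f u] g(1,3) h by simp
    moreover have "u = v" using g(1) h f by (auto simp: path_append)
    ultimately show "spell (fs @ [f]) = repr_minus T v" using g(3) h fs by simp
  next
    assume a: "spell (fs @ [f]) = repr_minus T v"
    have "f \<in> EP_minus T" unfolding EP_minus_def using snoc.prems a by (intro CollectI exI[of _ "fs @ [f]"] exI[of _ v]) auto
    then show "set (fs @ [f]) \<subseteq> EP_minus T"
      using snoc.IH[OF f(3)] spell_butlast_repr_minus[OF snoc.prems a] by simp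
  qed
qed

end

text \<open>The properties shared by the two orders. By \<open>le_append\<close> common prefixes can
  be both added and cancelled. \<open>le_antisym\<close> is restricted to suffixes of
  \<open>T\<close>, where equal lengths imply equality; on arbitrary lists it fails for
  \<open>le_pos\<close>.\<close>

locale ordered_cdawg = cdawg +
  fixes le :: "nat list \<Rightarrow> nat list \<Rightarrow> bool"
  assumes le_total: "le X Y \<or> le Y X"
    and le_trans: "le X Y \<Longrightarrow> le Y Z \<Longrightarrow> le X Z"
    and le_append: "le (A @ X) (A @ Y) \<longleftrightarrow> le X Y"
    and le_antisym: "suffix X T \<Longrightarrow> suffix Y T \<Longrightarrow> le X Y \<Longrightarrow> le Y X \<Longrightarrow> X = Y"
begin

lemma repr_plus_least:
  assumes "v \<in> nodes T"
  shows "repr_plus le T v \<in> U_plus T v" "Y \<in> U_plus T v \<Longrightarrow> le (repr_plus le T v) Y"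
  using min_wrt[OF finite_U_plus[OF assms] U_plus_nonempty[OF assms], of le]
    le_total le_trans le_antisym U_plus_suffix[OF assms] unfolding repr_plus_def by blast+

lemma repr_plus_eqI:
  assumes "v \<in> nodes T" "Y \<in> U_plus T v" "\<And>Z. Z \<in> U_plus T v \<Longrightarrow> le Y Z"
  shows "repr_plus le T v = Y"
  by (meson assms le_antisym U_plus_suffix repr_plus_least)

lemma repr_plus_sink: "repr_plus le T (sink T) = []"
  using repr_plus_least(1)[OF sink_in_nodes] U_plus_sink by simp

lemma repr_plus_path:
  assumes "v \<in> nodes T"
  obtains fs where "path (edges T) v fs (sink T)" "spell fs = repr_plus le T v"
  using repr_plus_least(1)[OF assms] by (auto simp: U_plus_def)

text \<open>Optimal substructure: prepending \<open>lab f\<close> to a better continuation from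
  \<open>tgt f\<close> would give a better one from \<open>v\<close>.\<close>

lemma spell_tl_repr_plus:
  assumes "path (edges T) v (f # fs) (sink T)" "spell (f # fs) = repr_plus le T v"
  shows "spell fs = repr_plus le T (tgt f)"
proof -
  have f: "f \<in> edges T" "src f = v" "path (edges T) (tgt f) fs (sink T)" using assms by auto
  note n = edge_nodes[OF f(1)]
  have "le (spell fs) Z" if "Z \<in> U_plus T (tgt f)" for Z
    using repr_plus_least(2)[OF n(1) U_plus_edge[OF f(1) that]] f(2) assms(2)
    by (metis le_append spell_simps(2))
  moreover have "spell fs \<in> U_plus T (tgt f)" using f(3) by (auto simp: U_plus_def)
  ultimately show ?thesis using repr_plus_eqI[OF n(2)] by simp
qed

lemma EP_plus_iff:
  assumes "f \<in> edges T"
  shows "f \<in> EP_plus le T \<longleftrightarrow> lab f @ repr_plus le T (tgt f) = repr_plus le T (src f)"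
proof
  assume "f \<in> EP_plus le T"
  then obtain gs u where g: "path (edges T) u gs (sink T)" "gs \<noteq> []" "spell gs = repr_plus le T u" "f = hd gs"
    by (auto simp: EP_plus_def)
  then obtain hs where h: "gs = f # hs" by (metis list.collapse)
  then show "lab f @ repr_plus le T (tgt f) = repr_plus le T (src f)"
    using spell_tl_repr_plus[of u f hs] g by (metis path.simps(2) spell_simps(2))
next
  assume a: "lab f @ repr_plus le T (tgt f) = repr_plus le T (src f)"
  obtain fs where fs: "path (edges T) (tgt f) fs (sink T)" "spell fs = repr_plus le T (tgt f)"
    using repr_plus_path[OF edge_nodes(2)[OF assms]] by blast
  then have "path (edges T) (src f) (f # fs) (sink T)" "spell (f # fs) = repr_plus le T (src f)"
    using assms a by auto
  then show "f \<in> EP_plus le T" unfolding EP_plus_def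
    by (intro CollectI exI[of _ "f # fs"] exI[of _ "src f"]) simp
qed

lemma EP_plus_path:
  assumes "path (edges T) v fs (sink T)"
  shows "set fs \<subseteq> EP_plus le T \<longleftrightarrow> spell fs = repr_plus le T v"
  using assms
proof (induction fs arbitrary: v)
  case Nil
  then show ?case using repr_plus_sink by auto
next
  case (Cons f fs)
  have f: "f \<in> edges T" "src f = v" "path (edges T) (tgt f) fs (sink T)" using Cons.prems by auto
  show ?case
  proof
    assume "set (f # fs) \<subseteq> EP_plus le T"
    then show "spell (f # fs) = repr_plus le T v" using Cons.IH[OF f(3)] EP_plus_iff[OF f(1)] f(2) by simp
  next
    assume a: "spell (f # fs) = repr_plus le T v"
    have s: "spell fs = repr_plus le T (tgt f)" using spell_tl_repr_plus[OF Cons.prems a] .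
    then show "set (f # fs) \<subseteq> EP_plus le T"
      using Cons.IH[OF f(3)] EP_plus_iff[OF f(1)] f(2) a by simp
  qed
qed

lemma EP_plus_exists:
  assumes "v \<in> nodes T" "v \<noteq> sink T" obtains f where "f \<in> edges T" "src f = v" "f \<in> EP_plus le T"
proof -
  obtain fs where fs: "path (edges T) v fs (sink T)" "spell fs = repr_plus le T v"
    using repr_plus_path[OF assms(1)] by blast
  then obtain f gs where "fs = f # gs" using assms(2) by (cases fs) auto
  then show thesis using that[of f] fs EP_plus_path[OF fs(1)] by auto
qed

lemma repr_plus_edge:
  assumes "f \<in> edges T"
  shows "lab f @ repr_plus le T (tgt f) \<in> U_plus T (src f)"
    "le (repr_plus le T (src f)) (lab f @ repr_plus le T (tgt f))"
proof -
  show *: "lab f @ repr_plus le T (tgt f) \<in> U_plus T (src f)"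
    using U_plus_edge[OF assms repr_plus_least(1)[OF edge_nodes(2)[OF assms]]] .
  show "le (repr_plus le T (src f)) (lab f @ repr_plus le T (tgt f))"
    using repr_plus_least(2)[OF edge_nodes(1)[OF assms] *] .
qed

section \<open>Canonical suffixes as secondary edges, and their GLPF values\<close>

definition canonical_suffix :: "nat list set edge \<Rightarrow> nat list" where
  "canonical_suffix f = repr_minus T (src f) @ lab f @ repr_plus le T (tgt f)"

lemma canonical_suffix_Suf: assumes "f \<in> edges T" shows "canonical_suffix f \<in> Suf T"
  unfolding canonical_suffix_def
  using U_minus_plus[OF edge_nodes(1)[OF assms] repr_minus_longest(1)[OF edge_nodes(1)[OF assms]]]
    repr_plus_edge(1)[OF assms] by blast

lemma canonical_suffix_path:
  assumes "f \<in> edges T"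
  obtains fs gs where "path (edges T) (root T) (fs @ f # gs) (sink T)" "spell (fs @ f # gs) = canonical_suffix f"
    "set fs \<subseteq> EP_minus T" "set gs \<subseteq> EP_plus le T"
proof -
  note n = edge_nodes[OF assms]
  obtain fs where fs: "path (edges T) (root T) fs (src f)" "spell fs = repr_minus T (src f)"
    using repr_minus_longest(1)[OF n(1)] by (auto simp: U_minus_def)
  obtain gs where gs: "path (edges T) (tgt f) gs (sink T)" "spell gs = repr_plus le T (tgt f)"
    using repr_plus_path[OF n(2)] by blast
  show thesis using that[of fs gs] fs gs EP_minus_path[OF fs(1)] EP_plus_path[OF gs(1)] assms
    by (auto simp: path_append canonical_suffix_def)
qed

lemma repr_plus_root_Suf: "repr_plus le T (root T) \<in> Suf T"
  using U_minus_plus[OF root_in_nodes, of "[]"] repr_plus_least(1)[OF root_in_nodes] U_minus_root by simp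

text \<open>In a canonical factoring only the edge at list index \<open>k - 1\<close> is free: by
  \<open>EP_minus_path\<close> and \<open>EP_plus_path\<close> the edges before and after it spell
  the two representatives.\<close>

lemma CS_plus_eq: "CS_plus le T = insert (repr_plus le T (root T)) (canonical_suffix ` ES_plus le T)"
proof (intro set_eqI iffI)
  fix S assume "S \<in> CS_plus le T"
  then obtain fs where fs: "path (edges T) (root T) fs (sink T)" "spell fs = S"
    and c: "trivial_path le T fs \<or> (\<exists>k. canonical_factoring_at le T fs k)" by (auto simp: CS_plus_def)
  from c show "S \<in> insert (repr_plus le T (root T)) (canonical_suffix ` ES_plus le T)"
  proof
    assume "trivial_path le T fs"
    then show ?thesis using EP_plus_path[OF fs(1)] fs(2) by (simp add: trivial_path_def)
  next
    assume "\<exists>k. canonical_factoring_at le T fs k"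
    then obtain k where k: "k \<in> {1..length fs}" "set (take (k - 1) fs) \<subseteq> EP_minus T"
      "fs ! (k - 1) \<in> ES_plus le T" "set (drop k fs) \<subseteq> EP_plus le T"
      by (auto simp: canonical_factoring_at_def)
    let ?f = "fs ! (k - 1)"
    have d: "fs = take (k - 1) fs @ ?f # drop k fs"
      using k(1) id_take_nth_drop[of "k - 1" fs] by force
    then have p: "path (edges T) (root T) (take (k - 1) fs) (src ?f)" "path (edges T) (tgt ?f) (drop k fs) (sink T)"
      using fs(1) path_append[of _ _ "take (k - 1) fs" "?f # drop k fs"] by (metis path.simps(2))+
    have "S = spell (take (k - 1) fs) @ lab ?f @ spell (drop k fs)" using fs(2) d by (metis spell_simps(2,3))
    then have "S = canonical_suffix ?f"
      using EP_minus_path[OF p(1)] EP_plus_path[OF p(2)] k by (simp add: canonical_suffix_def)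
    then show ?thesis using k by blast
  qed
next
  fix S assume "S \<in> insert (repr_plus le T (root T)) (canonical_suffix ` ES_plus le T)"
  then consider "S = repr_plus le T (root T)" | f where "f \<in> ES_plus le T" "S = canonical_suffix f" by blast
  then show "S \<in> CS_plus le T"
  proof cases
    case 1
    obtain fs where p: "path (edges T) (root T) fs (sink T)" "spell fs = repr_plus le T (root T)"
      using repr_plus_path[OF root_in_nodes] by blast
    then have "trivial_path le T fs" using EP_plus_path[OF p(1)] by (simp add: trivial_path_def)
    then show ?thesis using 1 repr_plus_root_Suf p unfolding CS_plus_def by blast
  next
    case 2
    then have f: "f \<in> edges T" by (simp add: ES_plus_def)
    obtain fs gs where p: "path (edges T) (root T) (fs @ f # gs) (sink T)" "spell (fs @ f # gs) = S"
      "set fs \<subseteq> EP_minus T" "set gs \<subseteq> EP_plus le T" using canonical_suffix_path[OF f] 2 by metis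
    then have "canonical_factoring_at le T (fs @ f # gs) (Suc (length fs))"
      using 2 by (simp add: canonical_factoring_at_def nth_append)
    then show ?thesis using p(1,2) canonical_suffix_Suf[OF f] 2 unfolding CS_plus_def
      by (intro CollectI conjI exI[of _ "fs @ f # gs"]) auto
  qed
qed

lemma canonical_suffix_neq_trivial:
  assumes "f \<in> ES_plus le T" shows "canonical_suffix f \<noteq> repr_plus le T (root T)"
proof
  assume a: "canonical_suffix f = repr_plus le T (root T)"
  have f: "f \<in> edges T" "f \<notin> EP_plus le T" using assms by (auto simp: ES_plus_def)
  obtain fs gs where p: "path (edges T) (root T) (fs @ f # gs) (sink T)" "spell (fs @ f # gs) = canonical_suffix f"
    using canonical_suffix_path[OF f(1)] by metis
  then show False using EP_plus_path[OF p(1)] a f(2) by simp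
qed

text \<open>Equal suffixes have the same path, and \<open>f\<close> is the last edge outside
  \<open>EP_plus le T\<close> on it.\<close>

lemma inj_canonical_suffix: "inj_on canonical_suffix (ES_plus le T)"
proof (rule inj_onI)
  fix f g assume fg: "f \<in> ES_plus le T" "g \<in> ES_plus le T" "canonical_suffix f = canonical_suffix g"
  then have e: "f \<in> edges T" "f \<notin> EP_plus le T" "g \<in> edges T" "g \<notin> EP_plus le T" by (auto simp: ES_plus_def)
  obtain fs gs where f: "path (edges T) (root T) (fs @ f # gs) (sink T)" "spell (fs @ f # gs) = canonical_suffix f"
    "set gs \<subseteq> EP_plus le T" using canonical_suffix_path[OF e(1)] by metis
  obtain fs' gs' where g: "path (edges T) (root T) (fs' @ g # gs') (sink T)" "spell (fs' @ g # gs') = canonical_suffix g"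
    "set gs' \<subseteq> EP_plus le T" using canonical_suffix_path[OF e(3)] by metis
  have "fs @ f # gs = fs' @ g # gs'"
    by (rule path_determ[OF T_nonempty f(1) g(1)]) (use f g fg in simp)
  from last_outside_unique[OF this e(2,4) f(3) g(3)] show "f = g" .
qed

lemma GLPF_pos:
  assumes "S \<in> Suf T"
  shows "GLPF le T (pos T S) = Max (insert 0 (lcp S ` {S' \<in> Suf T. strict le S' S}))"
proof -
  have "{lcp S (suffix_at T q) | q. q \<in> {1..length T} \<and> strict le (suffix_at T q) S}
      = lcp S ` {S' \<in> Suf T. strict le S' S}" by (auto simp: Suf_def)
  then show ?thesis unfolding GLPF_def suffix_at_pos(1)[OF assms] by simp
qed

lemma GLPF_trivial: "GLPF le T (pos T (repr_plus le T (root T))) = 0"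
proof -
  have "\<not> strict le S (repr_plus le T (root T))" if "S \<in> Suf T" for S
  proof -
    have "S \<in> U_plus T (root T)" using that U_plus_cls[OF Nil_st_node] by (simp add: root_def)
    then show ?thesis using repr_plus_least(2)[OF root_in_nodes] by (auto simp: strict_def)
  qed
  then have e: "{S' \<in> Suf T. strict le S' (repr_plus le T (root T))} = {}" by blast
  show ?thesis unfolding GLPF_pos[OF repr_plus_root_Suf] e by simp
qed

text \<open>A suffix agreeing with the canonical suffix of \<open>f\<close> beyond \<open>repr_minus T (src f)\<close> also takes
  the edge \<open>f\<close>, and from the target of \<open>f\<close> on the canonical suffix is minimal.\<close>

lemma GLPF_canonical:
  assumes "f \<in> ES_plus le T"
  shows "GLPF le T (pos T (canonical_suffix f)) = length (repr_minus T (src f))"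
proof -
  have f: "f \<in> edges T" "f \<notin> EP_plus le T" using assms by (auto simp: ES_plus_def)
  let ?v = "src f" and ?P = "repr_minus T (src f)" and ?Y = "lab f @ repr_plus le T (tgt f)"
  let ?S = "canonical_suffix f"
  note n = edge_nodes[OF f(1)] and lf = edge_lab_nonempty[OF f(1)]
  have S: "?S = ?P @ ?Y" by (simp add: canonical_suffix_def)
  note P = repr_minus_longest(1)[OF n(1)]
  note SS = canonical_suffix_Suf[OF f(1)]
  \<comment> \<open>The primary edge at the source of \<open>f\<close> yields the lower bound: its
    first symbol differs from that of \<open>f\<close>, so the two suffixes part right after
    \<open>repr_minus T (src f)\<close>.\<close>
  obtain g where g: "g \<in> edges T" "src g = ?v" "g \<in> EP_plus le T"
    using EP_plus_exists[OF n(1) src_not_sink[OF f(1)]] by blast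
  have lg: "lab g \<noteq> []" using edge_lab_nonempty[OF g(1)] .
  let ?G = "repr_plus le T ?v"
  have G: "?G = lab g @ repr_plus le T (tgt g)" using EP_plus_iff[OF g(1)] g by simp
  have hd: "hd (lab f) \<noteq> hd (lab g)" using edge_determ[OF T_nonempty f(1) g(1)] g f by auto
  have Gin: "?P @ ?G \<in> Suf T" using U_minus_plus[OF n(1) P] repr_plus_least(1)[OF n(1)] by blast
  have YG: "?Y \<noteq> ?G" using hd G lf lg by (metis hd_append2)
  have leGY: "le ?G ?Y" using repr_plus_edge(2)[OF f(1)] .
  have "\<not> le ?Y ?G" using YG leGY le_antisym U_plus_suffix[OF n(1)] repr_plus_edge(1)[OF f(1)]
      repr_plus_least(1)[OF n(1)] by blast
  then have "strict le (?P @ ?G) ?S" using leGY by (simp add: S strict_def le_append)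
  moreover have "lcp ?S (?P @ ?G) = length ?P"
    unfolding S lcp_append using lcp_hd_neq[of ?Y ?G] hd lf lg G by simp
  ultimately have low: "length ?P \<in> lcp ?S ` {S' \<in> Suf T. strict le S' ?S}" using Gin by force
  have up: "lcp ?S S' \<le> length ?P" if S': "S' \<in> Suf T" "strict le S' ?S" for S'
  proof (rule ccontr)
    assume a: "\<not> lcp ?S S' \<le> length ?P"
    have lp: "take (lcp ?S S') ?S = take (lcp ?S S') S'"
      by (metis lcp_def longest_common_prefix_prefix1 longest_common_prefix_prefix2 prefix_def append_eq_conv_conj)
    \<comment> \<open>One symbol beyond \<open>repr_minus T (src f)\<close> is enough, since the
      first symbol determines the edge.\<close>
    have tk: "take (Suc (length ?P)) S' = take (Suc (length ?P)) ?S"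
      using lp a by (metis min.absorb1 not_less_eq_eq take_take)
    have "take (Suc (length ?P)) ?S = ?P @ [hd (lab f)]" unfolding S using lf by (cases "lab f") auto
    then obtain W where W: "S' = ?P @ hd (lab f) # W"
      using tk by (metis append.assoc append_Cons append_Nil append_take_drop_id)
    then have "hd (lab f) # W \<in> U_plus T ?v" using U_minus_plus[OF n(1) P] S'(1) by simp
    then obtain hs where hs: "path (edges T) ?v hs (sink T)" "spell hs = hd (lab f) # W"
      by (auto simp: U_plus_def)
    then obtain h ks where h: "hs = h # ks" by (cases hs) auto
    have he: "h \<in> edges T" "src f = src h" using hs h by auto
    have "hd (lab h) = hd (lab f)" using hs h edge_lab_nonempty[OF he(1)]
      by (metis hd_append2 list.sel(1) spell_simps(2))
    then have hf: "h = f" using edge_determ[OF T_nonempty f(1) he] by simp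
    then have ks: "spell ks \<in> U_plus T (tgt f)" using hs h by (auto simp: U_plus_def)
    then have "le (repr_plus le T (tgt f)) (spell ks)" using repr_plus_least(2)[OF n(2)] by blast
    moreover have "S' = ?P @ lab f @ spell ks" using W hs h hf by simp
    ultimately have "le ?S S'" by (simp add: S le_append)
    then show False using S'(2) by (simp add: strict_def)
  qed
  show ?thesis unfolding GLPF_pos[OF SS]
    by (rule Max_eqI) (use low up finite_Suf in auto)
qed

lemma quasi_irreducible_GLPF_eq:
  "quasi_irreducible_GLPF le T = insert (length T + 1 - length (repr_plus le T (root T)), 0)
     ((\<lambda>f. (length T + 1 - length (canonical_suffix f), length (repr_minus T (src f)))) ` ES_plus le T)"
proof -
  have "quasi_irreducible_GLPF le T = (\<lambda>S. (pos T S, GLPF le T (pos T S))) ` CS_plus le T"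
    by (auto simp: quasi_irreducible_GLPF_def)
  also have "\<dots> = insert (pos T (repr_plus le T (root T)), 0)
      ((\<lambda>f. (pos T (canonical_suffix f), length (repr_minus T (src f)))) ` ES_plus le T)"
    unfolding CS_plus_eq image_insert image_image using GLPF_canonical GLPF_trivial by auto
  finally show ?thesis by (simp only: pos_def)
qed

text \<open>The primary edge at the root is missing from \<open>ES_plus le T\<close>; it pays for
  the extra pair of the trivial suffix.\<close>

lemma card_quasi_irreducible_GLPF:
  "finite (quasi_irreducible_GLPF le T) \<and> card (quasi_irreducible_GLPF le T) \<le> cdawg_size T"
proof -
  obtain f where f: "f \<in> edges T" "f \<in> EP_plus le T"
    using EP_plus_exists[OF root_in_nodes root_not_sink] by metis
  have fin: "finite (ES_plus le T)" using finite_edges by (simp add: ES_plus_def)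
  have "ES_plus le T \<subset> edges T" using f by (auto simp: ES_plus_def)
  then have "card (ES_plus le T) < card (edges T)" using finite_edges by (rule psubset_card_mono[rotated])
  then show ?thesis unfolding quasi_irreducible_GLPF_eq cdawg_size_def using fin
    by (auto intro!: order_trans[OF card_insert_le_m1] order_trans[OF card_image_le])
qed

end

section \<open>Structured programs for the word RAM\<close>

datatype com =
    Skip
  | Basic instr
  | Seq com com (infixr ";;" 60)
  | Cond nat nat com com
  | Loop nat nat com

primrec code_length :: "com \<Rightarrow> nat" where
  "code_length Skip = 0"
| "code_length (Basic i) = 1"
| "code_length (c ;; d) = code_length c + code_length d"
| "code_length (Cond x y c d) = code_length c + code_length d + 2"
| "code_length (Loop x y c) = code_length c + 3"

text \<open>\<open>compile c l\<close> is the code for the start address \<open>l\<close>; \<open>Cond\<close> and \<open>Loop\<close> test whether register \<open>x\<close>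
  is less than register \<open>y\<close>.\<close>

primrec compile :: "com \<Rightarrow> nat \<Rightarrow> instr list" where
  "compile Skip l = []"
| "compile (Basic i) l = [i]"
| "compile (c ;; d) l = compile c l @ compile d (l + code_length c)"
| "compile (Cond x y c d) l =
     JumpLess x y (l + code_length d + 2) # compile d (l + 1) @
     Jump (l + code_length d + code_length c + 2) # compile c (l + code_length d + 2)"
| "compile (Loop x y c) l =
     JumpLess x y (l + 2) # Jump (l + code_length c + 3) # compile c (l + 2) @ [Jump l]"

lemma length_compile [simp]: "length (compile c l) = code_length c"
  by (induction c arbitrary: l) auto

section \<open>Weakest preconditions with a step count, and their soundness\<close>

type_synonym assn = "(nat \<Rightarrow> nat) \<Rightarrow> (nat \<Rightarrow> nat) \<Rightarrow> nat \<Rightarrow> bool"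

fun wp_instr :: "nat \<Rightarrow> nat \<Rightarrow> instr \<Rightarrow> assn \<Rightarrow> assn" where
  "wp_instr m B (Const x c) Q r h k \<longleftrightarrow> c < B \<and> Q (r(x := c)) h (Suc k)"
| "wp_instr m B (Move x y) Q r h k \<longleftrightarrow> r y < B \<and> Q (r(x := r y)) h (Suc k)"
| "wp_instr m B (Add x y z) Q r h k \<longleftrightarrow> r y + r z < B \<and> Q (r(x := r y + r z)) h (Suc k)"
| "wp_instr m B (Sub x y z) Q r h k \<longleftrightarrow> r y - r z < B \<and> Q (r(x := r y - r z)) h (Suc k)"
| "wp_instr m B (Load x y) Q r h k \<longleftrightarrow>
     r y < m \<and> h (r y) < B \<and> Q (r(x := h (r y))) h (Suc k)"
| "wp_instr m B (Store x y) Q r h k \<longleftrightarrow> r x < m \<and> Q r (h(r x := r y)) (Suc k)"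
| "wp_instr m B (Jump l) Q r h k \<longleftrightarrow> False"
| "wp_instr m B (JumpLess x y l) Q r h k \<longleftrightarrow> False"

text \<open>Weakest precondition for total correctness. An assertion speaks about the registers, the
  memory, and the number of machine instructions executed so far.\<close>

primrec wp :: "nat \<Rightarrow> nat \<Rightarrow> com \<Rightarrow> assn \<Rightarrow> assn" where
  "wp m B Skip Q = Q"
| "wp m B (Basic i) Q = wp_instr m B i Q"
| "wp m B (c ;; d) Q = wp m B c (wp m B d Q)"
| "wp m B (Cond x y c d) Q = (\<lambda>r h k.
     if r x < r y then wp m B c Q r h (Suc k)
     else wp m B d (\<lambda>r h k. Q r h (Suc k)) r h (Suc k))"
| "wp m B (Loop x y c) Q = (\<lambda>r h k.
     \<exists>n. ((\<lambda>W r h k.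
            if r x < r y then wp m B c (\<lambda>r h k. W r h (Suc k)) r h (Suc k) else Q r h (k + 2)) ^^ n)
          (\<lambda>_ _ _. False) r h k)"

lemma steps_add: "steps P m w (t + t') s = Option.bind (steps P m w t s) (steps P m w t')"
proof (induction t arbitrary: s)
  case (Suc t)
  then show ?case by (cases "step P m w s") auto
qed simp

lemma steps_trans:
  "steps P m w t s = Some s' \<Longrightarrow> steps P m w t' s' = X \<Longrightarrow> steps P m w (t + t') s = X"
  by (simp add: steps_add)

lemma step_at: "step (A @ i # B) m w \<lparr>pc = length A, reg = r, mem = h\<rparr> =
    exec m w i \<lparr>pc = length A, reg = r, mem = h\<rparr>"
  by (simp add: step_def)

lemma wp_instr_step:
  assumes "wp_instr m (2 ^ w) i Q r h k"
  shows "\<exists>r' h'. exec m w i \<lparr>pc = l, reg = r, mem = h\<rparr> = Some \<lparr>pc = Suc l, reg = r', mem = h'\<rparr> \<and>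
     Q r' h' (Suc k)"
  using assms by (cases i) (auto simp: set_reg_def)

text \<open>Jump targets are absolute, so the code is placed between arbitrary pieces
  \<open>A\<close> and \<open>B\<close>, over which the induction generalises. The counter
  \<open>k\<close> is a ghost variable that grows by the number of machine steps.\<close>

lemma wp_sound:
  assumes "wp m (2 ^ w) c Q r h k" "P = A @ compile c (length A) @ B"
  shows "\<exists>t r' h'. steps P m w t \<lparr>pc = length A, reg = r, mem = h\<rparr> =
      Some \<lparr>pc = length A + code_length c, reg = r', mem = h'\<rparr> \<and> Q r' h' (k + t)"
  using assms
proof (induction c arbitrary: Q r h k A B)
  case Skip
  then show ?case by (intro exI[of _ 0]) simp
next
  case (Basic i)
  from wp_instr_step[of m w i Q r h k "length A"] Basic show ?case
    by (intro exI[of _ 1]) (auto simp: step_at)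
next
  case (Seq c d)
  have "P = A @ compile c (length A) @ compile d (length A + code_length c) @ B" using Seq.prems by simp
  then obtain t r' h' where 1: "steps P m w t \<lparr>pc = length A, reg = r, mem = h\<rparr> =
      Some \<lparr>pc = length A + code_length c, reg = r', mem = h'\<rparr>" "wp m (2 ^ w) d Q r' h' (k + t)"
    using Seq.IH(1)[of "wp m (2 ^ w) d Q" r h k A] Seq.prems by auto
  let ?A = "A @ compile c (length A)"
  have "P = ?A @ compile d (length ?A) @ B" using Seq.prems by simp
  from Seq.IH(2)[OF 1(2) this] obtain t' r'' h'' where
    2: "steps P m w t' \<lparr>pc = length A + code_length c, reg = r', mem = h'\<rparr> =
      Some \<lparr>pc = length A + code_length c + code_length d, reg = r'', mem = h''\<rparr>" "Q r'' h'' (k + t + t')"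
    by auto
  show ?case using steps_trans[OF 1(1) 2(1)] 2(2)
    by (intro exI[of _ "t + t'"] exI[of _ r''] exI[of _ h'']) (simp add: ac_simps)
next
  case (Cond x y c d)
  let ?l = "length A"
  let ?j = "JumpLess x y (?l + code_length d + 2)" and ?e = "Jump (?l + code_length d + code_length c + 2)"
  have P0: "P = A @ ?j # (compile d (?l + 1) @ ?e # compile c (?l + code_length d + 2) @ B)"
    using Cond.prems by simp
  have s0: "step P m w \<lparr>pc = ?l, reg = r, mem = h\<rparr> =
      Some \<lparr>pc = (if r x < r y then ?l + code_length d + 2 else ?l + 1), reg = r, mem = h\<rparr>"
    unfolding P0 step_at by simp
  show ?case
  proof (cases "r x < r y")
    case True
    let ?A = "A @ ?j # compile d (?l + 1) @ [?e]"
    have "P = ?A @ compile c (length ?A) @ B" using P0 by simp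
    from Cond.IH(1)[OF _ this, of Q r h "Suc k"] True Cond.prems obtain t r' h' where
      "steps P m w t \<lparr>pc = ?l + code_length d + 2, reg = r, mem = h\<rparr> =
        Some \<lparr>pc = ?l + code_length d + 2 + code_length c, reg = r', mem = h'\<rparr>" "Q r' h' (Suc k + t)"
      by auto
    then show ?thesis using s0 True
      by (intro exI[of _ "Suc t"] exI[of _ r'] exI[of _ h']) (simp add: ac_simps)
  next
    case False
    let ?A = "A @ [?j]"
    have "P = ?A @ compile d (length ?A) @ (?e # compile c (?l + code_length d + 2) @ B)" using P0 by simp
    from Cond.IH(2)[OF _ this, of "\<lambda>r h k. Q r h (Suc k)" r h "Suc k"] False Cond.prems obtain t r' h' where
      1: "steps P m w t \<lparr>pc = ?l + 1, reg = r, mem = h\<rparr> =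
        Some \<lparr>pc = ?l + 1 + code_length d, reg = r', mem = h'\<rparr>" "Q r' h' (Suc (Suc k + t))"
      by auto
    let ?A' = "A @ ?j # compile d (?l + 1)"
    have "P = ?A' @ ?e # compile c (?l + code_length d + 2) @ B" using P0 by simp
    from step_at[of ?A' ?e "compile c (?l + code_length d + 2) @ B" m w r' h', folded this]
    have "step P m w \<lparr>pc = ?l + 1 + code_length d, reg = r', mem = h'\<rparr> =
        Some \<lparr>pc = ?l + code_length d + code_length c + 2, reg = r', mem = h'\<rparr>" by simp
    then have "steps P m w (t + 1) \<lparr>pc = ?l + 1, reg = r, mem = h\<rparr> =
        Some \<lparr>pc = ?l + code_length d + code_length c + 2, reg = r', mem = h'\<rparr>"
      by (intro steps_trans[OF 1(1)]) simp
    then show ?thesis using s0 False 1(2)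
      by (intro exI[of _ "Suc (t + 1)"] exI[of _ r'] exI[of _ h']) (simp add: ac_simps)
  qed
next
  case (Loop x y c)
  let ?l = "length A"
  let ?j = "JumpLess x y (?l + 2)" and ?e = "Jump (?l + code_length c + 3)"
  have P0: "P = A @ ?j # (?e # compile c (?l + 2) @ Jump ?l # B)"
    using Loop.prems by simp
  have s0: "step P m w \<lparr>pc = ?l, reg = r, mem = h\<rparr> =
      Some \<lparr>pc = (if r x < r y then ?l + 2 else ?l + 1), reg = r, mem = h\<rparr>" for r h
    unfolding P0 step_at by simp
  have P1: "P = (A @ [?j]) @ ?e # (compile c (?l + 2) @ Jump ?l # B)" using P0 by simp
  from step_at[of "A @ [?j]" ?e "compile c (?l + 2) @ Jump ?l # B" m w, folded this]
  have s1: "step P m w \<lparr>pc = ?l + 1, reg = r, mem = h\<rparr> =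
      Some \<lparr>pc = ?l + code_length c + 3, reg = r, mem = h\<rparr>" for r h by simp
  let ?A = "A @ [?j, ?e]" and ?A' = "A @ ?j # ?e # compile c (?l + 2)"
  have P2: "P = ?A @ compile c (length ?A) @ Jump ?l # B" using P0 by simp
  have P3: "P = ?A' @ Jump ?l # B" using P0 by simp
  from step_at[of ?A' "Jump ?l" B m w, folded this]
  have s3: "step P m w \<lparr>pc = ?l + 2 + code_length c, reg = r, mem = h\<rparr> =
      Some \<lparr>pc = ?l, reg = r, mem = h\<rparr>" for r h by simp
  let ?F = "\<lambda>W r h k. if r x < r y then wp m (2 ^ w) c (\<lambda>r h k. W r h (Suc k)) r h (Suc k) else Q r h (k + 2)"
  obtain n where "(?F ^^ n) (\<lambda>_ _ _. False) r h k" using Loop.prems by auto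
  \<comment> \<open>The iterate of the loop functional that satisfies the precondition bounds the
    number of rounds, which supports the inner induction.\<close>
  then show ?case
  proof (induction n arbitrary: r h k)
    case (Suc n)
    show ?case
    proof (cases "r x < r y")
      case True
      then have "wp m (2 ^ w) c (\<lambda>r h k. (?F ^^ n) (\<lambda>_ _ _. False) r h (Suc k)) r h (Suc k)"
        using Suc.prems by simp
      from Loop.IH[OF this P2] obtain t r' h' where
        1: "steps P m w t \<lparr>pc = ?l + 2, reg = r, mem = h\<rparr> =
          Some \<lparr>pc = ?l + 2 + code_length c, reg = r', mem = h'\<rparr>"
          "(?F ^^ n) (\<lambda>_ _ _. False) r' h' (Suc (Suc k + t))"
        by auto
      from Suc.IH[OF 1(2)] obtain t' r'' h'' where
        2: "steps P m w t' \<lparr>pc = ?l, reg = r', mem = h'\<rparr> =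
          Some \<lparr>pc = ?l + code_length (Loop x y c), reg = r'', mem = h''\<rparr>"
          "Q r'' h'' (Suc (Suc k + t) + t')" by blast
      have "steps P m w (t + Suc t') \<lparr>pc = ?l + 2, reg = r, mem = h\<rparr> =
          Some \<lparr>pc = ?l + code_length (Loop x y c), reg = r'', mem = h''\<rparr>"
        by (rule steps_trans[OF 1(1)]) (use s3 2(1) in \<open>simp del: code_length.simps\<close>)
      then have "steps P m w (Suc (t + Suc t')) \<lparr>pc = ?l, reg = r, mem = h\<rparr> =
          Some \<lparr>pc = ?l + code_length (Loop x y c), reg = r'', mem = h''\<rparr>"
        using True by (simp add: s0 del: code_length.simps)
      moreover have "Q r'' h'' (k + Suc (t + Suc t'))" using 2(2) by (simp add: ac_simps)
      ultimately show ?thesis by blast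
    next
      case False
      then have "steps P m w 2 \<lparr>pc = ?l, reg = r, mem = h\<rparr> =
          Some \<lparr>pc = ?l + code_length (Loop x y c), reg = r, mem = h\<rparr>"
        using s0 s1 by (simp add: numeral_2_eq_2)
      moreover have "Q r h (k + 2)" using Suc.prems False by simp
      ultimately show ?thesis by blast
    qed
  qed simp
qed

lemma wp_mono:
  assumes "wp m B c Q r h k" "\<And>r h k. Q r h k \<Longrightarrow> Q' r h k" shows "wp m B c Q' r h k"
  using assms
proof (induction c arbitrary: Q Q' r h k)
  case (Basic i)
  then show ?case by (cases i) auto
next
  case (Seq c d)
  have "wp m B c (wp m B d Q) r h k" using Seq.prems by simp
  then have "wp m B c (wp m B d Q') r h k" by (rule Seq.IH(1)) (erule Seq.IH(2), rule Seq.prems(2))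
  then show ?case by simp
next
  case (Cond x y c d)
  show ?case
  proof (cases "r x < r y")
    case True
    then have "wp m B c Q r h (Suc k)" using Cond.prems by simp
    then have "wp m B c Q' r h (Suc k)" by (rule Cond.IH(1)) (rule Cond.prems(2))
    then show ?thesis using True by simp
  next
    case False
    then have "wp m B d (\<lambda>r h k. Q r h (Suc k)) r h (Suc k)" using Cond.prems by simp
    then have "wp m B d (\<lambda>r h k. Q' r h (Suc k)) r h (Suc k)" by (rule Cond.IH(2)) (rule Cond.prems(2))
    then show ?thesis using False by simp
  qed
next
  case (Loop x y c)
  let ?F = "\<lambda>Q W r h k. if r x < r y then wp m B c (\<lambda>r h k. W r h (Suc k)) r h (Suc k) else Q r h (k + 2)"
  have "(?F Q' ^^ n) (\<lambda>_ _ _. False) r h k" if "(?F Q ^^ n) (\<lambda>_ _ _. False) r h k" for n r h k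
    using that
  proof (induction n arbitrary: r h k)
    case (Suc n)
    show ?case
    proof (cases "r x < r y")
      case True
      then have "wp m B c (\<lambda>r h k. (?F Q ^^ n) (\<lambda>_ _ _. False) r h (Suc k)) r h (Suc k)"
        using Suc.prems by simp
      then have "wp m B c (\<lambda>r h k. (?F Q' ^^ n) (\<lambda>_ _ _. False) r h (Suc k)) r h (Suc k)"
        by (rule Loop.IH) (rule Suc.IH)
      then show ?thesis using True by simp
    next
      case False
      then show ?thesis using Suc.prems Loop.prems(2) by simp
    qed
  qed simp
  then show ?case using Loop.prems(1) unfolding wp.simps by blast
qed auto

text \<open>For loops whose number \<open>n\<close> of rounds is known beforehand;
  \<open>Inv j\<close> describes the state after \<open>j\<close> rounds. A round costs one step for
  the test and one for the jump back; leaving costs two, the failing test and the jump behind the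
  loop.\<close>

lemma wp_Loop:
  assumes "Inv 0 r h k"
    and step: "\<And>j r h k. j < n \<Longrightarrow> Inv j r h k \<Longrightarrow>
      r x < r y \<and> wp m B c (\<lambda>r h k. Inv (Suc j) r h (Suc k)) r h (Suc k)"
    and exit: "\<And>r h k. Inv n r h k \<Longrightarrow> \<not> r x < r y \<and> Q r h (k + 2)"
  shows "wp m B (Loop x y c) Q r h k"
proof -
  let ?F = "\<lambda>W r h k. if r x < r y then wp m B c (\<lambda>r h k. W r h (Suc k)) r h (Suc k) else Q r h (k + 2)"
  have "(?F ^^ Suc i) (\<lambda>_ _ _. False) r h k" if "i \<le> n" "Inv (n - i) r h k" for i r h k
    using that
  proof (induction i arbitrary: r h k)
    case 0
    then show ?case using exit by simp
  next
    case (Suc i)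
    have "r x < r y \<and> wp m B c (\<lambda>r h k. Inv (n - i) r h (Suc k)) r h (Suc k)"
      using step[of "n - Suc i" r h k] Suc.prems by (simp add: Suc_diff_Suc)
    then have xy: "r x < r y" and 1: "wp m B c (\<lambda>r h k. Inv (n - i) r h (Suc k)) r h (Suc k)" by auto
    have "wp m B c (\<lambda>r h k. (?F ^^ Suc i) (\<lambda>_ _ _. False) r h (Suc k)) r h (Suc k)"
      by (rule wp_mono[OF 1], rule Suc.IH) (use Suc.prems in simp_all)
    then show ?case using xy by simp
  qed
  from this[of n r h k] have "(?F ^^ Suc n) (\<lambda>_ _ _. False) r h k" using assms(1) by simp
  then show ?thesis unfolding wp.simps by blast
qed

lemma constructs_compileI:
  assumes "wp m (2 ^ w) c (\<lambda>r h k. k \<le> t \<and> r 0 + 2 * r 1 \<le> m \<and>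
      (let ps = map (\<lambda>i. (h (r 0 + 2 * i), h (r 0 + 2 * i + 1))) [0..<r 1] in distinct ps \<and> set ps = A))
    (\<lambda>_. 0) (\<lambda>a. if a < length I then I ! a else 0) 0" "length I \<le> m"
  shows "constructs (compile c 0) I A t m w"
proof -
  obtain t' r h where "steps (compile c 0) m w t' (initial I) = Some \<lparr>pc = code_length c, reg = r, mem = h\<rparr>"
    "t' \<le> t" "r 0 + 2 * r 1 \<le> m"
    "let ps = map (\<lambda>i. (h (r 0 + 2 * i), h (r 0 + 2 * i + 1))) [0..<r 1] in distinct ps \<and> set ps = A"
    using wp_sound[OF assms(1), of "compile c 0" "[]" "[]"] by (auto simp: initial_def)
  then show ?thesis using assms(2) unfolding constructs_def output_pairs_def Let_def
    by (intro conjI exI[of _ t'] exI[of _ "\<lparr>pc = code_length c, reg = r, mem = h\<rparr>"]) simp_all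
qed

section \<open>Topological sorting\<close>

text \<open>The rank \<open>lm\<close> is the length of a longest path from the root.\<close>

locale dag =
  fixes nv ne rt :: nat and fe od ln tg sc lm :: "nat \<Rightarrow> nat"
  assumes rt: "rt < nv"
    and sc: "i < ne \<Longrightarrow> sc i < nv"
    and tg: "i < ne \<Longrightarrow> tg i < nv"
    and out: "v < nv \<Longrightarrow> {i. i < ne \<and> sc i = v} = {fe v ..< fe v + od v}"
    and tg_rt: "i < ne \<Longrightarrow> tg i \<noteq> rt"
    and ln_pos: "i < ne \<Longrightarrow> 0 < ln i"
    and lm_rt: "lm rt = 0"
    and lm_edge: "i < ne \<Longrightarrow> lm (sc i) + ln i \<le> lm (tg i)"
    and lm_rec: "v < nv \<Longrightarrow> v \<noteq> rt \<Longrightarrow> \<exists>i<ne. tg i = v \<and> lm v = lm (sc i) + ln i"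
begin

text \<open>State of the topological sort after the edges in \<open>F\<close> have been removed: \<open>d\<close> holds the
  remaining in-degrees, \<open>l\<close> the lengths of the longest paths found so far, and the first \<open>t\<close>
  entries of \<open>q\<close> the vertices of in-degree 0.\<close>

definition kahn :: "nat set \<Rightarrow> nat \<Rightarrow> (nat \<Rightarrow> nat) \<Rightarrow> (nat \<Rightarrow> nat) \<Rightarrow> (nat \<Rightarrow> nat) \<Rightarrow> bool" where
  "kahn F t d l q \<longleftrightarrow>
     F \<subseteq> {..<ne} \<and> inj_on q {..<t} \<and> q ` {..<t} = {v. v < nv \<and> d v = 0} \<and>
     (\<forall>v<nv. d v = card {i. i < ne \<and> tg i = v \<and> i \<notin> F}) \<and>
     (\<forall>v<nv. l v = Max (insert 0 ((\<lambda>i. lm (sc i) + ln i) ` {i \<in> F. tg i = v}))) \<and>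
     (\<forall>b<t. \<forall>i<ne. tg i = q b \<longrightarrow> (\<exists>a<b. sc i = q a))"

lemma kahnD:
  assumes "kahn F t d l q"
  shows "F \<subseteq> {..<ne}" "inj_on q {..<t}" "q ` {..<t} = {v. v < nv \<and> d v = 0}"
    "v < nv \<Longrightarrow> d v = card {i. i < ne \<and> tg i = v \<and> i \<notin> F}"
    "v < nv \<Longrightarrow> l v = Max (insert 0 ((\<lambda>i. lm (sc i) + ln i) ` {i \<in> F. tg i = v}))"
    "b < t \<Longrightarrow> i < ne \<Longrightarrow> tg i = q b \<Longrightarrow> \<exists>a<b. sc i = q a" "finite F"
proof -
  note a = assms[unfolded kahn_def]
  from a show F: "F \<subseteq> {..<ne}" and "inj_on q {..<t}" and "q ` {..<t} = {v. v < nv \<and> d v = 0}"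
    by (rule conjunct1, rule conjunct2[THEN conjunct1], rule conjunct2[THEN conjunct2, THEN conjunct1])
  from a show "v < nv \<Longrightarrow> d v = card {i. i < ne \<and> tg i = v \<and> i \<notin> F}"
    and "v < nv \<Longrightarrow> l v = Max (insert 0 ((\<lambda>i. lm (sc i) + ln i) ` {i \<in> F. tg i = v}))"
    and "b < t \<Longrightarrow> i < ne \<Longrightarrow> tg i = q b \<Longrightarrow> \<exists>a<b. sc i = q a" by simp_all
  show "finite F" using F by (rule finite_subset) simp
qed

lemma kahn_q: assumes "kahn F t d l q" "j < t" shows "q j < nv" "d (q j) = 0"
  using kahnD(3)[OF assms(1)] assms(2) by auto

lemma kahn_t: assumes "kahn F t d l q" shows "t \<le> nv"
proof -
  have "card (q ` {..<t}) \<le> card {..<nv}" by (rule card_mono) (use kahnD(3)[OF assms] in auto)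
  then show ?thesis using card_image[OF kahnD(2)[OF assms]] by simp
qed

lemma kahn_l_le: assumes "kahn F t d l q" "v < nv" shows "l v \<le> lm v"
  unfolding kahnD(5)[OF assms]
  by (rule Max.boundedI) (use kahnD(1,7)[OF assms(1)] lm_edge in auto)

lemma kahn_d_le: assumes "kahn F t d l q" "v < nv" shows "d v \<le> ne"
proof -
  have "card {i. i < ne \<and> tg i = v \<and> i \<notin> F} \<le> card {..<ne}" by (rule card_mono) auto
  then show ?thesis using kahnD(4)[OF assms] by simp
qed

text \<open>In-degree 0 means that every incoming edge is already in \<open>F\<close>, so the
  maximum ranges over all of them, and by \<open>lm_rec\<close> one of them attains
  \<open>lm v\<close>.\<close>

lemma kahn_l_final: assumes k: "kahn F t d l q" and v: "v < nv" and "d v = 0" shows "l v = lm v"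
proof (cases "v = rt")
  case True
  then show ?thesis using kahn_l_le[OF k v] lm_rt by simp
next
  case False
  have "{i. i < ne \<and> tg i = v \<and> i \<notin> F} = {}" using kahnD(4)[OF k v] assms(3) by simp
  moreover obtain i where i: "i < ne" "tg i = v" "lm v = lm (sc i) + ln i" using lm_rec[OF v False] by blast
  ultimately have "lm v \<in> insert 0 ((\<lambda>i. lm (sc i) + ln i) ` {i \<in> F. tg i = v})" by auto
  then have "lm v \<le> l v" unfolding kahnD(5)[OF k v] using kahnD(7)[OF k] by (intro Max_ge) auto
  then show ?thesis using kahn_l_le[OF k v] by simp
qed

text \<open>By \<open>lm_rec\<close> every vertex other than the root has an incoming edge, so the
  queue starts with the root alone.\<close>

lemma kahn_init:
  assumes d: "\<And>v. v < nv \<Longrightarrow> d v = card {i. i < ne \<and> tg i = v}"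
  shows "kahn {} 1 d (\<lambda>_. 0) (q(0 := rt))"
proof -
  have "d v = 0 \<longleftrightarrow> v = rt" if v: "v < nv" for v
  proof -
    have "{i. i < ne \<and> tg i = v} = {} \<longleftrightarrow> v = rt" using lm_rec[OF v] tg_rt by auto
    then show ?thesis using d[OF v] by simp
  qed
  then have "{v. v < nv \<and> d v = 0} = {rt}" using rt by auto
  then show ?thesis unfolding kahn_def using tg_rt by (auto simp: d lessThan_Suc)
qed

text \<open>Removal of an edge \<open>i\<close> that leaves the queue entry at \<open>h\<close>.
  That all edges in \<open>F\<close> leave entries up to \<open>h\<close> matters when the target
  joins the queue: all its incoming edges are then removed, so its predecessors stand before
  it.\<close>

lemma kahn_step:
  assumes k: "kahn F t d l q" and i: "i < ne" "i \<notin> F" and h: "h < t" "sc i = q h"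
    and F: "\<forall>j\<in>F. \<exists>a\<le>h. sc j = q a"
  defines "x \<equiv> l (q h) + ln i"
  shows "0 < d (tg i)" "x \<le> lm (tg i)"
    "kahn (insert i F) (if d (tg i) = 1 then Suc t else t) (d(tg i := d (tg i) - 1))
       (if l (tg i) < x then l(tg i := x) else l) (if d (tg i) = 1 then q(t := tg i) else q)"
proof -
  let ?w = "tg i"
  have w: "?w < nv" using tg i by simp
  have lh: "l (q h) = lm (sc i)" using kahn_l_final[OF k kahn_q[OF k h(1)]] h by simp
  then show "x \<le> lm ?w" using lm_edge[OF i(1)] by (simp add: x_def)
  have rem: "{j. j < ne \<and> tg j = v \<and> j \<notin> insert i F} = {j. j < ne \<and> tg j = v \<and> j \<notin> F} - {i}" for v
    by auto
  have mem: "i \<in> {j. j < ne \<and> tg j = ?w \<and> j \<notin> F}" using i by simp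
  then have "0 < card {j. j < ne \<and> tg j = ?w \<and> j \<notin> F}" by (subst card_gt_0_iff) auto
  then show pos: "0 < d ?w" using kahnD(4)[OF k w] by simp
  let ?d = "d(?w := d ?w - 1)" and ?t = "if d ?w = 1 then Suc t else t"
  let ?q = "if d ?w = 1 then q(t := ?w) else q"
  have d': "?d v = card {j. j < ne \<and> tg j = v \<and> j \<notin> insert i F}" if v: "v < nv" for v
  proof (cases "v = ?w")
    case True
    then show ?thesis unfolding rem using kahnD(4)[OF k w] mem by simp
  next
    case False
    then have "{j. j < ne \<and> tg j = v \<and> j \<notin> F} - {i} = {j. j < ne \<and> tg j = v \<and> j \<notin> F}" by auto
    then show ?thesis unfolding rem using kahnD(4)[OF k v] False by simp
  qed
  have l': "(if l ?w < x then l(?w := x) else l) v =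
      Max (insert 0 ((\<lambda>i. lm (sc i) + ln i) ` {j \<in> insert i F. tg j = v}))" if v: "v < nv" for v
  proof (cases "v = ?w")
    case True
    let ?A = "(\<lambda>i. lm (sc i) + ln i) ` {j \<in> F. tg j = ?w}"
    have "(\<lambda>i. lm (sc i) + ln i) ` {j \<in> insert i F. tg j = ?w} = insert x ?A"
      using lh by (auto simp: x_def)
    moreover have "Max (insert 0 (insert x ?A)) = max x (Max (insert 0 ?A))"
      using kahnD(7)[OF k] by (subst insert_commute, subst Max_insert) auto
    ultimately show ?thesis using True kahnD(5)[OF k w] by (auto simp: max_def)
  next
    case False
    then have "{j \<in> insert i F. tg j = v} = {j \<in> F. tg j = v}" by auto
    then show ?thesis using kahnD(5)[OF k v] False by simp
  qed
  have wt: "?w \<notin> q ` {..<t}" using pos kahnD(3)[OF k] by simp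
  have q: "inj_on ?q {..<?t}" "?q ` {..<?t} = {v. v < nv \<and> ?d v = 0}"
  proof -
    have eq: "(q(t := ?w)) ` {..<t} = q ` {..<t}" by auto
    have "inj_on (q(t := ?w)) {..<t}" using kahnD(2)[OF k] by (auto simp: inj_on_def)
    then have "inj_on (q(t := ?w)) {..<Suc t}" unfolding lessThan_Suc using wt eq by (simp add: inj_on_insert)
    then show "inj_on ?q {..<?t}" using kahnD(2)[OF k] by simp
    show "?q ` {..<?t} = {v. v < nv \<and> ?d v = 0}"
    proof (cases "d ?w = 1")
      case True
      then have "?q ` {..<?t} = insert ?w ((q(t := ?w)) ` {..<t})"
        by (simp add: lessThan_Suc del: fun_upd_apply) simp
      then have "?q ` {..<?t} = insert ?w (q ` {..<t})" unfolding eq .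
      then show ?thesis using kahnD(3)[OF k] w True by auto
    next
      case False
      then show ?thesis using kahnD(3)[OF k] pos by (auto split: if_splits)
    qed
  qed
  have top: "\<exists>a<b. sc j = ?q a" if b: "b < ?t" and j: "j < ne" "tg j = ?q b" for b j
  proof (cases "b < t")
    case True
    then have "tg j = q b" using j by (auto split: if_splits)
    then obtain a where "a < b" "sc j = q a" using kahnD(6)[OF k True j(1)] by blast
    then show ?thesis using True by (intro exI[of _ a]) auto
  next
    case False
    then have b: "b = t" "d ?w = 1" using b by (auto split: if_splits)
    then have tj: "tg j = ?w" using j by simp
    have "card {j. j < ne \<and> tg j = ?w \<and> j \<notin> insert i F} = 0" using d'[OF w] b by simp
    then have "j \<in> insert i F" using j(1) tj by simp
    then obtain a where "a \<le> h" "sc j = q a" using F h by blast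
    then show ?thesis using b h(1) by (intro exI[of _ a]) auto
  qed
  show "kahn (insert i F) ?t ?d (if l ?w < x then l(?w := x) else l) ?q"
    unfolding kahn_def using kahnD(1)[OF k] i(1) q d' l' top
    by (intro conjI allI impI; (assumption | simp only: insert_subset lessThan_iff simp_thms))
qed

text \<open>Induction on \<open>lm\<close>, which grows strictly along edges and so takes the place
  of acyclicity: the predecessors of \<open>v\<close> are in the queue, their edges are removed,
  hence \<open>v\<close> has in-degree 0 and is in the queue too.\<close>

lemma kahn_complete:
  assumes k: "kahn {i. i < ne \<and> sc i \<in> q ` {..<t}} t d l q" shows "t = nv"
proof -
  have "v \<in> q ` {..<t}" if "v < nv" for v
    using that
  proof (induction "lm v" arbitrary: v rule: less_induct)
    case less
    have "{i. i < ne \<and> tg i = v \<and> i \<notin> {i. i < ne \<and> sc i \<in> q ` {..<t}}} = {}"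
    proof -
      have "sc i \<in> q ` {..<t}" if i: "i < ne" "tg i = v" for i
        using lm_edge[OF i(1)] ln_pos[OF i(1)] sc[OF i(1)] i(2) by (intro less.hyps) auto
      then show ?thesis by blast
    qed
    then have "d v = 0" using kahnD(4)[OF k less.prems] by simp
    then show ?case using kahnD(3)[OF k] less.prems by blast
  qed
  then have "card {..<nv} \<le> card (q ` {..<t})" by (intro card_mono) auto
  then show ?thesis using card_image[OF kahnD(2)[OF k]] kahn_t[OF k] by simp
qed

lemma out_iff: assumes "v < nv" shows "i < ne \<and> sc i = v \<longleftrightarrow> fe v \<le> i \<and> i < fe v + od v"
  using arg_cong[OF out[OF assms], of "\<lambda>A. i \<in> A"] by simp

text \<open>If \<open>od v\<close> is 0, the interval is empty and \<open>fe v\<close> is an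
  arbitrary word; hence the condition on the second bound.\<close>

lemma out_bound: assumes "v < nv" shows "od v \<le> ne" "0 < od v \<Longrightarrow> fe v + od v \<le> ne"
proof -
  have "i < ne" if "fe v \<le> i" "i < fe v + od v" for i using out_iff[OF assms, of i] that by blast
  then have "card {fe v ..< fe v + od v} \<le> card {..<ne}" by (intro card_mono) auto
  then show "od v \<le> ne" by simp
  show "fe v + od v \<le> ne" if "0 < od v"
    using out_iff[OF assms, of "fe v + od v - 1"] that by auto
qed

text \<open>The amortisation: visiting each vertex once and scanning its outgoing edges touches each
  edge once.\<close>

lemma sum_out: assumes "inj_on q {..<nv}" "q ` {..<nv} = {..<nv}" shows "(\<Sum>j<nv. od (q j)) = ne"
proof -
  have "(\<Sum>j<nv. od (q j)) = (\<Sum>v<nv. od v)"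
    using sum.reindex[OF assms(1), of od] assms(2) by simp
  also have "\<dots> = (\<Sum>v<nv. card {i. i < ne \<and> sc i = v})" using out by simp
  also have "\<dots> = card (\<Union>v<nv. {i. i < ne \<and> sc i = v})" by (rule card_UN_disjoint[symmetric]) auto
  also have "(\<Union>v<nv. {i. i < ne \<and> sc i = v}) = {..<ne}" using sc by auto
  finally show ?thesis by simp
qed

definition removed :: "(nat \<Rightarrow> nat) \<Rightarrow> nat \<Rightarrow> nat set" where
  "removed q h = {i. i < ne \<and> sc i \<in> q ` {..<h}}"

lemma removed_cong: assumes "\<And>j. j < h \<Longrightarrow> q' j = q j" shows "removed q' h = removed q h"
proof -
  have "q' ` {..<h} = q ` {..<h}" by (rule image_cong) (simp_all add: assms)
  then show ?thesis by (simp add: removed_def)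
qed

text \<open>\<open>kahn_step\<close> in the form of the inner loop, with \<open>c\<close> edges of
  \<open>v\<close> already removed. A new entry is written at \<open>t > h\<close>, so the queue up
  to \<open>h\<close>, and with it \<open>removed q h\<close> and the sum of out-degrees, stays as
  it is.\<close>

lemma kahn_inner:
  assumes k: "kahn (removed q h \<union> {fe v ..< fe v + c}) t d l q" and h: "h < t" "q h = v" and c: "c < od v"
  defines "i \<equiv> fe v + c"
  defines "x \<equiv> lm v + ln i"
  defines "q' \<equiv> if d (tg i) = 1 then q(t := tg i) else q" and "t' \<equiv> if d (tg i) = 1 then Suc t else t"
  shows "i < ne" "tg i < nv" "0 < d (tg i)" "x \<le> lm (tg i)" "h < t'" "q' h = v"
    "kahn (removed q' h \<union> {fe v ..< fe v + Suc c}) t' (d(tg i := d (tg i) - 1))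
       (if l (tg i) < x then l(tg i := x) else l) q'"
    "(\<Sum>j<h. od (q' j)) = (\<Sum>j<h. od (q j))"
proof -
  have v: "v < nv" "d v = 0" using kahn_q[OF k h(1)] h by simp_all
  have i: "i < ne" "sc i = v" using out_iff[OF v(1), of i] c by (simp_all add: i_def)
  then show "i < ne" "tg i < nv" using tg by auto
  have inj: "q a \<noteq> v" if "a < h" for a
    using inj_onD[OF kahnD(2)[OF k], of a h] that h by auto
  have nF: "i \<notin> removed q h \<union> {fe v ..< fe v + c}"
    using i inj by (auto simp: removed_def i_def)
  have F: "\<forall>j\<in>removed q h \<union> {fe v ..< fe v + c}. \<exists>a\<le>h. sc j = q a"
  proof (intro ballI, elim UnE)
    fix j
    assume "j \<in> removed q h"
    then obtain a where "a < h" "sc j = q a" by (auto simp: removed_def)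
    then show "\<exists>a\<le>h. sc j = q a" by (intro exI[of _ a]) simp
  next
    fix j
    assume "j \<in> {fe v ..< fe v + c}"
    then have "sc j = v" using out_iff[OF v(1), of j] c by simp
    then show "\<exists>a\<le>h. sc j = q a" using h(2) by (intro exI[of _ h]) simp
  qed
  have lv: "l (q h) = lm v" using kahn_l_final[OF k v] h(2) by simp
  have sci: "sc i = q h" using i h by simp
  note s = kahn_step[OF k i(1) nF h(1) sci F, unfolded lv, folded x_def]
  show "0 < d (tg i)" "x \<le> lm (tg i)" using s(1,2) .
  show "h < t'" using h by (simp add: t'_def)
  have q': "q' j = q j" if "j \<le> h" for j using that h by (simp add: q'_def)
  then show "q' h = v" "(\<Sum>j<h. od (q' j)) = (\<Sum>j<h. od (q j))" using h by simp_all
  have "removed q' h = removed q h" using q' by (intro removed_cong) simp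
  moreover have "insert i (removed q h \<union> {fe v ..< fe v + c}) = removed q h \<union> {fe v ..< fe v + Suc c}"
    by (auto simp: i_def)
  ultimately show "kahn (removed q' h \<union> {fe v ..< fe v + Suc c}) t' (d(tg i := d (tg i) - 1))
       (if l (tg i) < x then l(tg i := x) else l) q'"
    using s(3) by (simp add: q'_def t'_def)
qed

lemma removed_Suc: assumes "q h = v" "v < nv"
  shows "removed q (Suc h) = removed q h \<union> {fe v ..< fe v + od v}"
  using out[OF assms(2)] assms(1) by (auto simp: removed_def lessThan_Suc)

text \<open>The queue cannot run empty early: for \<open>h = t\<close>, completeness would yield
  \<open>t = nv\<close>.\<close>

lemma kahn_head: assumes "kahn (removed q h) t d l q" "h \<le> t" "h < nv" shows "h < t"
  using assms kahn_complete[of q t d l] unfolding removed_def by (cases "h = t") auto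

end

section \<open>The program\<close>

text \<open>Access to a table with three words per entry. The factor 3 is obtained by additions, as
  the machine does not multiply; the offset \<open>c\<close> is one of the registers 2, 3, 4, which
  hold 0, 1, 2.\<close>

definition field :: "nat \<Rightarrow> nat \<Rightarrow> nat \<Rightarrow> nat \<Rightarrow> com" where
  "field x b i c = Basic (Add x i i) ;; Basic (Add x x i) ;; Basic (Add x x b) ;;
     Basic (Add x x c) ;; Basic (Load x x)"

definition elem :: "nat \<Rightarrow> nat \<Rightarrow> nat \<Rightarrow> com" where
  "elem x b i = Basic (Add x b i) ;; Basic (Load x x)"

definition put :: "nat \<Rightarrow> nat \<Rightarrow> nat \<Rightarrow> nat \<Rightarrow> com" where
  "put a b i x = Basic (Add a b i) ;; Basic (Store a x)"

definition incr :: "nat \<Rightarrow> com" where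
  "incr x = Basic (Add x x 3)"

lemma wp_field [simp]:
  assumes "x \<noteq> b" "x \<noteq> i" "x \<noteq> c"
  shows "wp m B (field x b i c) Q r h k \<longleftrightarrow>
    r b + 3 * r i + r c < m \<and> r b + 3 * r i + r c < B \<and> h (r b + 3 * r i + r c) < B \<and>
    Q (r(x := h (r b + 3 * r i + r c))) h (k + 5)"
proof -
  have "r i + r i + r i + r b + r c = r b + 3 * r i + r c" "Suc (Suc (Suc (Suc (Suc k)))) = k + 5" by simp_all
  then have "wp m B (field x b i c) Q r h k \<longleftrightarrow> r i + r i < B \<and> r i + r i + r i < B \<and>
      r i + r i + r i + r b < B \<and> r b + 3 * r i + r c < B \<and> r b + 3 * r i + r c < m \<and>
      h (r b + 3 * r i + r c) < B \<and> Q (r(x := h (r b + 3 * r i + r c))) h (k + 5)"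
    using assms by (simp only: field_def wp.simps wp_instr.simps fun_upd_same fun_upd_other fun_upd_upd
        not_sym simp_thms)
  then show ?thesis by auto
qed

lemma wp_elem [simp]:
  "wp m B (elem x b i) Q r h k \<longleftrightarrow>
    r b + r i < m \<and> r b + r i < B \<and> h (r b + r i) < B \<and> Q (r(x := h (r b + r i))) h (k + 2)"
  by (auto simp: elem_def)

lemma wp_put [simp]:
  assumes "a \<noteq> x"
  shows "wp m B (put a b i x) Q r h k \<longleftrightarrow>
    r b + r i < m \<and> r b + r i < B \<and> Q (r(a := r b + r i)) (h(r b + r i := r x)) (k + 2)"
  using assms by (auto simp: put_def)

lemma wp_incr [simp]:
  "wp m B (incr x) Q r h k \<longleftrightarrow> r x + r 3 < B \<and> Q (r(x := r x + r 3)) h (Suc k)"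
  by (simp add: incr_def)

text \<open>Registers 2, 3 and 4 hold the constants 0, 1 and 2; the registers 5 to 9 and 14 hold the
  numbers of vertices and of edges, the addresses of the vertex table and of the edge table, the
  length of the text, and the root. The registers 10 to 13 and 0 hold the addresses of the arrays of
  in-degrees, of the lengths of \<open>repr_minus\<close>, of the queue, of the lengths of \<open>repr_plus\<close>, and of
  the output.\<close>

definition setup_code :: com where
  "setup_code =
     Basic (Const 2 0) ;; Basic (Const 3 1) ;; Basic (Const 4 2) ;;
     Basic (Load 10 2) ;; Basic (Load 5 3) ;; Basic (Load 6 4) ;;
     Basic (Const 14 3) ;; Basic (Load 14 14) ;; Basic (Const 9 5) ;; Basic (Load 9 9) ;;
     Basic (Const 7 6) ;; Basic (Load 7 7) ;; Basic (Const 8 7) ;; Basic (Load 8 8) ;;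
     Basic (Add 11 10 10) ;; Basic (Add 12 11 10) ;; Basic (Add 13 12 10) ;; Basic (Add 0 13 10)"

definition count_code :: com where
  "count_code = Basic (Const 20 0) ;;
     Loop 20 6 (field 26 8 20 4 ;; Basic (Add 28 10 26) ;; Basic (Load 29 28) ;; incr 29 ;;
       Basic (Store 28 29) ;; incr 20)"

definition sort_inner :: com where
  "sort_inner = Loop 23 24 (
     field 26 8 23 3 ;; Basic (Add 26 25 26) ;; field 27 8 23 4 ;;
     Basic (Add 28 11 27) ;; Basic (Load 29 28) ;; Cond 29 26 (Basic (Store 28 26)) Skip ;;
     Basic (Add 28 10 27) ;; Basic (Load 29 28) ;; Basic (Sub 29 29 3) ;; Basic (Store 28 29) ;;
     Cond 29 3 (put 28 12 21 27 ;; incr 21) Skip ;;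
     incr 23)"

definition sort_code :: com where
  "sort_code = Basic (Const 20 0) ;; Basic (Const 21 1) ;; Basic (Store 12 14) ;;
     Loop 20 21 (elem 22 12 20 ;; field 23 7 22 2 ;; field 24 7 22 3 ;; Basic (Add 24 24 23) ;;
       elem 25 11 22 ;; sort_inner ;; incr 20)"

text \<open>The index followed by five arrays. Taking the index length \<open>N\<close> as the size
  of the first four makes all base addresses sums of the header word \<open>I ! 0\<close>; it
  suffices because \<open>N\<close> is at least \<open>3 * nv\<close>. The last array, the output,
  is open-ended.\<close>

definition layout :: "nat list \<Rightarrow> (nat \<Rightarrow> nat) \<Rightarrow> (nat \<Rightarrow> nat) \<Rightarrow> (nat \<Rightarrow> nat) \<Rightarrow> (nat \<Rightarrow> nat) \<Rightarrow>
    (nat \<Rightarrow> nat) \<Rightarrow> nat \<Rightarrow> nat" where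
  "layout I d l q p z a = (let N = length I in
     if a < N then I ! a else if a < 2 * N then d (a - N) else if a < 3 * N then l (a - 2 * N)
     else if a < 4 * N then q (a - 3 * N) else if a < 5 * N then p (a - 4 * N) else z (a - 5 * N))"

section \<open>Verification of the initialisation and the topological sort\<close>

locale indexed_dag = dag nv ne rt fe od ln tg sc lm
  for nv ne rt :: nat and fe od ln tg sc lm :: "nat \<Rightarrow> nat" +
  fixes I :: "nat list" and N n nt et m B :: nat and sy :: "nat \<Rightarrow> nat"
  assumes len: "length I = N" "8 \<le> N"
    and header: "I ! 0 = N" "I ! 1 = nv" "I ! 2 = ne" "I ! 3 = rt" "I ! 5 = n" "I ! 6 = nt" "I ! 7 = et"
    and tables: "nt + 3 * nv \<le> N" "et + 3 * ne \<le> N"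
    and vertex: "v < nv \<Longrightarrow> I ! (nt + 3 * v) = fe v" "v < nv \<Longrightarrow> I ! (nt + 3 * v + 1) = od v"
    and edge: "i < ne \<Longrightarrow> I ! (et + 3 * i) = sy i" "i < ne \<Longrightarrow> I ! (et + 3 * i + 1) = ln i"
      "i < ne \<Longrightarrow> I ! (et + 3 * i + 2) = tg i"
    and bounds: "a < N \<Longrightarrow> I ! a < B" "8 * N \<le> B" "2 * n + 2 \<le> B" "7 * N \<le> m"
    and lm_n: "v < nv \<Longrightarrow> lm v \<le> n"
begin

abbreviation "lay \<equiv> layout I"
abbreviation (input) "Z \<equiv> \<lambda>_::nat. 0::nat"

lemma lay_index: "a < N \<Longrightarrow> lay d l q p z a = I ! a"
  by (simp add: layout_def len)

lemma lay_arrays [simp]: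
  "v < N \<Longrightarrow> lay d l q p z (N + v) = d v"
  "v < N \<Longrightarrow> lay d l q p z (2 * N + v) = l v"
  "v < N \<Longrightarrow> lay d l q p z (3 * N + v) = q v"
  "v < N \<Longrightarrow> lay d l q p z (4 * N + v) = p v"
  "lay d l q p z (5 * N + v) = z v"
  by (simp_all add: layout_def len)

text \<open>Turns a store into an update of one abstract array, so that the memory is again of the
  form \<open>lay\<close> afterwards.\<close>

lemma lay_update [simp]:
  "v < N \<Longrightarrow> (lay d l q p z)(N + v := x) = lay (d(v := x)) l q p z"
  "v < N \<Longrightarrow> (lay d l q p z)(2 * N + v := x) = lay d (l(v := x)) q p z"
  "v < N \<Longrightarrow> (lay d l q p z)(3 * N + v := x) = lay d l (q(v := x)) p z"
  "v < N \<Longrightarrow> (lay d l q p z)(4 * N + v := x) = lay d l q (p(v := x)) z"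
  "(lay d l q p z)(5 * N + v := x) = lay d l q p (z(v := x))"
  by (auto simp: layout_def len fun_eq_iff Let_def)

lemma sizes: "3 * nv \<le> N" "3 * ne \<le> N"
  using tables by auto

lemma lay_vertex [simp]:
  assumes "v < nv"
  shows "lay d l q p z (nt + 3 * v) = fe v" "lay d l q p z (Suc (nt + 3 * v)) = od v"
  using assms vertex[of v] tables by (simp_all add: lay_index)

lemma lay_edge [simp]:
  assumes "i < ne"
  shows "lay d l q p z (et + 3 * i) = sy i" "lay d l q p z (Suc (et + 3 * i)) = ln i"
    "lay d l q p z (Suc (Suc (et + 3 * i))) = tg i"
  using assms edge[of i] tables by (simp_all add: lay_index)

lemma vertex_bounds: assumes "v < nv"
  shows "Suc (nt + 3 * v) < N" "fe v < B" "od v < B" "fe v + od v < B"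
proof -
  show *: "Suc (nt + 3 * v) < N" using assms tables by simp
  show "fe v < B" "od v < B"
    using bounds(1)[of "nt + 3 * v"] bounds(1)[of "nt + 3 * v + 1"] vertex[OF assms] * by simp_all
  then show "fe v + od v < B" using out_bound[OF assms] sizes bounds(2) len(2) by (cases "od v = 0") auto
qed

lemma edge_bounds: assumes "i < ne"
  shows "Suc (Suc (et + 3 * i)) < N" "sy i < B" "ln i < B" "tg i < B"
proof -
  show *: "Suc (Suc (et + 3 * i)) < N" using assms tables by simp
  show "sy i < B" "ln i < B" "tg i < B"
    using bounds(1)[of "et + 3 * i"] bounds(1)[of "et + 3 * i + 1"] bounds(1)[of "et + 3 * i + 2"]
      edge[OF assms] * by simp_all
qed

definition env :: "(nat \<Rightarrow> nat) \<Rightarrow> bool" where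
  "env r \<longleftrightarrow> r 0 = 5 * N \<and> r 2 = 0 \<and> r 3 = 1 \<and> r 4 = 2 \<and> r 5 = nv \<and> r 6 = ne \<and> r 7 = nt \<and> r 8 = et \<and>
     r 9 = n \<and> r 10 = N \<and> r 11 = 2 * N \<and> r 12 = 3 * N \<and> r 13 = 4 * N \<and> r 14 = rt"

lemma wp_setup:
  assumes "\<And>r k'. env r \<Longrightarrow> k' \<le> k + 18 \<Longrightarrow> Q r (lay Z Z Z Z Z) k'"
  shows "wp m B setup_code Q r (lay Z Z Z Z Z) k"
proof -
  have hd: "lay Z Z Z Z Z 0 = N" "lay Z Z Z Z Z 1 = nv" "lay Z Z Z Z Z 2 = ne" "lay Z Z Z Z Z 3 = rt"
    "lay Z Z Z Z Z 5 = n" "lay Z Z Z Z Z 6 = nt" "lay Z Z Z Z Z 7 = et"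
    using header len by (simp_all add: lay_index)
  have b: "nv < B" "ne < B" "rt < B" "n < B" "nt < B" "et < B"
    using sizes tables bounds rt len by auto
  show ?thesis unfolding setup_code_def using hd b bounds len
    by simp (rule assms, simp_all add: env_def)
qed

definition indeg :: "nat \<Rightarrow> (nat \<Rightarrow> nat) \<Rightarrow> bool" where
  "indeg j d \<longleftrightarrow> (\<forall>v<nv. d v = card {i. i < j \<and> tg i = v})"

lemma wp_count:
  assumes "env r"
    and Q: "\<And>r d k'. env r \<Longrightarrow> indeg ne d \<Longrightarrow> k' \<le> k + 20 * ne + 3 \<Longrightarrow> Q r (lay d Z Z Z Z) k'"
  shows "wp m B count_code Q r (lay Z Z Z Z Z) k"
proof -
  have i0: "indeg 0 Z" by (simp add: indeg_def)
  \<comment> \<open>A round takes 12 steps; the bound 20 is rounded up, and so are the constants per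
    round of the later loops.\<close>
  let ?Inv = "\<lambda>j r h k'. env r \<and> r 20 = j \<and> k' \<le> k + 1 + 20 * j \<and> (\<exists>d. h = lay d Z Z Z Z \<and> indeg j d)"
  have "wp m B (Loop 20 6 (field 26 8 20 4 ;; Basic (Add 28 10 26) ;; Basic (Load 29 28) ;; incr 29 ;;
       Basic (Store 28 29) ;; incr 20)) Q (r(20 := 0)) (lay Z Z Z Z Z) (Suc k)"
  proof (rule wp_Loop[where Inv = ?Inv and n = ne])
    show "?Inv 0 (r(20 := 0)) (lay Z Z Z Z Z) (Suc k)" using assms(1) i0 by (auto simp: env_def)
  next
    fix j r h k' assume j: "j < ne" and "?Inv j r h k'"
    then obtain d where inv: "env r" "r 20 = j" "k' \<le> k + 1 + 20 * j" "h = lay d Z Z Z Z" "indeg j d" by blast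
    let ?w = "tg j"
    have w: "?w < nv" "?w < N" using tg[OF j] sizes by auto
    have "card {i. i < j \<and> tg i = ?w} \<le> card {..<j}" by (rule card_mono) auto
    then have dw: "d ?w \<le> j" using inv(5) w by (simp add: indeg_def)
    have "indeg (Suc j) (d(?w := Suc (d ?w)))"
      unfolding indeg_def
    proof (intro allI impI)
      fix v assume v: "v < nv"
      have "{i. i < Suc j \<and> tg i = v} = (if v = ?w then insert j {i. i < j \<and> tg i = v} else {i. i < j \<and> tg i = v})"
        by (auto simp: less_Suc_eq)
      then show "(d(?w := Suc (d ?w))) v = card {i. i < Suc j \<and> tg i = v}"
        using inv(5) v by (simp add: indeg_def)
    qed
    then show "r 20 < r 6 \<and> wp m B (field 26 8 20 4 ;; Basic (Add 28 10 26) ;; Basic (Load 29 28) ;; incr 29 ;;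
       Basic (Store 28 29) ;; incr 20) (\<lambda>r h k. ?Inv (Suc j) r h (Suc k)) r h (Suc k')"
      using inv(1-3) j w dw bounds(2,4) len sizes edge_bounds[OF j] unfolding inv(4) env_def
      by auto
  next
    fix r h k' assume "?Inv ne r h k'"
    then show "\<not> r 20 < r 6 \<and> Q r h (k' + 2)" using Q by (auto simp: env_def)
  qed
  then show ?thesis using bounds len by (simp add: count_code_def)
qed

text \<open>State of the inner loop after \<open>c\<close> edges of the queue entry \<open>v\<close>
  at \<open>h\<close>. The number \<open>s\<close> of edges treated at earlier entries is a
  parameter because the outer time bound expresses it through the array \<open>q\<close>, which
  changes.\<close>

definition sorting :: "nat \<Rightarrow> nat \<Rightarrow> nat \<Rightarrow> nat \<Rightarrow> nat \<Rightarrow> (nat \<Rightarrow> nat) \<Rightarrow> (nat \<Rightarrow> nat) \<Rightarrow> (nat \<Rightarrow> nat) \<Rightarrow> bool" where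
  "sorting h v s c t d l q \<longleftrightarrow> h < t \<and> q h = v \<and>
     kahn (removed q h \<union> {fe v ..< fe v + c}) t d l q \<and> (\<Sum>j<h. od (q j)) = s"

lemma wp_sort_inner:
  assumes r: "env r" "r 20 = h" "r 23 = fe v" "r 24 = fe v + od v" "r 25 = lm v"
    and s0: "sorting h v s 0 (r 21) d l q"
    and Q: "\<And>r d l q k'. env r \<Longrightarrow> r 20 = h \<Longrightarrow> sorting h v s (od v) (r 21) d l q \<Longrightarrow>
      k' \<le> k + 40 * od v + 2 \<Longrightarrow> Q r (lay d l q Z Z) k'"
  shows "wp m B sort_inner Q r (lay d l q Z Z) k"
proof -
  let ?Inv = "\<lambda>c r H k'. env r \<and> r 20 = h \<and> r 23 = fe v + c \<and> r 24 = fe v + od v \<and> r 25 = lm v \<and>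
    k' \<le> k + 40 * c \<and> (\<exists>d l q. H = lay d l q Z Z \<and> sorting h v s c (r 21) d l q)"
  show ?thesis unfolding sort_inner_def
  proof (rule wp_Loop[where Inv = ?Inv and n = "od v"])
    show "?Inv 0 r (lay d l q Z Z) k" using r s0 by auto
  next
    fix c r H k' assume c: "c < od v" and "?Inv c r H k'"
    then obtain d l q where inv: "env r" "r 20 = h" "r 23 = fe v + c" "r 24 = fe v + od v" "r 25 = lm v"
      "k' \<le> k + 40 * c" "H = lay d l q Z Z" "sorting h v s c (r 21) d l q" by blast
    define i where "i = fe v + c"
    define x where "x = lm v + ln i"
    define w where "w = tg i"
    define t where "t = r 21"
    have s: "h < t" "q h = v" "kahn (removed q h \<union> {fe v ..< fe v + c}) t d l q" "(\<Sum>j<h. od (q j)) = s"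
      using inv(8) by (simp_all add: sorting_def t_def)
    note st = kahn_inner[OF s(3,1,2) c, folded i_def, folded x_def w_def]
    have sort': "sorting h v s (Suc c) (if d w = 1 then Suc t else t) (d(w := d w - 1))
        (if l w < x then l(w := x) else l) (if d w = 1 then q(t := w) else q)"
      using st(5-8) s(4) by (simp add: sorting_def)
    have t': "(if d w = 1 then Suc t else t) \<le> nv" using kahn_t[OF st(7)] .
    have w: "w < nv" "w < N" using st(2) sizes len by auto
    have b: "d w \<le> ne" "l w \<le> n" "x \<le> n" "ne < B" "n < B" "d w - 1 < B"
      using kahn_d_le[OF s(3) w(1)] kahn_l_le[OF s(3) w(1)] lm_n[OF w(1)] st(4) bounds sizes len by auto
    have f: "r 23 = i" "r 21 = t" "r 24 = fe v + od v" "r 25 = lm v" "i < fe v + od v"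
      using inv c by (simp_all add: i_def t_def)
    have g: "fe v + Suc c = Suc i" by (simp add: i_def)
    note facts = inv(2,6) f w b t' bounds(2,4) len sizes edge_bounds[OF st(1)] st(1,3)
    show "r 23 < r 24 \<and> wp m B (field 26 8 23 3 ;; Basic (Add 26 25 26) ;; field 27 8 23 4 ;;
       Basic (Add 28 11 27) ;; Basic (Load 29 28) ;; Cond 29 26 (Basic (Store 28 26)) Skip ;;
       Basic (Add 28 10 27) ;; Basic (Load 29 28) ;; Basic (Sub 29 29 3) ;; Basic (Store 28 29) ;;
       Cond 29 3 (put 28 12 21 27 ;; incr 21) Skip ;;
       incr 23) (\<lambda>r h k. ?Inv (Suc c) r h (Suc k)) r H (Suc k')"
      unfolding g
    proof (intro conjI)
      show "r 23 < r 24" using f by simp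
    next
      \<comment> \<open>The cases decide both conditionals: whether the path length improves, and
        whether the in-degree, which is positive, drops to 0.\<close>
      consider "l w < x" "d w = 1" | "l w < x" "1 < d w" | "\<not> l w < x" "d w = 1" | "\<not> l w < x" "1 < d w"
        using st(3) by linarith
      then show "wp m B (field 26 8 23 3 ;; Basic (Add 26 25 26) ;; field 27 8 23 4 ;;
       Basic (Add 28 11 27) ;; Basic (Load 29 28) ;; Cond 29 26 (Basic (Store 28 26)) Skip ;;
       Basic (Add 28 10 27) ;; Basic (Load 29 28) ;; Basic (Sub 29 29 3) ;; Basic (Store 28 29) ;;
       Cond 29 3 (put 28 12 21 27 ;; incr 21) Skip ;;
       incr 23) (\<lambda>r h' k'. env r \<and> r 20 = h \<and> r 23 = Suc i \<and> r 24 = fe v + od v \<and> r 25 = lm v \<and>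
    Suc k' \<le> k + 40 * Suc c \<and> (\<exists>d l q. h' = lay d l q Z Z \<and> sorting h v s (Suc c) (r 21) d l q)) r H (Suc k')"
      proof cases
        case 1
        then show ?thesis using facts inv(1) sort' unfolding inv(7) env_def
          by (simp flip: w_def x_def) blast
      next
        case 2
        then show ?thesis using facts inv(1) sort' unfolding inv(7) env_def
          by (simp flip: w_def x_def) blast
      next
        case 3
        then show ?thesis using facts inv(1) sort' unfolding inv(7) env_def
          by (simp flip: w_def x_def) blast
      next
        case 4
        then show ?thesis using facts inv(1) sort' unfolding inv(7) env_def
          by (simp flip: w_def x_def) blast
      qed
    qed
  next
    fix r H k' assume "?Inv (od v) r H k'"
    then show "\<not> r 23 < r 24 \<and> Q r H (k' + 2)" using Q by auto
  qed
qed

text \<open>The invariant charges 40 steps to each processed queue entry and 40 to each of its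
  outgoing edges. In the end \<open>q\<close> permutes the vertices, so the charges for edges add up
  to \<open>40 * ne\<close>.\<close>

lemma wp_sort:
  assumes "env r" "indeg ne d"
    and Q: "\<And>r d l q k'. env r \<Longrightarrow> kahn (removed q nv) nv d l q \<Longrightarrow>
      k' \<le> k + 40 * nv + 40 * ne + 5 \<Longrightarrow> Q r (lay d l q Z Z) k'"
  shows "wp m B sort_code Q r (lay d Z Z Z Z) k"
proof -
  define sorted where "sorted h t d l q \<longleftrightarrow> h \<le> t \<and> kahn (removed q h) t d l q" for h t d l q
  let ?Inv = "\<lambda>h r H k'. env r \<and> r 20 = h \<and> (\<exists>d l q. H = lay d l q Z Z \<and> sorted h (r 21) d l q \<and>
    k' \<le> k + 3 + 40 * h + 40 * (\<Sum>j<h. od (q j)))"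
  let ?r = "r(20 := 0, 21 := 1)" and ?H = "lay d Z (Z(0 := rt)) Z Z"
  have "removed (Z(0 := rt)) 0 = {}" by (simp add: removed_def)
  then have i0: "sorted 0 1 d Z (Z(0 := rt))"
    using kahn_init[of d Z] assms(2) unfolding sorted_def indeg_def by simp
  have "wp m B (Loop 20 21 (elem 22 12 20 ;; field 23 7 22 2 ;; field 24 7 22 3 ;; Basic (Add 24 24 23) ;;
       elem 25 11 22 ;; sort_inner ;; incr 20)) Q ?r ?H (k + 3)"
  \<comment> \<open>The loop test compares head and tail of the queue; that it succeeds exactly
    \<open>nv\<close> times follows from \<open>kahn_head\<close> and \<open>kahn_t\<close>.\<close>
  proof (rule wp_Loop[where Inv = ?Inv and n = nv])
    show "?Inv 0 ?r ?H (k + 3)" using assms(1) i0 by (auto simp: env_def)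
  next
    fix h r H k' assume h: "h < nv" and "?Inv h r H k'"
    then obtain d l q where inv: "env r" "r 20 = h" "H = lay d l q Z Z" "sorted h (r 21) d l q"
      "k' \<le> k + 3 + 40 * h + 40 * (\<Sum>j<h. od (q j))" by blast
    define v where "v = q h"
    define s where "s = (\<Sum>j<h. od (q j))"
    have k: "kahn (removed q h) (r 21) d l q" and ht: "h < r 21"
      using inv(4) kahn_head[OF _ _ h] by (auto simp: sorted_def)
    have v: "v < nv" "v < N" "h < N" "l v = lm v" "lm v < B"
      using kahn_q[OF k ht] kahn_l_final[OF k kahn_q[OF k ht]] lm_n[of v] sizes h bounds len by (auto simp: v_def)
    have s0: "sorting h v s 0 (r 21) d l q" using k ht by (simp add: sorting_def v_def s_def)
    have Q': "?Inv (Suc h) (r'(20 := Suc h)) (lay d' l' q' Z Z) (Suc (Suc k''))"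
      if r': "env r'" and so: "sorting h v s (od v) (r' 21) d' l' q'" and k'': "k'' \<le> k' + 20 + 40 * od v"
      for r' d' l' q' k''
    proof -
      have 1: "h < r' 21" "q' h = v" "kahn (removed q' h \<union> {fe v ..< fe v + od v}) (r' 21) d' l' q'"
        "(\<Sum>j<h. od (q' j)) = s" using so by (simp_all add: sorting_def)
      then have "sorted (Suc h) (r' 21) d' l' q'"
        using removed_Suc[of q' h v, OF 1(2) v(1)] by (simp add: sorted_def)
      moreover have "Suc (Suc k'') \<le> k + 3 + 40 * Suc h + 40 * (\<Sum>j<Suc h. od (q' j))"
        using k'' inv(5) 1(2,4) by (simp flip: s_def)
      ultimately show ?thesis using r' by (auto simp: env_def)
    qed
    define R where "R = (\<lambda>r h' k. ?Inv (Suc h) r h' (Suc k))"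
    have inner: "wp m B sort_inner (wp m B (incr 20) R) r' (lay d l q Z Z) k''"
      if r': "env r'" "r' 20 = h" "r' 23 = fe v" "r' 24 = fe v + od v" "r' 25 = lm v" "r' 21 = r 21"
        "k'' \<le> k' + 18" for r' k''
    proof (rule wp_sort_inner[OF r'(1-5)])
      show "sorting h v s 0 (r' 21) d l q" using s0 r'(6) by simp
      fix r'' d l q kk assume a: "env r''" "r'' 20 = h" "sorting h v s (od v) (r'' 21) d l q"
        "kk \<le> k'' + 40 * od v + 2"
      have "h + 1 < B" using v bounds len by simp
      moreover have "?Inv (Suc h) (r''(20 := Suc h)) (lay d l q Z Z) (Suc (Suc kk))"
        using a r'(7) by (intro Q') auto
      ultimately show "wp m B (incr 20) R r'' (lay d l q Z Z) kk"
        using a(1,2) unfolding wp_incr R_def by (simp add: env_def)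
    qed
    have "r 20 < r 21" using ht inv(2) by simp
    moreover have "wp m B (elem 22 12 20 ;; field 23 7 22 2 ;; field 24 7 22 3 ;; Basic (Add 24 24 23) ;;
       elem 25 11 22 ;; sort_inner ;; incr 20) R r H (Suc k')"
      using inv(1,2) v bounds(2,4) len sizes vertex_bounds[OF v(1)] ht
      unfolding inv(3) env_def
      by (simp flip: v_def del: wp_incr) (rule inner, auto simp: env_def)
    ultimately show "r 20 < r 21 \<and> wp m B (elem 22 12 20 ;; field 23 7 22 2 ;; field 24 7 22 3 ;;
       Basic (Add 24 24 23) ;; elem 25 11 22 ;; sort_inner ;; incr 20) (\<lambda>r h' k. ?Inv (Suc h) r h' (Suc k)) r H (Suc k')"
      unfolding R_def by blast
  next
    fix r H k' assume "?Inv nv r H k'"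
    then obtain d l q where inv: "env r" "r 20 = nv" "H = lay d l q Z Z" "sorted nv (r 21) d l q"
      "k' \<le> k + 3 + 40 * nv + 40 * (\<Sum>j<nv. od (q j))" by blast
    have k: "kahn (removed q nv) (r 21) d l q" and "nv \<le> r 21" using inv(4) by (simp_all add: sorted_def)
    then have t: "r 21 = nv" using kahn_t[OF k] by simp
    then have k: "kahn (removed q nv) nv d l q" using k by simp
    have "q ` {..<nv} \<subseteq> {..<nv}" using kahn_q[OF k] by auto
    then have "q ` {..<nv} = {..<nv}" using kahnD(2)[OF k] by (simp add: endo_inj_surj)
    then have "(\<Sum>j<nv. od (q j)) = ne" using sum_out kahnD(2)[OF k] by blast
    then show "\<not> r 20 < r 21 \<and> Q r H (k' + 2)" using inv t Q[OF inv(1) k, of "k' + 2"] by simp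
  qed
  moreover have "(lay d Z Z Z Z)(3 * N := rt) = ?H" using lay_update(3)[of 0 d Z Z Z Z rt] len by simp
  ultimately show ?thesis using bounds len assms(1)
    by (simp add: sort_code_def env_def numeral_3_eq_3)
qed

end

section \<open>Lengths of \<open>repr_plus\<close>, primary edges and output\<close>

definition info :: "bool \<Rightarrow> nat \<Rightarrow> nat \<Rightarrow> com" where
  "info by_lex x y = field x 8 23 4 ;; elem x 13 x ;; field 31 8 23 3 ;; Basic (Add x x 31) ;;
     (if by_lex then field y 8 23 2 else Basic (Sub y 9 x))"

text \<open>\<open>x\<close> holds the length of a suffix, whose position is
  \<open>n - x + 1\<close>. Register 15 is the write address, and register 1 counts the
  pairs.\<close>

definition emit :: "nat \<Rightarrow> nat \<Rightarrow> com" where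
  "emit x y = Basic (Sub x 9 x) ;; incr x ;; Basic (Store 15 x) ;; incr 15 ;;
     Basic (Store 15 y) ;; incr 15 ;; incr 1"

text \<open>Of the best edge so far and the current edge the one with the larger key is not primary, and
  its pair is written at once.\<close>

definition scan_code :: "bool \<Rightarrow> com" where
  "scan_code by_lex = Loop 23 24 (info by_lex 28 29 ;;
     Cond 29 27 (Basic (Move 30 26) ;; Basic (Move 26 28) ;; Basic (Move 27 29)) (Basic (Move 30 28)) ;;
     Basic (Add 30 30 25) ;; emit 30 25 ;; incr 23)"

text \<open>Register 20 runs down to 0, so the targets of a vertex are finished before the vertex
  itself. \<open>Cond 23 24\<close> skips a vertex without outgoing edges; its entry keeps the
  initial 0, the length of the empty \<open>repr_plus\<close>. The trivial suffix comes last, with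
  its value 0 taken from register 2.\<close>

definition output_code :: "bool \<Rightarrow> com" where
  "output_code by_lex = Basic (Const 1 0) ;; Basic (Move 15 0) ;; Basic (Move 20 5) ;;
     Loop 2 20 (Basic (Sub 20 20 3) ;; elem 22 12 20 ;; field 23 7 22 2 ;; field 24 7 22 3 ;;
       Basic (Add 24 24 23) ;; elem 25 11 22 ;;
       Cond 23 24 (info by_lex 26 27 ;; incr 23 ;; scan_code by_lex ;; put 31 13 22 26) Skip) ;;
     elem 30 13 14 ;; emit 30 2"

definition glpf_program :: "bool \<Rightarrow> com" where
  "glpf_program by_lex = setup_code ;; count_code ;; sort_code ;; output_code by_lex"

definition stored :: "(nat \<times> nat) list \<Rightarrow> (nat \<Rightarrow> nat) \<Rightarrow> bool" where
  "stored ps z \<longleftrightarrow> (\<forall>k<length ps. z (2 * k) = fst (ps ! k) \<and> z (Suc (2 * k)) = snd (ps ! k))"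

lemma stored_snoc:
  assumes "stored ps z" "j = length ps"
  shows "stored (ps @ [(a, b)]) (z(2 * j := a, Suc (2 * j) := b))"
  using assms by (auto simp: stored_def nth_append less_Suc_eq)

text \<open>\<open>lp\<close> stands for the lengths of \<open>repr_plus\<close>. Subtracting from
  \<open>n\<close> in \<open>key\<close> turns the maximisation of the text order into a
  minimisation, so one comparison serves both orders; \<open>key_inj\<close> excludes ties among the
  edges of a vertex.\<close>

locale keyed_dag = indexed_dag +
  fixes lp key :: "nat \<Rightarrow> nat" and by_lex :: bool
  assumes key_def: "key i = (if by_lex then sy i else n - (ln i + lp (tg i)))"
    and key_inj: "i < ne \<Longrightarrow> j < ne \<Longrightarrow> sc i = sc j \<Longrightarrow> key i = key j \<Longrightarrow> i = j"
    and lp_leaf: "v < nv \<Longrightarrow> od v = 0 \<Longrightarrow> lp v = 0"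
    and lp_primary: "i < ne \<Longrightarrow> (\<And>j. j < ne \<Longrightarrow> sc j = sc i \<Longrightarrow> key i \<le> key j) \<Longrightarrow>
      lp (sc i) = ln i + lp (tg i)"
    and total_n: "i < ne \<Longrightarrow> ln i + lp (tg i) + lm (sc i) \<le> n"
    and lp_n: "v < nv \<Longrightarrow> lp v \<le> n"
begin

definition primary :: "nat \<Rightarrow> bool" where
  "primary i \<longleftrightarrow> i < ne \<and> (\<forall>j<ne. sc j = sc i \<longrightarrow> key i \<le> key j)"

definition edge_pair :: "nat \<Rightarrow> nat \<times> nat" where
  "edge_pair i = (Suc (n - (ln i + lp (tg i) + lm (sc i))), lm (sc i))"

definition topological :: "(nat \<Rightarrow> nat) \<Rightarrow> bool" where
  "topological q \<longleftrightarrow> inj_on q {..<nv} \<and> q ` {..<nv} = {..<nv} \<and>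
     (\<forall>i<ne. \<forall>a<nv. sc i = q a \<longrightarrow> tg i \<in> q ` {Suc a..<nv})"

lemma kahn_topological:
  assumes k: "kahn (removed q nv) nv d l q" shows "topological q" "v < nv \<Longrightarrow> l v = lm v"
proof -
  have "q ` {..<nv} \<subseteq> {..<nv}" using kahn_q[OF k] by auto
  then have surj: "q ` {..<nv} = {..<nv}" using kahnD(2)[OF k] by (simp add: endo_inj_surj)
  have "tg i \<in> q ` {Suc a..<nv}" if i: "i < ne" and a: "a < nv" "sc i = q a" for i a
  proof -
    have "tg i \<in> q ` {..<nv}" using surj tg[OF i] by blast
    then obtain b where b: "b < nv" "tg i = q b" by auto
    then obtain a' where a': "a' < b" "sc i = q a'" using kahnD(6)[OF k b(1) i] by blast
    have "q a' = q a" using a(2) a'(2) by simp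
    then have "a' = a" by (rule inj_onD[OF kahnD(2)[OF k]]) (use a a' b in simp_all)
    then have "b \<in> {Suc a..<nv}" using a'(1) b(1) by simp
    then show ?thesis unfolding b(2) by (rule imageI)
  qed
  then show "topological q" using kahnD(2)[OF k] surj by (simp add: topological_def)
  show "l v = lm v" if v: "v < nv"
  proof (rule kahn_l_final[OF k v])
    have "v \<in> q ` {..<nv}" using surj v by blast
    then show "d v = 0" unfolding kahnD(3)[OF k] by simp
  qed
qed

text \<open>\<open>b\<close> is the best of the edges before \<open>c\<close> and is held back from
  the output; \<open>xs\<close> are the edges written before \<open>v\<close> was reached,
  \<open>ys\<close> those written by now.\<close>

definition scan :: "nat \<Rightarrow> nat \<Rightarrow> nat \<Rightarrow> nat list \<Rightarrow> nat list \<Rightarrow> bool" where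
  "scan v c b xs ys \<longleftrightarrow> fe v \<le> b \<and> b < c \<and> c \<le> fe v + od v \<and> (\<forall>i. fe v \<le> i \<and> i < c \<longrightarrow> key b \<le> key i) \<and>
     distinct ys \<and> set ys = set xs \<union> ({fe v..<c} - {b}) \<and> set ys \<subseteq> {..<ne} \<and>
     (\<forall>i\<in>set xs. sc i \<noteq> v)"

text \<open>The loser of the comparison is written. Since the best edge is never among
  \<open>ys\<close>, fewer than \<open>ne\<close> edges have been written, which keeps the output
  inside its memory.\<close>

lemma scan_step:
  assumes v: "v < nv" and s: "scan v c b xs ys" and c: "c < fe v + od v"
  shows "key c < key b \<Longrightarrow> scan v (Suc c) c xs (ys @ [b])"
    "\<not> key c < key b \<Longrightarrow> scan v (Suc c) b xs (ys @ [c])" "length ys < ne" "b < ne" "c < ne" "sc c = v" "sc b = v"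
proof -
  have s': "fe v \<le> b" "b < c" "\<forall>i. fe v \<le> i \<and> i < c \<longrightarrow> key b \<le> key i" "distinct ys"
    "set ys = set xs \<union> ({fe v..<c} - {b})" "set ys \<subseteq> {..<ne}" "\<forall>i\<in>set xs. sc i \<noteq> v"
    using s unfolding scan_def by auto
  show bc: "b < ne" "sc b = v" "c < ne" "sc c = v"
    using out_iff[OF v, of b] out_iff[OF v, of c] s' c by simp_all
  have nb: "b \<notin> set ys" "c \<notin> set ys" using s' bc by auto
  then have "set ys \<subset> {..<ne}" using s'(6) bc by auto
  then have "card (set ys) < card {..<ne}" by (rule psubset_card_mono[rotated]) simp
  then show "length ys < ne" using distinct_card[OF s'(4)] by simp
  show "scan v (Suc c) c xs (ys @ [b])" if k: "key c < key b"
  proof -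
    have "\<forall>i. fe v \<le> i \<and> i < Suc c \<longrightarrow> key c \<le> key i" using s'(3) k by (fastforce simp: less_Suc_eq)
    moreover have "set (ys @ [b]) = set xs \<union> ({fe v..<Suc c} - {c})" using s' by auto
    moreover have "set (ys @ [b]) \<subseteq> {..<ne}" using s'(6) bc by simp
    moreover have "distinct (ys @ [b])" "fe v \<le> c" "c < Suc c" "Suc c \<le> fe v + od v" using s' nb c by simp_all
    ultimately show ?thesis unfolding scan_def using s'(7) by (intro conjI)
  qed
  show "scan v (Suc c) b xs (ys @ [c])" if k: "\<not> key c < key b"
  proof -
    have "\<forall>i. fe v \<le> i \<and> i < Suc c \<longrightarrow> key b \<le> key i" using s'(3) k by (auto simp: less_Suc_eq)
    moreover have "set (ys @ [c]) = set xs \<union> ({fe v..<Suc c} - {b})" using s' by auto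
    moreover have "set (ys @ [c]) \<subseteq> {..<ne}" using s'(6) bc by simp
    moreover have "distinct (ys @ [c])" "b < Suc c" "Suc c \<le> fe v + od v" using s' nb c by simp_all
    ultimately show ?thesis unfolding scan_def using s'(1,7) by (intro conjI)
  qed
qed

text \<open>By \<open>key_inj\<close> the minimum \<open>b\<close> is the only primary edge of
  \<open>v\<close>, so exactly the others have been written.\<close>

lemma scan_end:
  assumes v: "v < nv" and s: "scan v (fe v + od v) b xs ys"
  shows "lp v = ln b + lp (tg b)" "b < ne"
    "set ys = set xs \<union> {i. i < ne \<and> sc i = v \<and> \<not> primary i}" "distinct ys"
proof -
  have s': "fe v \<le> b" "b < fe v + od v" "\<forall>i. fe v \<le> i \<and> i < fe v + od v \<longrightarrow> key b \<le> key i" "distinct ys"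
    "set ys = set xs \<union> ({fe v..<fe v + od v} - {b})"
    using s unfolding scan_def by auto
  have b: "b < ne" "sc b = v" using out_iff[OF v, of b] s' by simp_all
  have le: "key b \<le> key j" if "j < ne" "sc j = v" for j using s'(3) out_iff[OF v, of j] that by blast
  have "primary i \<longleftrightarrow> i = b" if i: "i < ne" "sc i = v" for i
  proof
    assume "primary i"
    then have "key i \<le> key b" using b i by (simp add: primary_def)
    then show "i = b" using le[OF i] key_inj[of i b] i b by simp
  qed (use le b in \<open>simp add: primary_def\<close>)
  then have "{i. i < ne \<and> sc i = v \<and> \<not> primary i} = {i. i < ne \<and> sc i = v} - {b}" by auto
  then show "set ys = set xs \<union> {i. i < ne \<and> sc i = v \<and> \<not> primary i}" using s'(5) out[OF v] by simp
  show "lp v = ln b + lp (tg b)" "b < ne" "distinct ys" using lp_primary[of b] le b s'(4) by auto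
qed

lemma lay_output_Suc [simp]:
  "lay d l q p z (Suc (5 * N + v)) = z (Suc v)"
  "(lay d l q p z)(Suc (5 * N + v) := x) = lay d l q p (z(Suc v := x))"
  using lay_arrays(5)[of d l q p z "Suc v"] lay_update(5)[of d l q p z "Suc v" x] by simp_all

lemma key_bound: "i < ne \<Longrightarrow> key i < B"
  using edge_bounds(2)[of i] bounds(3) diff_le_self[of n "ln i + lp (tg i)"] unfolding key_def by (cases by_lex) auto

lemma wp_info:
  assumes r: "env r" "r 23 = i" "i < ne" "p (tg i) = lp (tg i)" and xy: "x = 26 \<and> y = 27 \<or> x = 28 \<and> y = 29"
    and Q: "\<And>r' k'. r' x = ln i + lp (tg i) \<Longrightarrow> r' y = key i \<Longrightarrow> (\<And>a. a \<notin> {x, y, 31} \<Longrightarrow> r' a = r a) \<Longrightarrow>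
      k' \<le> k + 18 \<Longrightarrow> Q r' (lay d l q p z) k'"
  shows "wp m B (info by_lex x y) Q r (lay d l q p z) k"
proof -
  have w: "tg i < nv" "tg i < N" using tg[OF r(3)] sizes by auto
  have b: "lp (tg i) < B" "ln i + lp (tg i) < B" "n < B"
    using total_n[OF r(3)] bounds by auto
  note facts = r w b edge_bounds[OF r(3)] bounds(2,4) len sizes key_bound[OF r(3)]
  show ?thesis
  proof (cases by_lex)
    case True
    then have "key i = sy i" by (simp add: key_def)
    note facts = facts this True
    from xy show ?thesis
    proof (elim disjE conjE)
      assume "x = 26" "y = 27"
      then show ?thesis using facts by (simp add: info_def env_def) (rule Q; simp)
    next
      assume "x = 28" "y = 29"
      then show ?thesis using facts by (simp add: info_def env_def) (rule Q; simp)
    qed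
  next
    case False
    then have "n - (lp (tg i) + ln i) = key i" by (simp add: key_def add.commute)
    note facts = facts this False
    from xy show ?thesis
    proof (elim disjE conjE)
      assume "x = 26" "y = 27"
      then show ?thesis using facts by (simp add: info_def env_def) (rule Q; simp)
    next
      assume "x = 28" "y = 29"
      then show ?thesis using facts by (simp add: info_def env_def) (rule Q; simp)
    qed
  qed
qed

lemma wp_emit:
  assumes r: "env r" "r 30 = a" "a \<le> n" "r y = b" "b < B" "r 1 = c" "r 15 = 5 * N + 2 * c" "c \<le> ne"
    and y: "y = 25 \<or> y = 2"
    and Q: "\<And>r' k'. r' 15 = 5 * N + 2 * Suc c \<Longrightarrow> r' 1 = Suc c \<Longrightarrow>
      (\<And>x. x \<notin> {30, 15, 1} \<Longrightarrow> r' x = r x) \<Longrightarrow> k' \<le> k + 7 \<Longrightarrow>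
      Q r' (lay d l q p (z(2 * c := Suc (n - a), Suc (2 * c) := b))) k'"
  shows "wp m B (emit 30 y) Q r (lay d l q p z) k"
proof -
  have b: "n - a < B" "Suc (n - a) < B" using bounds(3) by linarith+
  show ?thesis using y
  proof
    assume "y = 25"
    then show ?thesis using r b bounds(2,4) len sizes by (simp add: emit_def env_def) (rule Q; simp)
  next
    assume y: "y = 2"
    then have "b = 0" using r(1,4) by (simp add: env_def)
    then show ?thesis using y r b bounds(2,4) len sizes
      by (simp add: emit_def env_def) (rule Q[unfolded \<open>b = 0\<close>]; simp)
  qed
qed

text \<open>Register 1 is exempt because it is the output counter; registers above 14 are working
  registers.\<close>

lemma env_cong: assumes "env r" "\<And>a. a \<le> 14 \<Longrightarrow> a \<noteq> 1 \<Longrightarrow> r' a = r a" shows "env r'"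
  using assms by (simp add: env_def)

definition written :: "nat list \<Rightarrow> (nat \<Rightarrow> nat) \<Rightarrow> (nat \<Rightarrow> nat) \<Rightarrow> bool" where
  "written ys r z \<longleftrightarrow> stored (map edge_pair ys) z \<and> r 1 = length ys \<and> r 15 = 5 * N + 2 * length ys"

lemma wp_scan:
  assumes v: "v < nv" and p: "\<And>i. i < ne \<Longrightarrow> sc i = v \<Longrightarrow> p (tg i) = lp (tg i)" and od: "0 < od v"
    and r: "env r" "r 20 = j" "r 22 = v" "r 23 = Suc (fe v)" "r 24 = fe v + od v" "r 25 = lm v"
      "r 26 = ln (fe v) + lp (tg (fe v))" "r 27 = key (fe v)"
    and s0: "scan v (Suc (fe v)) (fe v) xs xs" "written xs r z"
    and Q: "\<And>r b ys z k'. env r \<Longrightarrow> r 20 = j \<Longrightarrow> r 22 = v \<Longrightarrow> scan v (fe v + od v) b xs ys \<Longrightarrow>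
      r 26 = ln b + lp (tg b) \<Longrightarrow> written ys r z \<Longrightarrow>
      k' \<le> k + 50 * od v \<Longrightarrow> Q r (lay d l q p z) k'"
  shows "wp m B (scan_code by_lex) Q r (lay d l q p z) k"
proof -
  let ?Inv = "\<lambda>c r H k'. env r \<and> r 20 = j \<and> r 22 = v \<and> r 23 = Suc (fe v) + c \<and> r 24 = fe v + od v \<and>
    r 25 = lm v \<and> k' \<le> k + 48 * c \<and>
    (\<exists>b ys z. H = lay d l q p z \<and> scan v (Suc (fe v) + c) b xs ys \<and> r 26 = ln b + lp (tg b) \<and> r 27 = key b \<and>
      written ys r z)"
  have lmB: "lm v < B" using lm_n[OF v] bounds by simp
  show ?thesis unfolding scan_code_def
  \<comment> \<open>One round less than there are edges, as the first edge is the initial best. So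
    48 steps per round and 2 for leaving stay within \<open>50 * od v\<close>.\<close>
  proof (rule wp_Loop[where Inv = ?Inv and n = "od v - 1"])
    show "?Inv 0 r (lay d l q p z) k" using r s0 by auto
  next
    fix c r H k' assume c: "c < od v - 1" and "?Inv c r H k'"
    then obtain b ys z where inv: "env r" "r 20 = j" "r 22 = v" "r 23 = Suc (fe v) + c" "r 24 = fe v + od v" "r 25 = lm v"
      "k' \<le> k + 48 * c" "H = lay d l q p z" "scan v (Suc (fe v) + c) b xs ys" "r 26 = ln b + lp (tg b)" "r 27 = key b"
      "written ys r z" by blast
    define i where "i = Suc (fe v) + c"
    have i: "i < fe v + od v" using c by (simp add: i_def)
    note sc = scan_step[OF v inv(9)[folded i_def] i]
    have w: "stored (map edge_pair ys) z" "r 1 = length ys" "r 15 = 5 * N + 2 * length ys"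
      using inv(12) by (simp_all add: written_def)
    define R where "R = (\<lambda>r h k. ?Inv (Suc c) r h (Suc k))"
    \<comment> \<open>Common continuation of both branches: \<open>e\<close> is the edge that lost
      the comparison, \<open>b'\<close> the new best one.\<close>
    have fin: "wp m B (Basic (Add 30 30 25) ;; emit 30 25 ;; incr 23) R r' (lay d l q p z) k''"
      if r': "\<And>x. x \<notin> {26, 27, 28, 29, 30, 31} \<Longrightarrow> r' x = r x"
        and e: "r' 30 = ln e + lp (tg e)" "e < ne" "sc e = v" "k'' \<le> k' + 25"
        and b': "scan v (Suc i) b' xs (ys @ [e])" "r' 26 = ln b' + lp (tg b')" "r' 27 = key b'" for r' k'' e b'
    proof -
      let ?a = "ln e + lp (tg e) + lm v"
      have a: "?a \<le> n" using total_n[OF e(2)] e(3) by simp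
      then have aB: "?a < B" using bounds by simp
      have env': "env r'" using inv(1) by (rule env_cong) (simp add: r')
      have "wp m B (emit 30 25) (wp m B (incr 23) R) (r'(30 := ?a)) (lay d l q p z) (Suc k'')"
      proof (rule wp_emit[where a = ?a and b = "lm v" and c = "length ys"])
        show "env (r'(30 := ?a))" using env' by (rule env_cong) simp
        show "(r'(30 := ?a)) 15 = 5 * N + 2 * length ys" "(r'(30 := ?a)) 1 = length ys" "(r'(30 := ?a)) 25 = lm v"
          using w inv(6) r' by simp_all
        fix r'' kk assume r'': "r'' 15 = 5 * N + 2 * Suc (length ys)" "r'' 1 = Suc (length ys)"
          "\<And>x. x \<notin> {30, 15, 1} \<Longrightarrow> r'' x = (r'(30 := ?a)) x" "kk \<le> Suc k'' + 7"
        let ?z = "z(2 * length ys := Suc (n - ?a), Suc (2 * length ys) := lm v)"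
        have env'': "env (r''(23 := Suc i))" using env' by (rule env_cong) (simp add: r'')
        have "stored (map edge_pair ys @ [(Suc (n - ?a), lm v)]) ?z"
          by (rule stored_snoc) (use w in simp_all)
        then have wr: "written (ys @ [e]) (r''(23 := Suc i)) ?z"
          using e(3) r''(1,2) by (simp add: written_def edge_pair_def)
        have "?Inv (Suc c) (r''(23 := Suc i)) (lay d l q p ?z) (Suc (Suc kk))"
        proof (intro conjI exI)
          show "(r''(23 := Suc i)) 23 = Suc (fe v) + Suc c" by (simp add: i_def)
          show "scan v (Suc (fe v) + Suc c) b' xs (ys @ [e])" using b'(1) by (simp add: i_def)
          show "Suc (Suc kk) \<le> k + 48 * Suc c" using r''(4) e(4) inv(7) by simp
          show "written (ys @ [e]) (r''(23 := Suc i)) ?z" using wr .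
          show "(r''(23 := Suc i)) 26 = ln b' + lp (tg b')" "(r''(23 := Suc i)) 27 = key b'" using b'(2,3) r'' by simp_all
        qed (use env'' inv r' r'' in simp_all)
        moreover have "i + 1 < B" using sc(5) sizes bounds len by simp
        ultimately show "wp m B (incr 23) R r'' (lay d l q p ?z) kk"
          using r''(3)[of 23] r''(3)[of 3] r'[of 23] r'[of 3] inv(1,4) by (simp add: R_def env_def i_def)
      qed (use a lmB sc(3) in simp_all)
      then show ?thesis using e(1) aB inv(6) r'[of 25] by simp
    qed
    have "wp m B (info by_lex 28 29) (wp m B (
        Cond 29 27 (Basic (Move 30 26) ;; Basic (Move 26 28) ;; Basic (Move 27 29)) (Basic (Move 30 28)) ;;
        Basic (Add 30 30 25) ;; emit 30 25 ;; incr 23) R) r H (Suc k')" unfolding inv(8)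
    proof (rule wp_info[where i = i])
      show "p (tg i) = lp (tg i)" using p sc(5,6) by simp
      fix r' k'' assume r': "r' 28 = ln i + lp (tg i)" "r' 29 = key i" "\<And>a. a \<notin> {28, 29, 31} \<Longrightarrow> r' a = r a"
        "k'' \<le> Suc k' + 18"
      have bd: "ln i + lp (tg i) < B" "ln b + lp (tg b) < B" "key i < B"
        using total_n[OF sc(4)] total_n[OF sc(5)] key_bound[OF sc(5)] bounds by simp_all
      show "wp m B (Cond 29 27 (Basic (Move 30 26) ;; Basic (Move 26 28) ;; Basic (Move 27 29)) (Basic (Move 30 28)) ;;
        Basic (Add 30 30 25) ;; emit 30 25 ;; incr 23) R r' (lay d l q p z) k''"
      proof (cases "key i < key b")
        case True
        have "wp m B (Basic (Add 30 30 25) ;; emit 30 25 ;; incr 23) R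
            (r'(30 := r' 26, 26 := r' 28, 27 := r' 29)) (lay d l q p z) (k'' + 4)"
          by (rule fin[OF _ _ _ _ _ sc(1)[OF True]]) (use r' inv sc in simp_all)
        then show ?thesis using True r' inv(10,11) bd by (simp add: eval_nat_numeral)
      next
        case False
        have "wp m B (Basic (Add 30 30 25) ;; emit 30 25 ;; incr 23) R
            (r'(30 := r' 28)) (lay d l q p z) (k'' + 3)"
          by (rule fin[OF _ _ _ _ _ sc(2)[OF False]]) (use r' inv sc in simp_all)
        then show ?thesis using False r' inv(10,11) bd by (simp add: eval_nat_numeral)
      qed
    qed (use inv sc in \<open>simp_all add: i_def\<close>)
    moreover have "r 23 < r 24" using inv i by (simp add: i_def)
    ultimately show "r 23 < r 24 \<and> wp m B (info by_lex 28 29 ;;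
      Cond 29 27 (Basic (Move 30 26) ;; Basic (Move 26 28) ;; Basic (Move 27 29)) (Basic (Move 30 28)) ;;
      Basic (Add 30 30 25) ;; emit 30 25 ;; incr 23) (\<lambda>r h k. ?Inv (Suc c) r h (Suc k)) r H (Suc k')"
      unfolding R_def by simp
  next
    fix r H k' assume "?Inv (od v - 1) r H k'"
    then show "\<not> r 23 < r 24 \<and> Q r H (k' + 2)" using od Q by auto
  qed
qed

text \<open>The clause that \<open>p\<close> is still 0 at untreated vertices justifies skipping a
  vertex without outgoing edges.\<close>

definition finished :: "(nat \<Rightarrow> nat) \<Rightarrow> nat \<Rightarrow> (nat \<Rightarrow> nat) \<Rightarrow> nat list \<Rightarrow> bool" where
  "finished q j p xs \<longleftrightarrow> (\<forall>v<nv. p v = (if v \<in> q ` {j..<nv} then lp v else 0)) \<and> distinct xs \<and>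
     set xs = {i. i < ne \<and> sc i \<in> q ` {j..<nv} \<and> \<not> primary i}"

text \<open>In a topological order the targets of the edges leaving \<open>q j\<close> stand at
  later positions, so their entries of \<open>p\<close> are final.\<close>

lemma finished_step:
  assumes t: "topological q" and j: "j < nv" and f: "finished q (Suc j) p xs"
  defines "v \<equiv> q j"
  shows "v < nv" "od v = 0 \<Longrightarrow> finished q j p xs" "0 < od v \<Longrightarrow> scan v (Suc (fe v)) (fe v) xs xs"
    "i < ne \<Longrightarrow> sc i = v \<Longrightarrow> p (tg i) = lp (tg i)"
    "scan v (fe v + od v) b xs ys \<Longrightarrow> finished q j (p(v := ln b + lp (tg b))) ys"
proof -
  have "q j \<in> q ` {..<nv}" using j by simp
  then show v: "v < nv" using t by (simp add: topological_def v_def)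
  have inj: "inj_on q {..<nv}" using t by (simp add: topological_def)
  have f': "\<And>u. u < nv \<Longrightarrow> p u = (if u \<in> q ` {Suc j..<nv} then lp u else 0)" "distinct xs"
    "set xs = {i. i < ne \<and> sc i \<in> q ` {Suc j..<nv} \<and> \<not> primary i}" using f by (simp_all add: finished_def)
  have "{j..<nv} = insert j {Suc j..<nv}" using j by auto
  then have ins: "q ` {j..<nv} = insert v (q ` {Suc j..<nv})" by (simp add: v_def)
  have nv: "v \<notin> q ` {Suc j..<nv}"
  proof
    assume "v \<in> q ` {Suc j..<nv}"
    then obtain b where b: "b \<in> {Suc j..<nv}" "q j = q b" by (auto simp: v_def)
    have "j = b" by (rule inj_onD[OF inj b(2)]) (use j b in simp_all)
    then show False using b(1) by simp
  qed
  show "finished q j p xs" if od: "od v = 0"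
  proof -
    have "sc i \<noteq> v" if "i < ne" for i using out_iff[OF v, of i] od that by simp
    then have "set xs = {i. i < ne \<and> sc i \<in> q ` {j..<nv} \<and> \<not> primary i}" unfolding f'(3) ins by auto
    then show ?thesis using f' lp_leaf[OF v od] nv by (simp add: finished_def ins)
  qed
  show "scan v (Suc (fe v)) (fe v) xs xs" if "0 < od v"
    using that f' nv by (auto simp: scan_def less_Suc_eq)
  show "p (tg i) = lp (tg i)" if i: "i < ne" "sc i = v"
    using t j i f'(1)[OF tg[OF i(1)]] by (simp add: topological_def v_def)
  show "finished q j (p(v := ln b + lp (tg b))) ys" if s: "scan v (fe v + od v) b xs ys"
  proof -
    note e = scan_end[OF v s]
    have "set ys = {i. i < ne \<and> sc i \<in> q ` {j..<nv} \<and> \<not> primary i}" unfolding e(3) f'(3) ins by blast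
    then show ?thesis using f'(1) e(1,4) by (simp add: finished_def ins)
  qed
qed

lemma wp_output:
  assumes "env r" and t: "topological q" and l: "\<And>v. v < nv \<Longrightarrow> l v = lm v"
    and Q: "\<And>r p z xs k'. env r \<Longrightarrow> r 1 = Suc (length xs) \<Longrightarrow> length xs \<le> ne \<Longrightarrow> distinct xs \<Longrightarrow>
      set xs = {i. i < ne \<and> \<not> primary i} \<Longrightarrow> stored (map edge_pair xs @ [(Suc (n - lp rt), 0)]) z \<Longrightarrow>
      k' \<le> k + 90 * nv + 90 * ne + 20 \<Longrightarrow> Q r (lay d l q p z) k'"
  shows "wp m B (output_code by_lex) Q r (lay d l q Z Z) k"
proof -
  \<comment> \<open>The out-degrees of the last \<open>s\<close> queue entries, which are treated in
    the first \<open>s\<close> rounds; over all rounds they sum to \<open>ne\<close>.\<close>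
  let ?o = "\<lambda>s. \<Sum>t<s. od (q (nv - Suc t))"
  let ?Inv = "\<lambda>s r H k'. env r \<and> r 20 = nv - s \<and> k' \<le> k + 3 + 90 * s + 90 * ?o s \<and>
    (\<exists>p z xs. H = lay d l q p z \<and> finished q (nv - s) p xs \<and> written xs r z)"
  define final where "final = elem 30 13 14 ;; emit 30 2"
  define body where "body = Basic (Sub 20 20 3) ;; elem 22 12 20 ;; field 23 7 22 2 ;; field 24 7 22 3 ;;
       Basic (Add 24 24 23) ;; elem 25 11 22 ;;
       Cond 23 24 (info by_lex 26 27 ;; incr 23 ;; scan_code by_lex ;; put 31 13 22 26) Skip"
  let ?r = "r(1 := 0, 15 := 5 * N, 20 := nv)"
  have "wp m B (Loop 2 20 body) (wp m B final Q) ?r (lay d l q Z Z) (k + 3)"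
  proof (rule wp_Loop[where Inv = ?Inv and n = nv])
    have "finished q nv Z []" by (simp add: finished_def)
    moreover have "written [] ?r Z" by (simp add: written_def stored_def)
    moreover have "env ?r" using assms(1) by (rule env_cong) simp
    ultimately show "?Inv 0 ?r (lay d l q Z Z) (k + 3)" by auto
  next
    fix s r H k' assume s: "s < nv" and "?Inv s r H k'"
    then obtain p z xs where inv: "env r" "r 20 = nv - s" "k' \<le> k + 3 + 90 * s + 90 * ?o s"
      "H = lay d l q p z" "finished q (nv - s) p xs" "written xs r z" by blast
    define j where "j = nv - Suc s"
    have j: "j < nv" "nv - s = Suc j" using s by (simp_all add: j_def)
    define v where "v = q j"
    note fs = finished_step[OF t j(1) inv(5)[unfolded j(2)], folded v_def]
    have o: "?o (Suc s) = ?o s + od v" by (simp add: v_def j_def)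
    have vN: "v < N" "j < N" "l v = lm v" "lm v < B"
      using fs(1) j sizes l lm_n[OF fs(1)] bounds by auto
    define R where "R = (\<lambda>r h k. ?Inv (Suc s) r h (Suc k))"
    have R: "R r' (lay d l q p' z') k''" if "env r'" "r' 20 = j" "k'' \<le> k' + 80 + 90 * od v"
        "finished q j p' xs'" "written xs' r' z'" for r' p' z' xs' k''
      unfolding R_def o using that inv(3) by (auto simp: j_def)
    define r1 where "r1 = r(20 := j, 22 := v, 23 := fe v, 24 := od v + fe v, 25 := lm v)"
    have r1: "env r1" "written xs r1 z"
    proof -
      show "env r1" using inv(1) by (rule env_cong) (simp add: r1_def)
      show "written xs r1 z" using inv(6) by (simp add: written_def r1_def)
    qed
    have main: "wp m B (info by_lex 26 27 ;; incr 23 ;; scan_code by_lex ;; put 31 13 22 26) R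
        r1 (lay d l q p z) k''" if od: "0 < od v" and k'': "k'' \<le> k' + 25" for k''
    proof -
      have fe: "fe v < ne" "sc (fe v) = v" using out_iff[OF fs(1), of "fe v"] od by simp_all
      have "wp m B (info by_lex 26 27) (wp m B (incr 23) (wp m B (scan_code by_lex) (wp m B (put 31 13 22 26) R)))
          r1 (lay d l q p z) k''"
      proof (rule wp_info[where i = "fe v"])
        show "p (tg (fe v)) = lp (tg (fe v))" using fs(4) fe by blast
        fix r' kk assume r': "r' 26 = ln (fe v) + lp (tg (fe v))" "r' 27 = key (fe v)"
          "\<And>a. a \<notin> {26, 27, 31} \<Longrightarrow> r' a = r1 a" "kk \<le> k'' + 18"
        have "wp m B (scan_code by_lex) (wp m B (put 31 13 22 26) R) (r'(23 := Suc (fe v))) (lay d l q p z) (Suc kk)"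
        proof (rule wp_scan[OF fs(1,4) od _ _ _ _ _ _ _ _ fs(3)[OF od]])
          show "env (r'(23 := Suc (fe v)))" using r1(1) by (rule env_cong) (simp add: r')
          show "written xs (r'(23 := Suc (fe v))) z" using r1(2) r' by (simp add: written_def)
          fix r'' b ys z k2 assume a: "env r''" "r'' 20 = j" "r'' 22 = v" "scan v (fe v + od v) b xs ys"
            "r'' 26 = ln b + lp (tg b)" "written ys r'' z" "k2 \<le> Suc kk + 50 * od v"
          have "R (r''(31 := 4 * N + v)) (lay d l q (p(v := ln b + lp (tg b))) z) (k2 + 2)"
          proof (rule R)
            show "env (r''(31 := 4 * N + v))" using a(1) by (rule env_cong) simp
            show "written ys (r''(31 := 4 * N + v)) z" using a(6) by (simp add: written_def)
            show "finished q j (p(v := ln b + lp (tg b))) ys" using fs(5)[OF a(4)] .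
          qed (use a r'(4) k'' in simp_all)
          then show "wp m B (put 31 13 22 26) R r'' (lay d l q p z) k2"
            using a vN bounds(2,4) len by (simp add: env_def)
        qed (use r' in \<open>simp_all add: r1_def\<close>)
        moreover have "fe v + 1 < B" using fe sizes bounds len by simp
        ultimately show "wp m B (incr 23) (wp m B (scan_code by_lex) (wp m B (put 31 13 22 26) R)) r' (lay d l q p z) kk"
          using r'(3)[of 23] r'(3)[of 3] r1(1) by (simp add: r1_def env_def)
      qed (use r1 fe in \<open>simp_all add: r1_def\<close>)
      then show ?thesis by simp
    qed
    have "wp m B body R r H (Suc k')"
    proof (cases "od v = 0")
      case True
      have "R r1 (lay d l q p z) (19 + k')"
        by (rule R[OF r1(1) _ _ fs(2)[OF True] r1(2)]) (simp_all add: r1_def)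
      then show ?thesis
        using True inv(1,2) fs(1) j vN bounds(2,4) len sizes vertex_bounds[OF fs(1)]
        unfolding inv(4) body_def env_def r1_def
        by (simp flip: v_def)
    next
      case False
      then show ?thesis
        using inv(1,2) fs(1) j vN bounds(2,4) len sizes vertex_bounds[OF fs(1)] main[of "18 + k'"]
        unfolding inv(4) body_def env_def r1_def
        by (simp flip: v_def)
    qed
    moreover have "r 2 < r 20" using inv(1,2) s by (simp add: env_def)
    ultimately show "r 2 < r 20 \<and> wp m B body (\<lambda>r h k. ?Inv (Suc s) r h (Suc k)) r H (Suc k')"
      by (simp add: R_def)
  next
    fix r H k' assume "?Inv nv r H k'"
    then obtain p z xs where inv: "env r" "r 20 = 0" "k' \<le> k + 3 + 90 * nv + 90 * ?o nv"
      "H = lay d l q p z" "finished q 0 p xs" "written xs r z" by auto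
    have "?o nv = (\<Sum>j<nv. od (q j))" by (rule sum.nat_diff_reindex)
    also have "\<dots> = ne" using sum_out t by (simp add: topological_def)
    finally have k': "k' \<le> k + 3 + 90 * nv + 90 * ne" using inv(3) by simp
    have q: "q ` {0..<nv} = {..<nv}" using t by (simp add: topological_def atLeast0LessThan)
    have fin: "p rt = lp rt" "distinct xs" "set xs = {i. i < ne \<and> \<not> primary i}"
      using inv(5) rt sc by (auto simp: finished_def q)
    have "card (set xs) \<le> card {..<ne}" by (rule card_mono) (use fin(3) in auto)
    then have lxs: "length xs \<le> ne" using distinct_card[OF fin(2)] by simp
    have w: "stored (map edge_pair xs) z" "r 1 = length xs" "r 15 = 5 * N + 2 * length xs"
      using inv(6) by (simp_all add: written_def)
    have "wp m B (emit 30 2) Q (r(30 := lp rt)) (lay d l q p z) (Suc (Suc (Suc (Suc k'))))"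
    proof (rule wp_emit[where a = "lp rt" and b = 0 and c = "length xs"])
      show "env (r(30 := lp rt))" using inv(1) by (rule env_cong) simp
      fix r' k'' assume r': "r' 15 = 5 * N + 2 * Suc (length xs)" "r' 1 = Suc (length xs)"
        "\<And>x. x \<notin> {30, 15, 1} \<Longrightarrow> r' x = (r(30 := lp rt)) x" "k'' \<le> Suc (Suc (Suc (Suc k'))) + 7"
      show "Q r' (lay d l q p (z(2 * length xs := Suc (n - lp rt), Suc (2 * length xs) := 0))) k''"
      proof (rule Q[where r = r' and xs = xs, OF _ r'(2) lxs fin(2,3)])
        show "env r'" using inv(1) by (rule env_cong) (simp add: r')
        show "stored (map edge_pair xs @ [(Suc (n - lp rt), 0)]) (z(2 * length xs := Suc (n - lp rt), Suc (2 * length xs) := 0))"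
          by (rule stored_snoc) (use w in simp_all)
      qed (use r' k' in simp)
    qed (use w lp_n[OF rt] lxs inv(1) bounds len in \<open>simp_all add: env_def\<close>)
    then show "\<not> r 2 < r 20 \<and> wp m B final Q r H (k' + 2)"
      using inv(1,2) fin(1) rt sizes bounds(2-4) len lp_n[OF rt] unfolding inv(4) final_def env_def
      by simp
  qed
  then show ?thesis using assms(1) bounds(2) len sizes
    by (simp add: output_code_def final_def body_def env_def eval_nat_numeral)
qed

lemma wp_program:
  assumes inj: "inj_on edge_pair {i. i < ne \<and> \<not> primary i}"
    and triv: "(Suc (n - lp rt), 0) \<notin> edge_pair ` {i. i < ne \<and> \<not> primary i}"
  shows "wp m B (glpf_program by_lex) (\<lambda>r h k. k \<le> 200 * N \<and> r 0 + 2 * r 1 \<le> m \<and>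
      (let ps = map (\<lambda>i. (h (r 0 + 2 * i), h (r 0 + 2 * i + 1))) [0..<r 1] in distinct ps \<and>
        set ps = insert (Suc (n - lp rt), 0) (edge_pair ` {i. i < ne \<and> \<not> primary i})))
    (\<lambda>_. 0) (\<lambda>a. if a < length I then I ! a else 0) 0"
    (is "wp m B _ ?Q _ _ _")
proof -
  \<comment> \<open>The bound adds up the phases: 18, \<open>20 * ne + 3\<close>,
    \<open>40 * nv + 40 * ne + 5\<close> and \<open>90 * nv + 90 * ne + 20\<close>. As
    \<open>3 * nv\<close> and \<open>3 * ne\<close> are at most \<open>N\<close> and
    \<open>N\<close> is at least 8, it is below \<open>200 * N\<close>.\<close>
  have Q: "?Q r (lay d l q p z) k" if a: "env r" "r 1 = Suc (length xs)" "length xs \<le> ne" "distinct xs"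
      "set xs = {i. i < ne \<and> \<not> primary i}" "stored (map edge_pair xs @ [(Suc (n - lp rt), 0)]) z"
      "k \<le> 46 + 150 * ne + 130 * nv" for r d l q p z k xs
  proof -
    let ?ps = "map edge_pair xs @ [(Suc (n - lp rt), 0)]"
    have "map (\<lambda>i. (lay d l q p z (r 0 + 2 * i), lay d l q p z (r 0 + 2 * i + 1))) [0..<r 1] = ?ps" (is "?m = _")
    proof (rule nth_equalityI)
      show "length ?m = length ?ps" using a(2) by simp
      fix i assume "i < length ?m"
      then have i: "i < length ?ps" "i < r 1" using a(2) by simp_all
      then have "z (2 * i) = fst (?ps ! i)" "z (Suc (2 * i)) = snd (?ps ! i)" using a(6) unfolding stored_def by blast+
      moreover have "r 0 = 5 * N" using a(1) by (simp add: env_def)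
      ultimately show "?m ! i = ?ps ! i" using i(2) by (simp add: prod_eq_iff del: upt_Suc)
    qed
    moreover have "distinct ?ps" using a(4,5) inj triv by (simp add: distinct_map)
    moreover have "r 0 + 2 * r 1 \<le> m" using a(1-3) sizes len bounds(4) by (simp add: env_def)
    ultimately show ?thesis using a(5,7) sizes len by (simp add: Let_def)
  qed
  have init: "(\<lambda>a. if a < length I then I ! a else 0) = lay Z Z Z Z Z"
    by (simp add: fun_eq_iff layout_def Let_def)
  show ?thesis unfolding init glpf_program_def wp.simps(3)
  proof (rule wp_setup)
    fix r and k :: nat assume "env r" "k \<le> 0 + 18"
    then show "wp m B count_code (wp m B sort_code (wp m B (output_code by_lex) ?Q)) r (lay Z Z Z Z Z) k"
    proof (elim wp_count)
      fix r d k' assume "env r" "indeg ne d" and k': "k' \<le> k + 20 * ne + 3"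
      then show "wp m B sort_code (wp m B (output_code by_lex) ?Q) r (lay d Z Z Z Z) k'"
      proof (elim wp_sort)
        fix r d l q k'' assume r: "env r" and kahn: "kahn (removed q nv) nv d l q" and k'': "k'' \<le> k' + 40 * nv + 40 * ne + 5"
        show "wp m B (output_code by_lex) ?Q r (lay d l q Z Z) k''"
        proof (rule wp_output[OF r kahn_topological[OF kahn]])
          fix r p z xs kk assume "env r" "r 1 = Suc (length xs)" "length xs \<le> ne" "distinct xs"
            "set xs = {i. i < ne \<and> \<not> primary i}" "stored (map edge_pair xs @ [(Suc (n - lp rt), 0)]) z"
            "kk \<le> k'' + 90 * nv + 90 * ne + 20"
          then show "?Q r (lay d l q p z) kk" using \<open>k \<le> 0 + 18\<close> k' k'' by (intro Q[of r xs z]) simp_all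
        qed
      qed
    qed
  qed
qed

end

section \<open>Running the program on the index\<close>

lemma (in cdawg) ordered_cdawg_le_pos: "ordered_cdawg T le_pos"
proof unfold_locales
  show "X = Y" if "suffix X T" "suffix Y T" "le_pos X Y" "le_pos Y X" for X Y
    using that by (metis le_pos_def le_antisym order_refl suffix_length_suffix suffix_order.antisym)
qed (auto simp: le_pos_def)

lemma le_lex_append: "le_lex (A @ X) (A @ Y) \<longleftrightarrow> le_lex X Y"
  by (induction A) (auto simp: le_lex_def)

lemma (in cdawg) ordered_cdawg_le_lex: "ordered_cdawg T le_lex"
proof unfold_locales
  show "le_lex X Y \<or> le_lex Y X" for X Y unfolding le_lex_def by (rule lexordp_eq_linear)
  show "le_lex X Y \<Longrightarrow> le_lex Y Z \<Longrightarrow> le_lex X Z" for X Y Z unfolding le_lex_def by (rule lexordp_eq_trans)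
  show "le_lex X Y \<Longrightarrow> le_lex Y X \<Longrightarrow> X = Y" for X Y unfolding le_lex_def by (rule lexordp_eq_antisym)
qed (rule le_lex_append)

locale indexed_cdawg = ordered_cdawg +
  fixes I :: "nat list" and \<nu> :: "nat \<Rightarrow> nat list set" and \<eta> :: "nat \<Rightarrow> nat list set edge"
    and by_lex :: bool
  assumes via: "self_index_via T I \<nu> \<eta>"
    and le_cases: "le = (if by_lex then le_lex else le_pos)"
begin

definition edge_key :: "nat list set edge \<Rightarrow> nat" where
  "edge_key f = (if by_lex then hd (lab f) else length T - length (lab f @ repr_plus le T (tgt f)))"

text \<open>The left-hand side is the length of \<open>canonical_suffix f\<close>. The bound keeps
  the truncated subtractions from the text length exact.\<close>

lemma edge_total: assumes "f \<in> edges T"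
  shows "length (lab f @ repr_plus le T (tgt f)) + length (repr_minus T (src f)) \<le> length T"
proof -
  have "suffix (canonical_suffix f) T" using canonical_suffix_Suf[OF assms] by (simp add: Suf_suffix)
  then have "length (canonical_suffix f) \<le> length T" by (rule suffix_length_le)
  then show ?thesis by (simp add: canonical_suffix_def)
qed

text \<open>For the text order, equal keys mean that two suffixes of \<open>T\<close> have equal
  lengths, hence are equal and share their first symbol; for the lexicographic order the key is the
  first symbol.\<close>

lemma edge_key_inj:
  assumes "f \<in> edges T" "g \<in> edges T" "src f = src g" "edge_key f = edge_key g" shows "f = g"
proof (rule edge_determ[OF T_nonempty assms(1-3)])
  show "hd (lab f) = hd (lab g)"
  proof (cases by_lex)
    case False
    let ?F = "lab f @ repr_plus le T (tgt f)" and ?G = "lab g @ repr_plus le T (tgt g)"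
    have "length ?F = length ?G"
      using assms(4) edge_total[OF assms(1)] edge_total[OF assms(2)] False unfolding edge_key_def by simp
    moreover have "suffix ?F T" "suffix ?G T"
      using U_plus_suffix[OF edge_nodes(1)[OF assms(1)] repr_plus_edge(1)[OF assms(1)]]
        U_plus_suffix[OF edge_nodes(1)[OF assms(2)] repr_plus_edge(1)[OF assms(2)]] by auto
    ultimately have "?F = ?G" by (metis suffix_length_suffix suffix_order.antisym order_refl)
    then show ?thesis by (metis assms(1,2) edge_lab_nonempty hd_append2)
  qed (use assms(4)[unfolded edge_key_def] in simp)
qed

text \<open>A primary edge begins the least continuation; the comparison is read off at the first
  symbols for \<open>le_lex\<close> and at the lengths for \<open>le_pos\<close>.\<close>

lemma edge_key_primary:
  assumes "f \<in> edges T" "g \<in> edges T" "src f = src g" "g \<in> EP_plus le T" shows "edge_key g \<le> edge_key f"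
proof -
  have le: "le (lab g @ repr_plus le T (tgt g)) (lab f @ repr_plus le T (tgt f))"
    using repr_plus_edge(2)[OF assms(1)] EP_plus_iff[OF assms(2)] assms(3,4) by simp
  show ?thesis
  proof (cases by_lex)
    case True
    obtain a A b B where "lab f = a # A" "lab g = b # B"
      using edge_lab_nonempty[OF assms(1)] edge_lab_nonempty[OF assms(2)] by (meson neq_Nil_conv)
    moreover have "le_lex (lab g @ repr_plus le T (tgt g)) (lab f @ repr_plus le T (tgt f))"
      using le True le_cases by metis
    ultimately show ?thesis using True unfolding edge_key_def le_lex_def by auto
  next
    case False
    then have "le_pos (lab g @ repr_plus le T (tgt g)) (lab f @ repr_plus le T (tgt f))"
      using le le_cases by metis
    then show ?thesis using False unfolding edge_key_def le_pos_def by simp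
  qed
qed

text \<open>A primary edge exists at the same source and has the least key, and keys are injective
  there; so a minimal key identifies it.\<close>

lemma edge_key_min_iff:
  assumes "f \<in> edges T"
  shows "f \<in> EP_plus le T \<longleftrightarrow> (\<forall>g\<in>edges T. src g = src f \<longrightarrow> edge_key f \<le> edge_key g)"
proof
  assume "f \<in> EP_plus le T"
  then show "\<forall>g\<in>edges T. src g = src f \<longrightarrow> edge_key f \<le> edge_key g" using edge_key_primary assms by blast
next
  assume a: "\<forall>g\<in>edges T. src g = src f \<longrightarrow> edge_key f \<le> edge_key g"
  obtain g where g: "g \<in> edges T" "src g = src f" "g \<in> EP_plus le T"
    using EP_plus_exists[OF edge_nodes(1)[OF assms] src_not_sink[OF assms]] by blast
  then have "edge_key f = edge_key g" using a edge_key_primary[OF assms g(1)] by (metis order_antisym)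
  then show "f \<in> EP_plus le T" using edge_key_inj[OF assms g(1)] g by simp
qed

abbreviation "nv \<equiv> I ! 1"
abbreviation "ne \<equiv> I ! 2"

text \<open>The entry of an edge does not contain its source. This function serves the specification
  only; the program knows the source because it scans the edges vertex by vertex.\<close>

definition source :: "nat \<Rightarrow> nat" where
  "source i = inv_into {..<nv} \<nu> (src (\<eta> i))"

lemma bij: "bij_betw \<nu> {..<nv} (nodes T)" "bij_betw \<eta> {..<ne} (edges T)"
  using via unfolding self_index_via_def Let_def by auto

lemma \<eta>_edge: "i < ne \<Longrightarrow> \<eta> i \<in> edges T"
  using bij_betw_apply[OF bij(2)] by simp

lemma edge_index: assumes "f \<in> edges T" obtains i where "i < ne" "f = \<eta> i"
  using bij(2) assms unfolding bij_betw_def by force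

lemma \<nu>_node: "v < nv \<Longrightarrow> \<nu> v \<in> nodes T"
  using bij_betw_apply[OF bij(1)] by simp

lemma \<nu>_inj: "v < nv \<Longrightarrow> u < nv \<Longrightarrow> \<nu> v = \<nu> u \<Longrightarrow> v = u"
  using inj_onD[OF bij_betw_imp_inj_on[OF bij(1)]] by simp

lemma \<eta>_inj: "i < ne \<Longrightarrow> j < ne \<Longrightarrow> \<eta> i = \<eta> j \<Longrightarrow> i = j"
  using inj_onD[OF bij_betw_imp_inj_on[OF bij(2)]] by simp

lemma source: assumes "i < ne" shows "source i < nv" "\<nu> (source i) = src (\<eta> i)"
proof -
  have "src (\<eta> i) \<in> \<nu> ` {..<nv}" using edge_nodes(1)[OF \<eta>_edge[OF assms]] bij(1) by (simp add: bij_betw_def)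
  then show "source i < nv" "\<nu> (source i) = src (\<eta> i)"
    unfolding source_def using inv_into_into[of _ \<nu> "{..<nv}"] f_inv_into_f[of _ \<nu> "{..<nv}"] by auto
qed

lemma source_eq_iff: "i < ne \<Longrightarrow> v < nv \<Longrightarrow> source i = v \<longleftrightarrow> src (\<eta> i) = \<nu> v"
  using source[of i] \<nu>_inj by metis

abbreviation "vertex_words v \<equiv> I ! 6 + 3 * v"
abbreviation "edge_words i \<equiv> I ! 7 + 3 * i"
abbreviation "min_len v \<equiv> length (repr_minus T (\<nu> v))"
abbreviation "plus_len v \<equiv> length (repr_plus le T (\<nu> v))"

lemma index_words:
  assumes "i < ne"
  shows "I ! edge_words i = hd (lab (\<eta> i))" "I ! (edge_words i + 1) = length (lab (\<eta> i))"
    "I ! (edge_words i + 2) < nv" "\<nu> (I ! (edge_words i + 2)) = tgt (\<eta> i)"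
  using self_index_viaD(9-12)[OF via assms] .

lemma layout_bounds: "8 \<le> length I" "I ! 0 = length I" "I ! 6 + 3 * nv \<le> length I" "I ! 7 + 3 * ne \<le> length I"
  using via unfolding self_index_via_def Let_def by auto

lemma min_len_recursion:
  assumes "v < nv" "v \<noteq> I ! 3"
  shows "\<exists>i<ne. I ! (edge_words i + 2) = v \<and> min_len v = min_len (source i) + I ! (edge_words i + 1)"
proof -
  have "\<nu> v \<noteq> root T" using assms \<nu>_inj[of v "I ! 3"] self_index_root_sink[OF via] by metis
  then obtain f where f: "f \<in> edges T" "tgt f = \<nu> v" "min_len v = length (repr_minus T (src f)) + length (lab f)"
    using repr_minus_recursion[OF \<nu>_node[OF assms(1)]] by blast
  then obtain i where i: "i < ne" "f = \<eta> i" using edge_index by metis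
  have "I ! (edge_words i + 2) = v" using \<nu>_inj[OF index_words(3)[OF i(1)] assms(1)] index_words(4)[OF i(1)] f(2) i(2) by simp
  moreover have "min_len v = min_len (source i) + I ! (edge_words i + 1)"
    using f(3) i(2) source(2)[OF i(1)] index_words(2)[OF i(1)] by simp
  ultimately show ?thesis using i(1) by blast
qed

lemma min_len_n: assumes "v < nv" shows "min_len v \<le> length T" "plus_len v \<le> length T"
proof -
  note n = \<nu>_node[OF assms]
  have "repr_minus T (\<nu> v) @ repr_plus le T (\<nu> v) \<in> Suf T"
    using U_minus_plus[OF n repr_minus_longest(1)[OF n]] repr_plus_least(1)[OF n] by blast
  then have "suffix (repr_minus T (\<nu> v) @ repr_plus le T (\<nu> v)) T" by (simp add: Suf_suffix)
  then have "length (repr_minus T (\<nu> v) @ repr_plus le T (\<nu> v)) \<le> length T" by (rule suffix_length_le)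
  then show "min_len v \<le> length T" "plus_len v \<le> length T" by simp_all
qed

definition key_word :: "nat \<Rightarrow> nat" where
  "key_word i = (if by_lex then I ! edge_words i
      else length T - (I ! (edge_words i + 1) + plus_len (I ! (edge_words i + 2))))"

lemma key_word_edge: "i < ne \<Longrightarrow> key_word i = edge_key (\<eta> i)"
  using index_words[of i] unfolding key_word_def edge_key_def by simp

lemma key_word_min_iff:
  assumes i: "i < ne"
  shows "\<eta> i \<in> EP_plus le T \<longleftrightarrow> (\<forall>j<ne. source j = source i \<longrightarrow> key_word i \<le> key_word j)"
proof -
  have "(\<forall>g\<in>edges T. src g = src (\<eta> i) \<longrightarrow> edge_key (\<eta> i) \<le> edge_key g) \<longleftrightarrow>
      (\<forall>j<ne. src (\<eta> j) = src (\<eta> i) \<longrightarrow> edge_key (\<eta> i) \<le> edge_key (\<eta> j))"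
    using \<eta>_edge by (metis edge_index)
  also have "\<dots> \<longleftrightarrow> (\<forall>j<ne. source j = source i \<longrightarrow> key_word i \<le> key_word j)"
    using i source key_word_edge \<nu>_inj by metis
  finally show ?thesis using edge_key_min_iff[OF \<eta>_edge[OF i]] by simp
qed

lemma keyed_dag:
  assumes "\<And>x. x \<in> set I \<Longrightarrow> x < B" "8 * length I \<le> B" "2 * length T + 2 \<le> B" "7 * length I \<le> m"
  shows "keyed_dag nv ne (I ! 3) (\<lambda>v. I ! vertex_words v) (\<lambda>v. I ! (vertex_words v + 1))
    (\<lambda>i. I ! (edge_words i + 1)) (\<lambda>i. I ! (edge_words i + 2)) source min_len
    I (length I) (length T) (I ! 6) (I ! 7) m B (\<lambda>i. I ! edge_words i) plus_len key_word by_lex"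
proof unfold_locales
  note rs = self_index_root_sink[OF via]
  show "I ! 3 < nv" using rs by simp
  show "source i < nv" if "i < ne" for i using source that by simp
  show "I ! (edge_words i + 2) < nv" if "i < ne" for i using index_words that by simp
  show "{i. i < ne \<and> source i = v} = {I ! vertex_words v..<I ! vertex_words v + I ! (vertex_words v + 1)}"
    if v: "v < nv" for v
  proof -
    have "{i. i < ne \<and> source i = v} = {i. i < ne \<and> src (\<eta> i) = \<nu> v}" using source_eq_iff[OF _ v] by blast
    then show ?thesis using self_index_viaD(8)[OF via v] by simp
  qed
  show "I ! (edge_words i + 2) \<noteq> I ! 3" if i: "i < ne" for i
    using index_words(4)[OF i] tgt_not_root[OF \<eta>_edge[OF i]] rs(1) by metis
  show "0 < I ! (edge_words i + 1)" if i: "i < ne" for i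
    using index_words(2)[OF i] edge_lab_nonempty[OF \<eta>_edge[OF i]] by simp
  show "min_len (I ! 3) = 0" using rs(1) repr_minus_root by simp
  show "min_len (source i) + I ! (edge_words i + 1) \<le> min_len (I ! (edge_words i + 2))" if i: "i < ne" for i
    using repr_minus_edge[OF \<eta>_edge[OF i]] index_words[OF i] source[OF i] by simp
  show "\<exists>i<ne. I ! (edge_words i + 2) = v \<and> min_len v = min_len (source i) + I ! (edge_words i + 1)"
    if "v < nv" "v \<noteq> I ! 3" for v using min_len_recursion that .
  show "I ! 5 = length T" using rs(5) .
  show "I ! a < B" if "a < length I" for a using assms(1) that by simp
  show "min_len v \<le> length T" "plus_len v \<le> length T" if "v < nv" for v using min_len_n[OF that] by auto
  show "key_word i = (if by_lex then I ! edge_words i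
      else length T - (I ! (edge_words i + 1) + plus_len (I ! (edge_words i + 2))))" for i
    by (simp add: key_word_def)
  show "i = j" if "i < ne" "j < ne" "source i = source j" "key_word i = key_word j" for i j
  proof -
    have "src (\<eta> i) = src (\<eta> j)" using source(2) that by metis
    then have "\<eta> i = \<eta> j" using edge_key_inj \<eta>_edge key_word_edge that by metis
    then show ?thesis using \<eta>_inj that by blast
  qed
  show "plus_len v = 0" if v: "v < nv" and o: "I ! (vertex_words v + 1) = 0" for v
  proof -
    have "\<nu> v = sink T"
    proof (rule ccontr)
      assume "\<nu> v \<noteq> sink T"
      then obtain f where f: "f \<in> edges T" "src f = \<nu> v" using EP_plus_exists[OF \<nu>_node[OF v]] by metis
      then obtain i where "i < ne" "src (\<eta> i) = \<nu> v" using edge_index by metis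
      then show False using self_index_viaD(8)[OF via v] o by auto
    qed
    then show ?thesis using repr_plus_sink by simp
  qed
  show "plus_len (source i) = I ! (edge_words i + 1) + plus_len (I ! (edge_words i + 2))"
    if i: "i < ne" and "\<And>j. j < ne \<Longrightarrow> source j = source i \<Longrightarrow> key_word i \<le> key_word j" for i
  proof -
    have "\<eta> i \<in> EP_plus le T" using key_word_min_iff[OF i] that(2) by blast
    then have "lab (\<eta> i) @ repr_plus le T (tgt (\<eta> i)) = repr_plus le T (src (\<eta> i))"
      using EP_plus_iff[OF \<eta>_edge[OF i]] by simp
    from arg_cong[OF this, of length] show ?thesis using index_words[OF i] source[OF i] by simp
  qed
  show "I ! (edge_words i + 1) + plus_len (I ! (edge_words i + 2)) + min_len (source i) \<le> length T" if i: "i < ne" for i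
    using edge_total[OF \<eta>_edge[OF i]] index_words[OF i] source[OF i] by simp
qed (use layout_bounds assms(2-) in simp_all)

lemma constructs_glpf:
  assumes "\<And>x. x \<in> set I \<Longrightarrow> x < 2 ^ w" "8 * length I \<le> 2 ^ w" "2 * length T + 2 \<le> 2 ^ w"
    "7 * length I \<le> m" "200 * length I \<le> t"
  shows "constructs (compile (glpf_program by_lex) 0) I (quasi_irreducible_GLPF le T) t m w"
proof -
  interpret K: keyed_dag nv ne "I ! 3" "\<lambda>v. I ! vertex_words v" "\<lambda>v. I ! (vertex_words v + 1)"
    "\<lambda>i. I ! (edge_words i + 1)" "\<lambda>i. I ! (edge_words i + 2)" source min_len
    I "length I" "length T" "I ! 6" "I ! 7" m "2 ^ w" "\<lambda>i. I ! edge_words i" plus_len key_word by_lex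
    by (rule keyed_dag) (use assms in auto)
  let ?S = "{i. i < ne \<and> \<not> K.primary i}"
  let ?g = "\<lambda>f. (length T + 1 - length (canonical_suffix f), length (repr_minus T (src f)))"
  let ?t = "(length T + 1 - length (repr_plus le T (root T)), 0)"
  have prim: "K.primary i \<longleftrightarrow> \<eta> i \<in> EP_plus le T" if "i < ne" for i
    using key_word_min_iff[OF that] that by (simp add: K.primary_def)
  have ES: "ES_plus le T = \<eta> ` ?S"
    unfolding ES_plus_def using prim \<eta>_edge by (auto elim!: edge_index)
  have pair: "K.edge_pair i = ?g (\<eta> i)" if i: "i < ne" for i
    unfolding K.edge_pair_def canonical_suffix_def
    using edge_total[OF \<eta>_edge[OF i]] index_words[OF i] source[OF i] by (simp add: Suc_diff_le ac_simps)
  have root: "\<nu> (I ! 3) = root T" using self_index_root_sink[OF via] by simp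
  have t: "(Suc (length T - plus_len (I ! 3)), 0) = ?t"
    using min_len_n(2)[OF self_index_root_sink(3)[OF via]] by (simp add: root Suc_diff_le)
  \<comment> \<open>The position alone separates the pairs, since it determines the suffix; this
    gives the distinctness required of the output.\<close>
  have inj_g: "f = g" if "f \<in> ES_plus le T" "g \<in> ES_plus le T" "fst (?g f) = fst (?g g)" for f g
  proof -
    have fg: "f \<in> edges T" "g \<in> edges T" using that by (auto simp: ES_plus_def)
    have "canonical_suffix f = canonical_suffix g"
      using inj_onD[OF inj_pos] that(3) canonical_suffix_Suf fg by (simp add: pos_def)
    then show ?thesis using inj_onD[OF inj_canonical_suffix] that by blast
  qed
  have "inj_on K.edge_pair ?S"
  proof (rule inj_onI)
    fix i j assume ij: "i \<in> ?S" "j \<in> ?S" "K.edge_pair i = K.edge_pair j"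
    then have "\<eta> i = \<eta> j" using inj_g[of "\<eta> i" "\<eta> j"] pair ES by auto
    then show "i = j" using \<eta>_inj ij by blast
  qed
  moreover have "(Suc (length T - plus_len (I ! 3)), 0) \<notin> K.edge_pair ` ?S" unfolding t
  proof
    assume "?t \<in> K.edge_pair ` ?S"
    then obtain i where i: "i \<in> ?S" "?t = K.edge_pair i" by blast
    then have "pos T (repr_plus le T (root T)) = pos T (canonical_suffix (\<eta> i))" using pair by (simp add: pos_def)
    then have "repr_plus le T (root T) = canonical_suffix (\<eta> i)"
      using inj_onD[OF inj_pos] repr_plus_root_Suf canonical_suffix_Suf \<eta>_edge i(1) by simp
    moreover have "\<eta> i \<in> ES_plus le T" unfolding ES using i(1) by (rule imageI)
    ultimately show False using canonical_suffix_neq_trivial by metis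
  qed
  moreover have "insert (Suc (length T - plus_len (I ! 3)), 0) (K.edge_pair ` ?S) = quasi_irreducible_GLPF le T"
  proof -
    have "K.edge_pair ` ?S = ?g ` ES_plus le T" unfolding ES image_image using pair by (intro image_cong) auto
    then show ?thesis unfolding quasi_irreducible_GLPF_eq t by simp
  qed
  ultimately have "wp m (2 ^ w) (glpf_program by_lex) (\<lambda>r h k. k \<le> 200 * length I \<and> r 0 + 2 * r 1 \<le> m \<and>
      (let ps = map (\<lambda>i. (h (r 0 + 2 * i), h (r 0 + 2 * i + 1))) [0..<r 1] in distinct ps \<and>
        set ps = quasi_irreducible_GLPF le T))
    (\<lambda>_. 0) (\<lambda>a. if a < length I then I ! a else 0) 0" using K.wp_program by simp
  then have "wp m (2 ^ w) (glpf_program by_lex) (\<lambda>r h k. k \<le> t \<and> r 0 + 2 * r 1 \<le> m \<and>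
      (let ps = map (\<lambda>i. (h (r 0 + 2 * i), h (r 0 + 2 * i + 1))) [0..<r 1] in distinct ps \<and>
        set ps = quasi_irreducible_GLPF le T))
    (\<lambda>_. 0) (\<lambda>a. if a < length I then I ! a else 0) 0"
    by (rule wp_mono) (use assms(5) in auto)
  then show ?thesis by (rule constructs_compileI) (use assms(4) in simp)
qed

end

theorem theorem2:
  fixes le :: "nat list \<Rightarrow> nat list \<Rightarrow> bool"
  assumes "le \<in> {le_lex, le_pos}"
  shows "(\<forall>T. terminated_text T \<longrightarrow>
            finite (quasi_irreducible_GLPF le T) \<and>
            card (quasi_irreducible_GLPF le T) \<le> cdawg_size T) \<and>
         (\<exists>P. \<forall>c. \<exists>C. \<forall>T I w.
            terminated_text T \<and> self_index T I \<and> length I \<le> c * cdawg_size T \<and>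
            (\<forall>x\<in>set I. x < 2 ^ w) \<longrightarrow>
            constructs P I (quasi_irreducible_GLPF le T)
              (C * cdawg_size T) (C * cdawg_size T) (w + C))"
proof -
  obtain by_lex where le: "le = (if by_lex then le_lex else le_pos)"
    using assms by (metis insertE singletonD)
  have ordered: "ordered_cdawg T le" if "terminated_text T" for T
    using cdawg.ordered_cdawg_le_lex[of T] cdawg.ordered_cdawg_le_pos[of T] that
    by (simp add: le cdawg_def)
  \<comment> \<open>The program depends on the order only, so it can be fixed before
    \<open>c\<close>. In the constant, \<open>200 * c\<close> covers the time and the
    \<open>7 * length I\<close> words of memory, and 4 the additional bits of a word.\<close>
  have "constructs (compile (glpf_program by_lex) 0) I (quasi_irreducible_GLPF le T)
      ((200 * c + 4) * cdawg_size T) ((200 * c + 4) * cdawg_size T) (w + (200 * c + 4))"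
    if T: "terminated_text T" and I: "self_index T I" "length I \<le> c * cdawg_size T" "\<forall>x\<in>set I. x < 2 ^ w"
    for c T I w
  proof -
    obtain \<nu> \<eta> where via: "self_index_via T I \<nu> \<eta>" using I(1) by (auto simp: self_index_def)
    interpret ordered_cdawg T le using ordered[OF T] .
    interpret indexed_cdawg T le I \<nu> \<eta> by_lex using via le by unfold_locales
    \<comment> \<open>The lengths of the index and of the text are themselves words of the index, so
      they fit into \<open>w\<close> bits; four more bits make room for \<open>8 * length I\<close>
      and \<open>2 * length T + 2\<close>.\<close>
    have "I ! 0 < 2 ^ w" "I ! 5 < 2 ^ w" using layout_bounds(1) by (auto intro!: bspec[OF I(3)] nth_mem)
    then have small: "length I < 2 ^ w" "length T < 2 ^ w"
      using layout_bounds(2) self_index_root_sink(5)[OF via] by simp_all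
    have "(2::nat) ^ (w + 4) \<le> 2 ^ (w + (200 * c + 4))" by (rule power_increasing) simp_all
    then have big: "16 * 2 ^ w \<le> (2::nat) ^ (w + (200 * c + 4))" by (simp add: power_add)
    have size: "200 * length I \<le> (200 * c + 4) * cdawg_size T" using I(2) by (simp add: algebra_simps)
    show ?thesis
    proof (rule constructs_glpf)
      show "x < 2 ^ (w + (200 * c + 4))" if "x \<in> set I" for x
        using I(3) that big by fastforce
    qed (use small big size in linarith)+
  qed
  then show ?thesis using ordered_cdawg.card_quasi_irreducible_GLPF[OF ordered] by blast
qed

end
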